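(* Let $G$ be a finite group, $p$ a prime, and $k$ a field of characteristic $p$. If $T$ is a simple $kG$-module in the principal block of $kG$, then there is a list of finitely generated $kG$-modules $k=V_1, V_2,\ldots, V_n=T$ (for some integer $n\geq 1$) such that for each $i=1,\ldots,n-1$ the modules $V_i$ and $V_{i+1}$ satisfy $$\mathrm{Ext}_{kG}^{f(i)}(V_i, V_{i+1})\neq 0,$$ where $f(i)$ is a positive integer for each $i=1,2,\ldots,n-1$.
   Context: All $kG$-modules are finitely generated left modules. The symbol $k$ also denotes the trivial $kG$-module. A block of a ring $A$ with identity is a primitive idempotent $e$ of the center $Z(A)$; an $A$-module $U$ belongs to (lies in) the block $e$ if $eU=U$. The principal block of $kG$ is the block to which the trivial module $k$ belongs. *)

theory Defs
  imports "HOL-Algebra.Algebra" "HOL-Computational_Algebra.Primes"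
begin

section \<open>Left modules over a not necessarily commutative ring\<close>

text \<open>The locale \<^locale>\<open>module\<close> of the library requires a commutative ring of scalars, so left modules are
  introduced here on top of the same record type. The fields \<open>mult\<close> and \<open>one\<close> which that record
  inherits from rings are irrelevant for modules.\<close>

locale left_module = R?: ring R + M?: abelian_group M
  for R :: "('a, 'r) ring_scheme" (structure) and M :: "('a, 'b, 'm) module_scheme" (structure) +
  assumes smult_closed [simp, intro]:
      "\<lbrakk>a \<in> carrier R; x \<in> carrier M\<rbrakk> \<Longrightarrow> a \<odot>\<^bsub>M\<^esub> x \<in> carrier M"
    and smult_l_distr:
      "\<lbrakk>a \<in> carrier R; b \<in> carrier R; x \<in> carrier M\<rbrakk> \<Longrightarrow>
      (a \<oplus>\<^bsub>R\<^esub> b) \<odot>\<^bsub>M\<^esub> x = a \<odot>\<^bsub>M\<^esub> x \<oplus>\<^bsub>M\<^esub> b \<odot>\<^bsub>M\<^esub> x"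
    and smult_r_distr:
      "\<lbrakk>a \<in> carrier R; x \<in> carrier M; y \<in> carrier M\<rbrakk> \<Longrightarrow>
      a \<odot>\<^bsub>M\<^esub> (x \<oplus>\<^bsub>M\<^esub> y) = a \<odot>\<^bsub>M\<^esub> x \<oplus>\<^bsub>M\<^esub> a \<odot>\<^bsub>M\<^esub> y"
    and smult_assoc1:
      "\<lbrakk>a \<in> carrier R; b \<in> carrier R; x \<in> carrier M\<rbrakk> \<Longrightarrow>
      (a \<otimes>\<^bsub>R\<^esub> b) \<odot>\<^bsub>M\<^esub> x = a \<odot>\<^bsub>M\<^esub> (b \<odot>\<^bsub>M\<^esub> x)"
    and smult_one [simp]:
      "x \<in> carrier M \<Longrightarrow> \<one>\<^bsub>R\<^esub> \<odot>\<^bsub>M\<^esub> x = x"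

definition fg_left_module ::
    "('a, 'r) ring_scheme \<Rightarrow> ('a, 'b, 'm) module_scheme \<Rightarrow> bool" where
  "fg_left_module A M \<longleftrightarrow> left_module A M \<and>
     (\<exists>S. finite S \<and> S \<subseteq> carrier M \<and>
          (\<forall>N. submodule N A M \<and> S \<subseteq> N \<longrightarrow> N = carrier M))"

definition simple_left_module ::
    "('a, 'r) ring_scheme \<Rightarrow> ('a, 'b, 'm) module_scheme \<Rightarrow> bool" where
  "simple_left_module A M \<longleftrightarrow> left_module A M \<and> carrier M \<noteq> {\<zero>\<^bsub>M\<^esub>} \<and>
     (\<forall>N. submodule N A M \<longrightarrow> N = {\<zero>\<^bsub>M\<^esub>} \<or> N = carrier M)"

text \<open>Homomorphisms are extensional functions, so that equality of homomorphisms is equality in HOL.\<close>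

definition mod_hom :: "('a, 'r) ring_scheme \<Rightarrow> ('a, 'b, 'm) module_scheme \<Rightarrow>
    ('a, 'c, 'n) module_scheme \<Rightarrow> ('b \<Rightarrow> 'c) set" where
  "mod_hom A M N = {h \<in> carrier M \<rightarrow>\<^sub>E carrier N.
     (\<forall>x\<in>carrier M. \<forall>y\<in>carrier M. h (x \<oplus>\<^bsub>M\<^esub> y) = h x \<oplus>\<^bsub>N\<^esub> h y) \<and>
     (\<forall>a\<in>carrier A. \<forall>x\<in>carrier M. h (a \<odot>\<^bsub>M\<^esub> x) = a \<odot>\<^bsub>N\<^esub> h x)}"

definition mod_isomorphic :: "('a, 'r) ring_scheme \<Rightarrow> ('a, 'b, 'm) module_scheme \<Rightarrow>
    ('a, 'c, 'n) module_scheme \<Rightarrow> bool" where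
  "mod_isomorphic A M N \<longleftrightarrow> (\<exists>h \<in> mod_hom A M N. bij_betw h (carrier M) (carrier N))"


section \<open>Projective resolutions and Ext\<close>

definition free_left_module ::
    "('a, 'r) ring_scheme \<Rightarrow> nat \<Rightarrow> ('a, nat \<Rightarrow> 'a) module" where
  "free_left_module A n =
     \<lparr>carrier = {..<n} \<rightarrow>\<^sub>E carrier A,
      monoid.mult = undefined, one = undefined,
      ring.zero = (\<lambda>i\<in>{..<n}. \<zero>\<^bsub>A\<^esub>),
      ring.add = (\<lambda>x y. \<lambda>i\<in>{..<n}. x i \<oplus>\<^bsub>A\<^esub> y i),
      smult = (\<lambda>a x. \<lambda>i\<in>{..<n}. a \<otimes>\<^bsub>A\<^esub> x i)\<rparr>"

text \<open>Finitely generated projective modules: direct summands of free modules of finite rank.\<close>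

definition fg_projective ::
    "('a, 'r) ring_scheme \<Rightarrow> ('a, 'b, 'm) module_scheme \<Rightarrow> bool" where
  "fg_projective A P \<longleftrightarrow> left_module A P \<and>
     (\<exists>n. \<exists>i \<in> mod_hom A P (free_left_module A n). \<exists>r \<in> mod_hom A (free_left_module A n) P.
        \<forall>x\<in>carrier P. r (i x) = x)"

text \<open>\<open>projective_resolution A V P d \<epsilon>\<close>: the sequence
  \<open>\<dots> \<rightarrow> P 2 \<rightarrow> P 1 \<rightarrow> P 0 \<rightarrow> V \<rightarrow> 0\<close> with maps \<open>d n : P (n + 1) \<rightarrow> P n\<close> and \<open>\<epsilon> : P 0 \<rightarrow> V\<close> is exact,
  and every \<open>P n\<close> is a finitely generated projective module. Over a left Noetherian ring (such as
  the group algebra of a finite group over a field) each finitely generated module has such a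
  resolution, and, up to isomorphism, its terms have carriers in the type \<^typ>\<open>nat \<Rightarrow> 'a\<close> of
  tuples over the ring.\<close>

definition projective_resolution ::
    "('a, 'r) ring_scheme \<Rightarrow> ('a, 'v, 'm) module_scheme \<Rightarrow> (nat \<Rightarrow> ('a, nat \<Rightarrow> 'a) module) \<Rightarrow>
     (nat \<Rightarrow> (nat \<Rightarrow> 'a) \<Rightarrow> (nat \<Rightarrow> 'a)) \<Rightarrow> ((nat \<Rightarrow> 'a) \<Rightarrow> 'v) \<Rightarrow> bool" where
  "projective_resolution A V P d \<epsilon> \<longleftrightarrow>
     (\<forall>n. fg_projective A (P n)) \<and>
     (\<forall>n. d n \<in> mod_hom A (P (Suc n)) (P n)) \<and>
     \<epsilon> \<in> mod_hom A (P 0) V \<and>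
     \<epsilon> ` carrier (P 0) = carrier V \<and>
     d 0 ` carrier (P 1) = {x \<in> carrier (P 0). \<epsilon> x = \<zero>\<^bsub>V\<^esub>} \<and>
     (\<forall>n. d (Suc n) ` carrier (P (Suc (Suc n))) = {x \<in> carrier (P (Suc n)). d n x = \<zero>\<^bsub>P n\<^esub>})"

definition Hom_cocycles ::
    "('a, 'r) ring_scheme \<Rightarrow> (nat \<Rightarrow> ('a, 'p) module) \<Rightarrow> (nat \<Rightarrow> 'p \<Rightarrow> 'p) \<Rightarrow>
     ('a, 'w, 'm) module_scheme \<Rightarrow> nat \<Rightarrow> ('p \<Rightarrow> 'w) set" where
  "Hom_cocycles A P d W n =
     {f \<in> mod_hom A (P n) W. \<forall>x\<in>carrier (P (Suc n)). f (d n x) = \<zero>\<^bsub>W\<^esub>}"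

fun Hom_coboundaries ::
    "('a, 'r) ring_scheme \<Rightarrow> (nat \<Rightarrow> ('a, 'p) module) \<Rightarrow> (nat \<Rightarrow> 'p \<Rightarrow> 'p) \<Rightarrow>
     ('a, 'w, 'm) module_scheme \<Rightarrow> nat \<Rightarrow> ('p \<Rightarrow> 'w) set" where
  "Hom_coboundaries A P d W 0 = {\<lambda>x\<in>carrier (P 0). \<zero>\<^bsub>W\<^esub>}"
| "Hom_coboundaries A P d W (Suc n) =
     (\<lambda>g. \<lambda>x\<in>carrier (P (Suc n)). g (d n x)) ` mod_hom A (P n) W"

text \<open>The group of \<open>n\<close>-cocycles of the complex \<open>Hom(P, W)\<close> under pointwise addition (the library
  writes quotient groups multiplicatively).\<close>

definition Hom_cocycle_group ::
    "('a, 'r) ring_scheme \<Rightarrow> (nat \<Rightarrow> ('a, 'p) module) \<Rightarrow> (nat \<Rightarrow> 'p \<Rightarrow> 'p) \<Rightarrow>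
     ('a, 'w, 'm) module_scheme \<Rightarrow> nat \<Rightarrow> ('p \<Rightarrow> 'w) monoid" where
  "Hom_cocycle_group A P d W n =
     \<lparr>carrier = Hom_cocycles A P d W n,
      monoid.mult = (\<lambda>f g. \<lambda>x\<in>carrier (P n). f x \<oplus>\<^bsub>W\<^esub> g x),
      one = (\<lambda>x\<in>carrier (P n). \<zero>\<^bsub>W\<^esub>)\<rparr>"

text \<open>\<open>Ext A n V W\<close> is the \<open>n\<close>-th cohomology group of \<open>Hom(P, W)\<close> for a chosen projective
  resolution \<open>P\<close> of \<open>V\<close>; up to isomorphism it does not depend on the choice. It is meaningful
  only when \<open>V\<close> has a resolution in the above sense, for instance when \<open>V\<close> is finitely generated
  and \<open>A\<close> is left Noetherian.\<close>

definition Ext :: "('a, 'r) ring_scheme \<Rightarrow> nat \<Rightarrow> ('a, 'v, 'm) module_scheme \<Rightarrow>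
    ('a, 'w, 'n) module_scheme \<Rightarrow> ((nat \<Rightarrow> 'a) \<Rightarrow> 'w) set monoid" where
  "Ext A n V W =
     (let (P, d, \<epsilon>) = (SOME (P, d, \<epsilon>). projective_resolution A V P d \<epsilon>)
      in Hom_cocycle_group A P d W n Mod Hom_coboundaries A P d W n)"

definition Ext_nonzero :: "('a, 'r) ring_scheme \<Rightarrow> nat \<Rightarrow> ('a, 'v, 'm) module_scheme \<Rightarrow>
    ('a, 'w, 'n) module_scheme \<Rightarrow> bool" where
  "Ext_nonzero A n V W \<longleftrightarrow> carrier (Ext A n V W) \<noteq> {\<one>\<^bsub>Ext A n V W\<^esub>}"


section \<open>Blocks\<close>

definition ring_center :: "('a, 'r) ring_scheme \<Rightarrow> 'a set" where
  "ring_center A = {z \<in> carrier A. \<forall>a\<in>carrier A. z \<otimes>\<^bsub>A\<^esub> a = a \<otimes>\<^bsub>A\<^esub> z}"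

text \<open>A block is a primitive idempotent of the center: a nonzero central idempotent that is not the
  sum of two nonzero orthogonal central idempotents.\<close>

definition block :: "('a, 'r) ring_scheme \<Rightarrow> 'a \<Rightarrow> bool" where
  "block A e \<longleftrightarrow> e \<in> ring_center A \<and> e \<noteq> \<zero>\<^bsub>A\<^esub> \<and> e \<otimes>\<^bsub>A\<^esub> e = e \<and>
     \<not> (\<exists>x\<in>ring_center A. \<exists>y\<in>ring_center A.
          x \<noteq> \<zero>\<^bsub>A\<^esub> \<and> y \<noteq> \<zero>\<^bsub>A\<^esub> \<and> x \<otimes>\<^bsub>A\<^esub> x = x \<and> y \<otimes>\<^bsub>A\<^esub> y = y \<and>
          x \<otimes>\<^bsub>A\<^esub> y = \<zero>\<^bsub>A\<^esub> \<and> e = x \<oplus>\<^bsub>A\<^esub> y)"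

definition belongs_to_block :: "('a, 'b, 'm) module_scheme \<Rightarrow> 'a \<Rightarrow> bool" where
  "belongs_to_block U e \<longleftrightarrow> (\<lambda>u. e \<odot>\<^bsub>U\<^esub> u) ` carrier U = carrier U"


section \<open>Group algebras\<close>

definition group_algebra ::
    "('k, 'r) ring_scheme \<Rightarrow> ('g, 's) monoid_scheme \<Rightarrow> ('g \<Rightarrow> 'k) ring" where
  "group_algebra K G =
     \<lparr>carrier = carrier G \<rightarrow>\<^sub>E carrier K,
      monoid.mult = (\<lambda>a b. \<lambda>x\<in>carrier G. \<Oplus>\<^bsub>K\<^esub>y\<in>carrier G. a y \<otimes>\<^bsub>K\<^esub> b (inv\<^bsub>G\<^esub> y \<otimes>\<^bsub>G\<^esub> x)),
      one = (\<lambda>x\<in>carrier G. if x = \<one>\<^bsub>G\<^esub> then \<one>\<^bsub>K\<^esub> else \<zero>\<^bsub>K\<^esub>),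
      ring.zero = (\<lambda>x\<in>carrier G. \<zero>\<^bsub>K\<^esub>),
      ring.add = (\<lambda>a b. \<lambda>x\<in>carrier G. a x \<oplus>\<^bsub>K\<^esub> b x)\<rparr>"

text \<open>The trivial module: every group element acts as the identity, so an element of the group
  algebra acts as its augmentation.\<close>

definition trivial_module ::
    "('k, 'r) ring_scheme \<Rightarrow> ('g, 's) monoid_scheme \<Rightarrow> ('g \<Rightarrow> 'k, 'k) module" where
  "trivial_module K G =
     \<lparr>carrier = carrier K, monoid.mult = monoid.mult K, one = \<one>\<^bsub>K\<^esub>, ring.zero = \<zero>\<^bsub>K\<^esub>, ring.add = ring.add K,
      smult = (\<lambda>a c. (\<Oplus>\<^bsub>K\<^esub>x\<in>carrier G. a x) \<otimes>\<^bsub>K\<^esub> c)\<rparr>"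

definition principal_block ::
    "('k, 'r) ring_scheme \<Rightarrow> ('g, 's) monoid_scheme \<Rightarrow> ('g \<Rightarrow> 'k) \<Rightarrow> bool" where
  "principal_block K G e \<longleftrightarrow>
     block (group_algebra K G) e \<and> belongs_to_block (trivial_module K G) e"

text \<open>The characteristic is the additive order of the unit element (0 if that order is infinite).\<close>

definition ring_characteristic :: "('k, 'r) ring_scheme \<Rightarrow> nat" where
  "ring_characteristic K = group.ord (add_monoid K) \<one>\<^bsub>K\<^esub>"

end

theory Submission
  imports Defs
begin

text \<open>
  Let \<open>A = kG\<close> with augmentation ideal \<open>I\<close>. Since the form \<open>(a, b) \<mapsto> (ab)(1)\<close> on \<open>A\<close> is symmetric and
  nondegenerate, \<open>T\<close> is isomorphic to a left ideal \<open>L\<close> of \<open>A\<close>. As the modules of the chain need not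
  be simple, three of them suffice: \<open>k\<close>, \<open>V = I \<oplus> A / L\<close> and \<open>T\<close>. Indeed, if \<open>Ext\<^sup>1(k, V) = 0\<close>, then
  \<open>V \<rightarrow> A \<oplus> A / L \<rightarrow> k\<close> splits, so \<open>k\<close> is projective; if \<open>Ext\<^sup>1(V, T) = 0\<close>, then
  \<open>L \<rightarrow> I \<oplus> A \<rightarrow> V\<close> splits, so \<open>T\<close> is projective. But a projective simple module \<open>S\<close> over a symmetric
  algebra is alone in its block: there is a central idempotent that acts as the identity on \<open>S\<close> and
  whose product with the annihilator of \<open>S\<close> is zero. As \<open>k\<close> and \<open>T\<close> lie in the same block, either
  splitting forces \<open>T \<cong> k\<close>, and then the chain with the single term \<open>k\<close> will do.
\<close>

section \<open>Elementary theory of left modules, homomorphisms and quotients\<close>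

section \<open>Left modules\<close>

text \<open>The middle module glues the sequences \<open>I -> A -> k\<close> and
  \<open>L -> A -> A / L\<close>: its summand \<open>I\<close> is linked to \<open>k\<close>, its
  summand \<open>A / L\<close> to \<open>T\<close>. In each of the two sequences the other summand
  rides along and does not disturb the splitting.

  All terms of the chain must have carriers in the single type \<open>nat => 'k\<close>, so images
  and quotients of submodules of \<open>A x A\<close> are copied into that type along injective
  encodings. \<open>Ext\<close> refers to one arbitrarily chosen resolution; its vanishing for that
  resolution already splits every extension.

  \<open>T\<close> is handled through a nonzero element \<open>t0\<close> and an element
  \<open>a0\<close> of \<open>A\<close> such that \<open>x t0 \<mapsto> x a0\<close> identifies
  \<open>T\<close> with \<open>L = A a0\<close>; the value \<open>aug a0\<close> decides between one
  term and three. The block idempotent satisfies \<open>aug e \<noteq> 0\<close> and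
  \<open>e a0 = a0\<close>. In the case \<open>aug a0 = 0\<close>, each splitting provides a central
  idempotent \<open>y\<close> for which exactly one of \<open>aug y\<close> and \<open>y a0\<close>
  vanishes, while primitivity of \<open>e\<close> forces \<open>e y = e\<close>; this is the
  contradiction in both cases.\<close>

context left_module
begin

lemma smult_l_null [simp]:
  assumes "x \<in> carrier M"
  shows "\<zero> \<odot>\<^bsub>M\<^esub> x = \<zero>\<^bsub>M\<^esub>"
proof -
  have "\<zero> \<odot>\<^bsub>M\<^esub> x \<oplus>\<^bsub>M\<^esub> \<zero> \<odot>\<^bsub>M\<^esub> x = \<zero> \<odot>\<^bsub>M\<^esub> x"
    using smult_l_distr[of \<zero> \<zero> x] assms by simp
  then show ?thesis
    using assms by (metis M.add.r_cancel_one' R.zero_closed smult_closed)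
qed

lemma smult_r_null [simp]:
  assumes "a \<in> carrier R"
  shows "a \<odot>\<^bsub>M\<^esub> \<zero>\<^bsub>M\<^esub> = \<zero>\<^bsub>M\<^esub>"
  using smult_assoc1[of a \<zero> "\<zero>\<^bsub>M\<^esub>"] assms by simp

lemma smult_minus_one:
  assumes "x \<in> carrier M"
  shows "(\<ominus> \<one>) \<odot>\<^bsub>M\<^esub> x = \<ominus>\<^bsub>M\<^esub> x"
proof -
  have "(\<ominus> \<one>) \<odot>\<^bsub>M\<^esub> x \<oplus>\<^bsub>M\<^esub> x = (\<ominus> \<one> \<oplus> \<one>) \<odot>\<^bsub>M\<^esub> x"
    using assms by (subst smult_l_distr) auto
  then show ?thesis
    using assms by (simp add: R.l_neg M.minus_equality)
qed

lemma smult_diff_distr: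
  assumes "a \<in> carrier R" "b \<in> carrier R" "x \<in> carrier M"
  shows "(a \<ominus> b) \<odot>\<^bsub>M\<^esub> x = a \<odot>\<^bsub>M\<^esub> x \<ominus>\<^bsub>M\<^esub> b \<odot>\<^bsub>M\<^esub> x"
proof -
  have "(\<ominus> b) \<odot>\<^bsub>M\<^esub> x \<oplus>\<^bsub>M\<^esub> b \<odot>\<^bsub>M\<^esub> x = \<zero>\<^bsub>M\<^esub>"
    using assms smult_l_distr[of "\<ominus> b" b x] by (simp add: R.l_neg)
  then have "(\<ominus> b) \<odot>\<^bsub>M\<^esub> x = \<ominus>\<^bsub>M\<^esub> (b \<odot>\<^bsub>M\<^esub> x)"
    using assms by (intro M.minus_equality[symmetric]) auto
  then show ?thesis
    using assms smult_l_distr[of a "\<ominus> b" x] by (simp add: a_minus_def)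
qed

text \<open>Negation is multiplication by the scalar \<open>-1\<close>, so closure under it follows
  from the other conditions.\<close>

lemma left_submoduleI:
  assumes "H \<subseteq> carrier M" "\<zero>\<^bsub>M\<^esub> \<in> H"
    and "\<And>x y. x \<in> H \<Longrightarrow> y \<in> H \<Longrightarrow> x \<oplus>\<^bsub>M\<^esub> y \<in> H"
    and "\<And>a x. a \<in> carrier R \<Longrightarrow> x \<in> H \<Longrightarrow> a \<odot>\<^bsub>M\<^esub> x \<in> H"
  shows "submodule H R M"
proof -
  have "\<ominus>\<^bsub>M\<^esub> x \<in> H" if "x \<in> H" for x
    using assms(4)[of "\<ominus> \<one>" x] assms(1) that smult_minus_one[of x] by auto
  then show ?thesis
    using assms
    by (intro submodule.intro subgroup.intro submodule_axioms.intro) (auto simp: a_inv_def)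
qed

lemma left_submoduleD:
  assumes "submodule H R M"
  shows "H \<subseteq> carrier M" "\<zero>\<^bsub>M\<^esub> \<in> H"
    and "\<And>x y. x \<in> H \<Longrightarrow> y \<in> H \<Longrightarrow> x \<oplus>\<^bsub>M\<^esub> y \<in> H"
    and "\<And>a x. a \<in> carrier R \<Longrightarrow> x \<in> H \<Longrightarrow> a \<odot>\<^bsub>M\<^esub> x \<in> H"
    and "\<And>x. x \<in> H \<Longrightarrow> \<ominus>\<^bsub>M\<^esub> x \<in> H"
    and "\<And>x y. x \<in> H \<Longrightarrow> y \<in> H \<Longrightarrow> x \<ominus>\<^bsub>M\<^esub> y \<in> H"
proof -
  interpret H: submodule H R M by fact
  show 1: "H \<subseteq> carrier M" "\<zero>\<^bsub>M\<^esub> \<in> H"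
    and 2: "\<And>x y. x \<in> H \<Longrightarrow> y \<in> H \<Longrightarrow> x \<oplus>\<^bsub>M\<^esub> y \<in> H"
    and 3: "\<And>a x. a \<in> carrier R \<Longrightarrow> x \<in> H \<Longrightarrow> a \<odot>\<^bsub>M\<^esub> x \<in> H"
    using H.subset H.one_closed H.m_closed H.smult_closed by auto
  show 4: "\<And>x. x \<in> H \<Longrightarrow> \<ominus>\<^bsub>M\<^esub> x \<in> H"
    using H.m_inv_closed by (simp add: a_inv_def)
  show "\<And>x y. x \<in> H \<Longrightarrow> y \<in> H \<Longrightarrow> x \<ominus>\<^bsub>M\<^esub> y \<in> H"
    using 2 4 by (simp add: a_minus_def)
qed

lemma submodule_carrier: "submodule (carrier M) R M"
  by (rule left_submoduleI) auto

lemma eq_of_minus_eq_zero: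
  assumes "x \<in> carrier M" "y \<in> carrier M"
  shows "x \<ominus>\<^bsub>M\<^esub> y = \<zero>\<^bsub>M\<^esub> \<longleftrightarrow> x = y"
  using assms by (metis M.add.inv_closed M.add.inv_equality M.minus_minus M.r_neg a_minus_def)

end

text \<open>\<open>W\<close> is only a record at the outset. Since each of its elements is some
  \<open>q x\<close>, each module axiom of \<open>W\<close> is the image of the same axiom of
  \<open>M\<close>.\<close>

lemma left_module_image:
  assumes "left_module R M" and surj: "q ` carrier M = carrier W"
    and add: "\<And>x y. x \<in> carrier M \<Longrightarrow> y \<in> carrier M \<Longrightarrow> q (x \<oplus>\<^bsub>M\<^esub> y) = q x \<oplus>\<^bsub>W\<^esub> q y"
    and smult: "\<And>a x. a \<in> carrier R \<Longrightarrow> x \<in> carrier M \<Longrightarrow> q (a \<odot>\<^bsub>M\<^esub> x) = a \<odot>\<^bsub>W\<^esub> q x"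
    and zero: "q \<zero>\<^bsub>M\<^esub> = \<zero>\<^bsub>W\<^esub>"
  shows "left_module R W"
proof -
  interpret M: left_module R M by fact
  have ex: "\<exists>x. x \<in> carrier M \<and> u = q x" if "u \<in> carrier W" for u
    using that surj by blast
  have closed: "q x \<in> carrier W" if "x \<in> carrier M" for x
    using that surj by blast
  note q = add[symmetric] smult[symmetric] zero[symmetric] closed
  show ?thesis
  proof (intro left_module.intro left_module_axioms.intro abelian_groupI)
    show "ring R" ..
    show "\<exists>v\<in>carrier W. v \<oplus>\<^bsub>W\<^esub> u = \<zero>\<^bsub>W\<^esub>" if "u \<in> carrier W" for u
    proof -
      obtain x where "x \<in> carrier M" "u = q x" using ex \<open>u \<in> carrier W\<close> by blast
      then show ?thesis
        by (intro bexI[of _ "q (\<ominus>\<^bsub>M\<^esub> x)"]) (simp_all add: q M.M.l_neg)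
    qed
  qed (auto dest!: ex simp: q M.smult_l_distr M.smult_r_distr M.smult_assoc1 M.M.a_ac)
qed

lemma left_module_submodule:
  assumes "left_module R M" "submodule H R M"
  shows "left_module R (M\<lparr>carrier := H\<rparr>)"
proof -
  interpret M: left_module R M by fact
  note H = M.left_submoduleD[OF assms(2)]
  show ?thesis
  proof (intro left_module.intro left_module_axioms.intro abelian_groupI)
    show "ring R" ..
    show "\<exists>y\<in>carrier (M\<lparr>carrier := H\<rparr>). y \<oplus>\<^bsub>M\<lparr>carrier := H\<rparr>\<^esub> x = \<zero>\<^bsub>M\<lparr>carrier := H\<rparr>\<^esub>"
      if "x \<in> carrier (M\<lparr>carrier := H\<rparr>)" for x
      using that H by (intro bexI[of _ "\<ominus>\<^bsub>M\<^esub> x"]) (auto simp: M.M.l_neg)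
  qed (use H in \<open>auto simp: subset_iff M.smult_l_distr M.smult_r_distr M.smult_assoc1
        M.M.a_ac\<close>)
qed

text \<open>Reduces finite generation of a restricted module to a statement about submodules of the
  ambient one.\<close>

lemma submodule_restrict_iff:
  assumes "left_module R M" "submodule H R M"
  shows "submodule N R (M\<lparr>carrier := H\<rparr>) \<longleftrightarrow> submodule N R M \<and> N \<subseteq> H"
proof -
  interpret M: left_module R M by fact
  interpret H: left_module R "M\<lparr>carrier := H\<rparr>"
    by (rule left_module_submodule) fact+
  note HD = M.left_submoduleD[OF assms(2)]
  show ?thesis
  proof (intro iffI conjI; (elim conjE)?)
    assume N: "submodule N R (M\<lparr>carrier := H\<rparr>)"
    note ND = H.left_submoduleD[OF N]
    show "N \<subseteq> H" using ND(1) by simp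
    show "submodule N R M"
      by (rule M.left_submoduleI) (use ND HD in auto)
  next
    assume N: "submodule N R M" and "N \<subseteq> H"
    show "submodule N R (M\<lparr>carrier := H\<rparr>)"
      by (rule H.left_submoduleI) (use M.left_submoduleD[OF N] \<open>N \<subseteq> H\<close> in auto)
  qed
qed

subsection \<open>Homomorphisms\<close>

lemma mod_homI:
  assumes "\<And>x. x \<in> carrier M \<Longrightarrow> h x \<in> carrier N" "h \<in> extensional (carrier M)"
    and "\<And>x y. x \<in> carrier M \<Longrightarrow> y \<in> carrier M \<Longrightarrow> h (x \<oplus>\<^bsub>M\<^esub> y) = h x \<oplus>\<^bsub>N\<^esub> h y"
    and "\<And>a x. a \<in> carrier R \<Longrightarrow> x \<in> carrier M \<Longrightarrow> h (a \<odot>\<^bsub>M\<^esub> x) = a \<odot>\<^bsub>N\<^esub> h x"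
  shows "h \<in> mod_hom R M N"
  using assms by (auto simp: mod_hom_def PiE_def)

lemma mod_hom_restrictI:
  assumes "left_module R M"
    and "\<And>x. x \<in> carrier M \<Longrightarrow> h x \<in> carrier N"
    and "\<And>x y. x \<in> carrier M \<Longrightarrow> y \<in> carrier M \<Longrightarrow> h (x \<oplus>\<^bsub>M\<^esub> y) = h x \<oplus>\<^bsub>N\<^esub> h y"
    and "\<And>a x. a \<in> carrier R \<Longrightarrow> x \<in> carrier M \<Longrightarrow> h (a \<odot>\<^bsub>M\<^esub> x) = a \<odot>\<^bsub>N\<^esub> h x"
  shows "restrict h (carrier M) \<in> mod_hom R M N"
proof -
  interpret M: left_module R M by fact
  show ?thesis using assms by (intro mod_homI) auto
qed

lemma mod_homD:
  assumes "h \<in> mod_hom R M N"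
  shows "\<And>x. x \<in> carrier M \<Longrightarrow> h x \<in> carrier N" "h \<in> extensional (carrier M)"
    and "\<And>x y. x \<in> carrier M \<Longrightarrow> y \<in> carrier M \<Longrightarrow> h (x \<oplus>\<^bsub>M\<^esub> y) = h x \<oplus>\<^bsub>N\<^esub> h y"
    and "\<And>a x. a \<in> carrier R \<Longrightarrow> x \<in> carrier M \<Longrightarrow> h (a \<odot>\<^bsub>M\<^esub> x) = a \<odot>\<^bsub>N\<^esub> h x"
  using assms by (auto simp: mod_hom_def PiE_def)

lemma mod_hom_zero:
  assumes "left_module R M" "left_module R N" "h \<in> mod_hom R M N"
  shows "h \<zero>\<^bsub>M\<^esub> = \<zero>\<^bsub>N\<^esub>"
proof -
  interpret M: left_module R M by fact
  interpret N: left_module R N by fact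
  show ?thesis
    using mod_homD(4)[OF assms(3), of "\<zero>\<^bsub>R\<^esub>" "\<zero>\<^bsub>M\<^esub>"] mod_homD(1)[OF assms(3)] by simp
qed

lemma mod_hom_minus:
  assumes "left_module R M" "left_module R N" "h \<in> mod_hom R M N" "x \<in> carrier M" "y \<in> carrier M"
  shows "h (x \<ominus>\<^bsub>M\<^esub> y) = h x \<ominus>\<^bsub>N\<^esub> h y"
proof -
  interpret M: left_module R M by fact
  interpret N: left_module R N by fact
  have "h (\<ominus>\<^bsub>M\<^esub> y) = \<ominus>\<^bsub>N\<^esub> h y"
    using mod_homD(4)[OF assms(3), of "\<ominus>\<^bsub>R\<^esub> \<one>\<^bsub>R\<^esub>" y] mod_homD(1)[OF assms(3)] assms(5)
    by (simp add: M.smult_minus_one N.smult_minus_one)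
  then show ?thesis
    using assms mod_homD(3)[OF assms(3)] by (simp add: a_minus_def)
qed

lemma mod_hom_compose:
  assumes "left_module R L" "f \<in> mod_hom R L M" "g \<in> mod_hom R M N"
  shows "(\<lambda>x\<in>carrier L. g (f x)) \<in> mod_hom R L N"
  by (intro mod_hom_restrictI[OF assms(1)])
    (simp_all add: mod_homD[OF assms(2)] mod_homD[OF assms(3)])

lemma submodule_image:
  assumes "left_module R M" "left_module R N" "h \<in> mod_hom R M N" "submodule H R M"
  shows "submodule (h ` H) R N"
proof -
  interpret M: left_module R M by fact
  interpret N: left_module R N by fact
  note H = M.left_submoduleD[OF assms(4)] and h = mod_homD[OF assms(3)]
  show ?thesis
  proof (rule N.left_submoduleI)
    show "\<zero>\<^bsub>N\<^esub> \<in> h ` H" using mod_hom_zero[OF assms(1-3)] H(2) by force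
    show "u \<oplus>\<^bsub>N\<^esub> v \<in> h ` H" if "u \<in> h ` H" "v \<in> h ` H" for u v
    proof -
      from that obtain x y where "x \<in> H" "u = h x" "y \<in> H" "v = h y" by blast
      then show ?thesis
        using H h(3)[of x y] by (intro image_eqI[of _ _ "x \<oplus>\<^bsub>M\<^esub> y"]) (auto simp: subset_eq)
    qed
    show "a \<odot>\<^bsub>N\<^esub> u \<in> h ` H" if "a \<in> carrier R" "u \<in> h ` H" for a u
    proof -
      from that obtain x where "x \<in> H" "u = h x" by blast
      then show ?thesis
        using H h(4)[of a x] that(1) by (intro image_eqI[of _ _ "a \<odot>\<^bsub>M\<^esub> x"]) (auto simp: subset_eq)
    qed
  qed (use h H in auto)
qed

lemma submodule_vimage:
  assumes "left_module R M" "left_module R N" "h \<in> mod_hom R M N" "submodule H R N"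
  shows "submodule {x \<in> carrier M. h x \<in> H} R M"
proof -
  interpret M: left_module R M by fact
  interpret N: left_module R N by fact
  show ?thesis
    by (rule M.left_submoduleI)
      (auto simp: mod_hom_zero[OF assms(1-3)] mod_homD[OF assms(3)] N.left_submoduleD[OF assms(4)])
qed

lemma submodule_zero:
  assumes "left_module R M"
  shows "submodule {\<zero>\<^bsub>M\<^esub>} R M"
proof -
  interpret M: left_module R M by fact
  show ?thesis by (rule M.left_submoduleI) auto
qed

lemma submodule_kernel:
  assumes "left_module R M" "left_module R N" "h \<in> mod_hom R M N"
  shows "submodule {x \<in> carrier M. h x = \<zero>\<^bsub>N\<^esub>} R M"
  using submodule_vimage[OF assms submodule_zero[OF assms(2)]] by simp

text \<open>Two preimages of \<open>v\<close> under \<open>\<pi>\<close> differ by an element of the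
  kernel of \<open>\<pi>\<close>, on which \<open>\<phi>\<close> vanishes; so \<open>\<phi>\<close>
  of an arbitrarily chosen preimage is well defined.\<close>

lemma mod_hom_factor:
  assumes "left_module R E" "left_module R V" "left_module R W"
    and \<pi>: "\<pi> \<in> mod_hom R E V" and surj: "\<pi> ` carrier E = carrier V"
    and \<phi>: "\<phi> \<in> mod_hom R E W"
    and ker: "\<And>x. x \<in> carrier E \<Longrightarrow> \<pi> x = \<zero>\<^bsub>V\<^esub> \<Longrightarrow> \<phi> x = \<zero>\<^bsub>W\<^esub>"
  shows "\<exists>s\<in>mod_hom R V W. \<forall>x\<in>carrier E. s (\<pi> x) = \<phi> x"
proof -
  interpret E: left_module R E by fact
  interpret V: left_module R V by fact
  interpret W: left_module R W by fact
  define s where "s = restrict (\<lambda>v. \<phi> (inv_into (carrier E) \<pi> v)) (carrier V)"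
  have s: "s (\<pi> x) = \<phi> x" if x: "x \<in> carrier E" for x
  proof -
    define x' where "x' = inv_into (carrier E) \<pi> (\<pi> x)"
    have x': "x' \<in> carrier E" "\<pi> x' = \<pi> x"
      unfolding x'_def using x by (auto intro: inv_into_into f_inv_into_f)
    then have "\<pi> (x' \<ominus>\<^bsub>E\<^esub> x) = \<zero>\<^bsub>V\<^esub>"
      using x mod_hom_minus[OF assms(1,2) \<pi>] mod_homD(1)[OF \<pi>] by (simp add: V.eq_of_minus_eq_zero)
    then have "\<phi> x' \<ominus>\<^bsub>W\<^esub> \<phi> x = \<zero>\<^bsub>W\<^esub>"
      using ker[of "x' \<ominus>\<^bsub>E\<^esub> x"] x' x mod_hom_minus[OF assms(1,3) \<phi>] by simp
    then have "\<phi> x' = \<phi> x"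
      using x x' mod_homD(1)[OF \<phi>] by (simp add: W.eq_of_minus_eq_zero)
    then show ?thesis
      using x mod_homD(1)[OF \<pi>] by (simp add: s_def x'_def)
  qed
  have ex: "\<exists>x. x \<in> carrier E \<and> u = \<pi> x" if "u \<in> carrier V" for u
    using that surj by blast
  have "s \<in> mod_hom R V W"
  proof (rule mod_homI)
    show "s \<in> extensional (carrier V)" by (simp add: s_def)
  qed (auto dest!: ex simp: s mod_homD[OF \<phi>] mod_homD(3,4)[OF \<pi>, symmetric])
  then show ?thesis using s by blast
qed

text \<open>Both modules are the quotient of \<open>E\<close> by the common kernel, and factoring
  each surjection through the other gives mutually inverse maps. The ends of the chain are
  identified with \<open>k\<close> and \<open>T\<close> in this way.\<close>

lemma mod_isomorphic_of_same_kernel: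
  assumes "left_module R E" "left_module R V" "left_module R W"
    and \<pi>: "\<pi> \<in> mod_hom R E V" "\<pi> ` carrier E = carrier V"
    and \<phi>: "\<phi> \<in> mod_hom R E W" "\<phi> ` carrier E = carrier W"
    and ker: "\<And>x. x \<in> carrier E \<Longrightarrow> \<pi> x = \<zero>\<^bsub>V\<^esub> \<longleftrightarrow> \<phi> x = \<zero>\<^bsub>W\<^esub>"
  shows "mod_isomorphic R V W"
proof -
  obtain s where s: "s \<in> mod_hom R V W" "\<And>x. x \<in> carrier E \<Longrightarrow> s (\<pi> x) = \<phi> x"
    using mod_hom_factor[OF assms(1-3) \<pi> \<phi>(1)] ker by blast
  obtain t where t: "t \<in> mod_hom R W V" "\<And>x. x \<in> carrier E \<Longrightarrow> t (\<phi> x) = \<pi> x"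
    using mod_hom_factor[OF assms(1,3,2) \<phi> \<pi>(1)] ker by blast
  have "bij_betw s (carrier V) (carrier W)"
    by (rule bij_betw_byWitness[where f' = t])
      (use s t in \<open>auto simp: \<pi>(2)[symmetric] \<phi>(2)[symmetric]\<close>)
  then show ?thesis using s(1) by (auto simp: mod_isomorphic_def)
qed

subsection \<open>Transport of structure\<close>

text \<open>The operations are computed on arbitrary preimages, so they make sense for any function
  \<open>q\<close>. If the fibres of \<open>q\<close> are the cosets of a submodule
  \<open>N\<close>, this is \<open>M / N\<close>, realised on whatever type \<open>q\<close> maps
  into.\<close>

definition image_module ::
    "('a, 'b, 'm) module_scheme \<Rightarrow> ('b \<Rightarrow> 'c) \<Rightarrow> ('a, 'c) module" where
  "image_module M q =
     \<lparr>carrier = q ` carrier M, monoid.mult = undefined, one = undefined, ring.zero = q \<zero>\<^bsub>M\<^esub>,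
      ring.add = (\<lambda>u v. q (inv_into (carrier M) q u \<oplus>\<^bsub>M\<^esub> inv_into (carrier M) q v)),
      smult = (\<lambda>a u. q (a \<odot>\<^bsub>M\<^esub> inv_into (carrier M) q u))\<rparr>"

lemma carrier_image_module [simp]: "carrier (image_module M q) = q ` carrier M"
  and zero_image_module [simp]: "\<zero>\<^bsub>image_module M q\<^esub> = q \<zero>\<^bsub>M\<^esub>"
  by (simp_all add: image_module_def)

lemma
  assumes "left_module R M" "submodule N R M"
    and q: "\<And>x y. x \<in> carrier M \<Longrightarrow> y \<in> carrier M \<Longrightarrow> q x = q y \<longleftrightarrow> x \<ominus>\<^bsub>M\<^esub> y \<in> N"
  shows left_module_image_module: "left_module R (image_module M q)"
    and restrict_in_mod_hom_image_module:
      "restrict q (carrier M) \<in> mod_hom R M (image_module M q)"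
    and image_module_eq_zero_iff:
      "\<And>x. x \<in> carrier M \<Longrightarrow> q x = \<zero>\<^bsub>image_module M q\<^esub> \<longleftrightarrow> x \<in> N"
proof -
  interpret M: left_module R M by fact
  note N = M.left_submoduleD[OF assms(2)]
  \<comment> \<open>The operations of \<open>image_module\<close> are evaluated at
    \<open>r x\<close>. As \<open>r x\<close> differs from \<open>x\<close> by an element of
    \<open>N\<close>, replacing one by the other in a sum or a multiple does not change the value of
    \<open>q\<close>.\<close>
  define r where "r = (\<lambda>x. inv_into (carrier M) q (q x))"
  have r: "r x \<in> carrier M" "q (r x) = q x" "r x \<ominus>\<^bsub>M\<^esub> x \<in> N" if "x \<in> carrier M" for x
  proof -
    show 1: "r x \<in> carrier M" "q (r x) = q x"
      unfolding r_def using that by (auto intro: inv_into_into f_inv_into_f)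
    show "r x \<ominus>\<^bsub>M\<^esub> x \<in> N" using 1 q that by blast
  qed
  have add: "q (x \<oplus>\<^bsub>M\<^esub> y) = q x \<oplus>\<^bsub>image_module M q\<^esub> q y" if "x \<in> carrier M" "y \<in> carrier M" for x y
  proof -
    have "r x \<oplus>\<^bsub>M\<^esub> r y \<ominus>\<^bsub>M\<^esub> (x \<oplus>\<^bsub>M\<^esub> y) = (r x \<ominus>\<^bsub>M\<^esub> x) \<oplus>\<^bsub>M\<^esub> (r y \<ominus>\<^bsub>M\<^esub> y)"
      using that r by (simp add: a_minus_def M.M.minus_add M.M.a_ac)
    then have "q (r x \<oplus>\<^bsub>M\<^esub> r y) = q (x \<oplus>\<^bsub>M\<^esub> y)"
      using q[of "r x \<oplus>\<^bsub>M\<^esub> r y" "x \<oplus>\<^bsub>M\<^esub> y"] r that N(3) by simp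
    then show ?thesis by (simp add: image_module_def r_def)
  qed
  have smult: "q (a \<odot>\<^bsub>M\<^esub> x) = a \<odot>\<^bsub>image_module M q\<^esub> q x" if "a \<in> carrier R" "x \<in> carrier M" for a x
  proof -
    have "(r x \<ominus>\<^bsub>M\<^esub> x) \<oplus>\<^bsub>M\<^esub> x = r x"
      using that r by (simp add: a_minus_def M.M.a_assoc M.M.l_neg)
    then have *: "a \<odot>\<^bsub>M\<^esub> r x = a \<odot>\<^bsub>M\<^esub> (r x \<ominus>\<^bsub>M\<^esub> x) \<oplus>\<^bsub>M\<^esub> a \<odot>\<^bsub>M\<^esub> x"
      using that r M.smult_r_distr[of a "r x \<ominus>\<^bsub>M\<^esub> x" x] by simp
    have "a \<odot>\<^bsub>M\<^esub> r x \<ominus>\<^bsub>M\<^esub> a \<odot>\<^bsub>M\<^esub> x = a \<odot>\<^bsub>M\<^esub> (r x \<ominus>\<^bsub>M\<^esub> x)"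
      unfolding * using that r by (simp add: a_minus_def M.M.a_assoc M.M.r_neg)
    then have "q (a \<odot>\<^bsub>M\<^esub> r x) = q (a \<odot>\<^bsub>M\<^esub> x)"
      using q[of "a \<odot>\<^bsub>M\<^esub> r x" "a \<odot>\<^bsub>M\<^esub> x"] r that N(4) by simp
    then show ?thesis by (simp add: image_module_def r_def)
  qed
  show "left_module R (image_module M q)"
    by (rule left_module_image[where q = q, OF assms(1)]) (auto simp: add smult)
  show "restrict q (carrier M) \<in> mod_hom R M (image_module M q)"
    by (rule mod_hom_restrictI[OF assms(1)]) (auto simp: add smult)
  show "q x = \<zero>\<^bsub>image_module M q\<^esub> \<longleftrightarrow> x \<in> N" if "x \<in> carrier M" for x
    using q[of x "\<zero>\<^bsub>M\<^esub>"] that M.M.minus_equality[of "\<zero>\<^bsub>M\<^esub>" "\<zero>\<^bsub>M\<^esub>"]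
    by (simp add: a_minus_def)
qed

subsection \<open>Finite generation\<close>

text \<open>The preimage of a submodule that contains the images of the generators contains the
  generators, hence is all of \<open>M\<close>.\<close>

lemma fg_left_module_image:
  assumes "fg_left_module R M" "left_module R N" "h \<in> mod_hom R M N" "h ` carrier M = carrier N"
  shows "fg_left_module R N"
proof -
  obtain S where S: "finite S" "S \<subseteq> carrier M"
    "\<And>H. submodule H R M \<Longrightarrow> S \<subseteq> H \<Longrightarrow> H = carrier M" and M: "left_module R M"
    using assms(1) by (auto simp: fg_left_module_def)
  interpret N: left_module R N by fact
  have "H = carrier N" if H: "submodule H R N" "h ` S \<subseteq> H" for H
  proof -
    have "{x \<in> carrier M. h x \<in> H} = carrier M"
      using S(2) H(2) by (intro S(3) submodule_vimage[OF M assms(2,3) H(1)]) auto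
    then have "h ` carrier M \<subseteq> H" by auto
    then show ?thesis using assms(4) N.left_submoduleD(1)[OF H(1)] by simp
  qed
  then show ?thesis
    unfolding fg_left_module_def
  proof (intro conjI exI[of _ "h ` S"] allI impI)
    show "h ` S \<subseteq> carrier N" using S(2) assms(4) by blast
  qed (use S(1) assms(2) in simp_all)
qed

section \<open>Lifting through surjections, and resolutions by free modules of finite rank\<close>

section \<open>Free modules and projective resolutions\<close>

lemma free_left_module_simps [simp]:
  "carrier (free_left_module A n) = {..<n} \<rightarrow>\<^sub>E carrier A"
  "\<zero>\<^bsub>free_left_module A n\<^esub> = (\<lambda>i\<in>{..<n}. \<zero>\<^bsub>A\<^esub>)"
  "x \<oplus>\<^bsub>free_left_module A n\<^esub> y = (\<lambda>i\<in>{..<n}. x i \<oplus>\<^bsub>A\<^esub> y i)"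
  "a \<odot>\<^bsub>free_left_module A n\<^esub> x = (\<lambda>i\<in>{..<n}. a \<otimes>\<^bsub>A\<^esub> x i)"
  by (simp_all add: free_left_module_def)

text \<open>Over the group algebra with index set \<open>{..<n}\<close> this is the free module;
  over the field \<open>K\<close> with index set \<open>carrier G\<close> or
  \<open>{..<n} \<times> carrier G\<close> it is the underlying vector space.\<close>

definition function_module :: "('a, 'r) ring_scheme \<Rightarrow> 'x set \<Rightarrow> ('a, 'x \<Rightarrow> 'a) module" where
  "function_module A I =
     \<lparr>carrier = I \<rightarrow>\<^sub>E carrier A, monoid.mult = undefined, one = undefined,
      ring.zero = (\<lambda>i\<in>I. \<zero>\<^bsub>A\<^esub>), ring.add = (\<lambda>x y. \<lambda>i\<in>I. x i \<oplus>\<^bsub>A\<^esub> y i),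
      smult = (\<lambda>a x. \<lambda>i\<in>I. a \<otimes>\<^bsub>A\<^esub> x i)\<rparr>"

lemma function_module_simps [simp]:
  "carrier (function_module A I) = I \<rightarrow>\<^sub>E carrier A"
  "\<zero>\<^bsub>function_module A I\<^esub> = (\<lambda>i\<in>I. \<zero>\<^bsub>A\<^esub>)"
  "x \<oplus>\<^bsub>function_module A I\<^esub> y = (\<lambda>i\<in>I. x i \<oplus>\<^bsub>A\<^esub> y i)"
  "a \<odot>\<^bsub>function_module A I\<^esub> x = (\<lambda>i\<in>I. a \<otimes>\<^bsub>A\<^esub> x i)"
  by (simp_all add: function_module_def)

lemma left_module_function:
  assumes "ring A"
  shows "left_module A (function_module A I)"
proof -
  interpret A: ring A by fact
  have mem: "x i \<in> carrier A" if "x \<in> I \<rightarrow>\<^sub>E carrier A" "i \<in> I" for x i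
    using that by auto
  note eqI = extensionalityI[of _ I]
  show ?thesis
  proof (intro left_module.intro left_module_axioms.intro abelian_groupI)
    show "\<exists>y\<in>carrier (function_module A I). y \<oplus>\<^bsub>function_module A I\<^esub> x = \<zero>\<^bsub>function_module A I\<^esub>"
      if "x \<in> carrier (function_module A I)" for x
      using that mem by (intro bexI[of _ "\<lambda>i\<in>I. \<ominus>\<^bsub>A\<^esub> x i"]) (auto intro!: eqI simp: A.l_neg)
  qed (use assms mem in \<open>auto intro!: eqI simp: PiE_iff A.a_ac A.m_assoc A.l_distr A.r_distr\<close>)
qed

lemma free_left_module_eq: "free_left_module A n = function_module A {..<n}"
  by (simp add: free_left_module_def function_module_def)

lemma left_module_free: "ring A \<Longrightarrow> left_module A (free_left_module A n)"
  unfolding free_left_module_eq by (rule left_module_function)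

definition free_basis :: "('a, 'r) ring_scheme \<Rightarrow> nat \<Rightarrow> nat \<Rightarrow> nat \<Rightarrow> 'a" where
  "free_basis A n i = (\<lambda>j\<in>{..<n}. if j = i then \<one>\<^bsub>A\<^esub> else \<zero>\<^bsub>A\<^esub>)"

lemma free_basis_closed:
  assumes "ring A"
  shows "free_basis A n i \<in> carrier (free_left_module A n)"
proof -
  interpret A: ring A by fact
  show ?thesis by (auto simp: free_basis_def)
qed

lemma free_basis_generates:
  assumes "ring A" "submodule N A (free_left_module A n)" "\<And>i. i < n \<Longrightarrow> free_basis A n i \<in> N"
  shows "N = carrier (free_left_module A n)"
proof -
  interpret A: ring A by fact
  interpret F: left_module A "free_left_module A n" by (rule left_module_free) fact
  note N = F.left_submoduleD[OF assms(2)]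
  have "x \<in> N" if x: "x \<in> {..<n} \<rightarrow>\<^sub>E carrier A" for x
  proof -
    have mem: "x i \<in> carrier A" if "i < n" for i using x that by auto
    \<comment> \<open>The coordinates of \<open>x\<close> are added one at a time; every truncation
      of \<open>x\<close> lies in \<open>N\<close>.\<close>
    have "(\<lambda>j\<in>{..<n}. if j < m then x j else \<zero>\<^bsub>A\<^esub>) \<in> N" if "m \<le> n" for m
      using that
    proof (induction m)
      case 0
      then show ?case using N(2) by (simp add: restrict_def)
    next
      case (Suc m)
      have "(\<lambda>j\<in>{..<n}. if j < Suc m then x j else \<zero>\<^bsub>A\<^esub>) =
        (\<lambda>j\<in>{..<n}. if j < m then x j else \<zero>\<^bsub>A\<^esub>) \<oplus>\<^bsub>free_left_module A n\<^esub>
        (x m \<odot>\<^bsub>free_left_module A n\<^esub> free_basis A n m)"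
        using Suc.prems mem
        by (auto simp: free_basis_def less_Suc_eq intro!: extensionalityI[of _ "{..<n}"])
      moreover have "x m \<odot>\<^bsub>free_left_module A n\<^esub> free_basis A n m \<in> N"
        using Suc.prems mem by (intro N(4) assms(3)) auto
      moreover have "(\<lambda>j\<in>{..<n}. if j < m then x j else \<zero>\<^bsub>A\<^esub>) \<in> N"
        using Suc by linarith
      ultimately show ?case by (metis N(3))
    qed
    then have "(\<lambda>j\<in>{..<n}. if j < n then x j else \<zero>\<^bsub>A\<^esub>) \<in> N" by blast
    also have "(\<lambda>j\<in>{..<n}. if j < n then x j else \<zero>\<^bsub>A\<^esub>) = restrict x {..<n}"
      by (rule restrict_ext) simp
    also have "\<dots> = x" using x by (rule PiE_restrict)
    finally show ?thesis .
  qed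
  then show ?thesis using N(1) by auto
qed

lemma (in left_module) finsum_smult_left:
  assumes "finite I" "a \<in> carrier R" "\<And>i. i \<in> I \<Longrightarrow> f i \<in> carrier M"
  shows "finsum M (\<lambda>i. a \<odot>\<^bsub>M\<^esub> f i) I = a \<odot>\<^bsub>M\<^esub> finsum M f I"
  using assms
proof (induction I rule: finite_induct)
  case (insert i I)
  then show ?case
    by (simp add: M.finsum_insert Pi_def smult_r_distr M.finsum_closed)
qed (simp add: M.finsum_empty)

lemma free_hom_exists:
  assumes "left_module A V" and y: "\<And>i. i < n \<Longrightarrow> y i \<in> carrier V"
  shows "\<exists>h\<in>mod_hom A (free_left_module A n) V. \<forall>i<n. h (free_basis A n i) = y i"
proof -
  interpret V: left_module A V by fact
  have F: "left_module A (free_left_module A n)" by (rule left_module_free) unfold_locales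
  define h where "h = restrict (\<lambda>x. \<Oplus>\<^bsub>V\<^esub>i\<in>{..<n}. x i \<odot>\<^bsub>V\<^esub> y i) (carrier (free_left_module A n))"
  have mem: "x i \<in> carrier A" if "x \<in> {..<n} \<rightarrow>\<^sub>E carrier A" "i < n" for x i
    using that by auto
  have "h \<in> mod_hom A (free_left_module A n) V"
    unfolding h_def
  proof (rule mod_hom_restrictI[OF F])
    fix x z assume x: "x \<in> carrier (free_left_module A n)" and z: "z \<in> carrier (free_left_module A n)"
    have "(\<Oplus>\<^bsub>V\<^esub>i\<in>{..<n}. (x \<oplus>\<^bsub>free_left_module A n\<^esub> z) i \<odot>\<^bsub>V\<^esub> y i) =
      (\<Oplus>\<^bsub>V\<^esub>i\<in>{..<n}. x i \<odot>\<^bsub>V\<^esub> y i \<oplus>\<^bsub>V\<^esub> z i \<odot>\<^bsub>V\<^esub> y i)"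
      using x z mem y by (intro V.M.finsum_cong') (auto simp: V.smult_l_distr)
    then show "(\<Oplus>\<^bsub>V\<^esub>i\<in>{..<n}. (x \<oplus>\<^bsub>free_left_module A n\<^esub> z) i \<odot>\<^bsub>V\<^esub> y i) =
      (\<Oplus>\<^bsub>V\<^esub>i\<in>{..<n}. x i \<odot>\<^bsub>V\<^esub> y i) \<oplus>\<^bsub>V\<^esub> (\<Oplus>\<^bsub>V\<^esub>i\<in>{..<n}. z i \<odot>\<^bsub>V\<^esub> y i)"
      using x z mem y by (simp add: V.M.finsum_addf Pi_def)
  next
    fix a x assume a: "a \<in> carrier A" and x: "x \<in> carrier (free_left_module A n)"
    have "(\<Oplus>\<^bsub>V\<^esub>i\<in>{..<n}. (a \<odot>\<^bsub>free_left_module A n\<^esub> x) i \<odot>\<^bsub>V\<^esub> y i) =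
      (\<Oplus>\<^bsub>V\<^esub>i\<in>{..<n}. a \<odot>\<^bsub>V\<^esub> (x i \<odot>\<^bsub>V\<^esub> y i))"
      using a x mem y by (intro V.M.finsum_cong') (auto simp: V.smult_assoc1)
    then show "(\<Oplus>\<^bsub>V\<^esub>i\<in>{..<n}. (a \<odot>\<^bsub>free_left_module A n\<^esub> x) i \<odot>\<^bsub>V\<^esub> y i) =
      a \<odot>\<^bsub>V\<^esub> (\<Oplus>\<^bsub>V\<^esub>i\<in>{..<n}. x i \<odot>\<^bsub>V\<^esub> y i)"
      using a x mem y V.finsum_smult_left[of "{..<n}" a "\<lambda>i. x i \<odot>\<^bsub>V\<^esub> y i"] by simp
  qed (use mem y in \<open>auto intro!: V.M.finsum_closed\<close>)
  moreover have "h (free_basis A n i) = y i" if "i < n" for i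
  proof -
    have "h (free_basis A n i) = (\<Oplus>\<^bsub>V\<^esub>j\<in>{..<n}. free_basis A n i j \<odot>\<^bsub>V\<^esub> y j)"
      using free_basis_closed[OF V.R.ring_axioms, of n i] by (simp add: h_def)
    also have "\<dots> = (\<Oplus>\<^bsub>V\<^esub>j\<in>{..<n}. if i = j then y j else \<zero>\<^bsub>V\<^esub>)"
      using y by (intro V.M.finsum_cong') (auto simp: free_basis_def)
    also have "\<dots> = y i"
      using that y by (intro V.M.finsum_singleton) auto
    finally show ?thesis .
  qed
  ultimately show ?thesis by blast
qed

text \<open>The set on which \<open>f\<close> and \<open>g\<close> agree is a submodule that
  contains the basis.\<close>

lemma free_hom_unique:
  assumes "left_module A V" "f \<in> mod_hom A (free_left_module A n) V"
    "g \<in> mod_hom A (free_left_module A n) V"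
    and "\<And>i. i < n \<Longrightarrow> f (free_basis A n i) = g (free_basis A n i)"
    and "x \<in> carrier (free_left_module A n)"
  shows "f x = g x"
proof -
  interpret V: left_module A V by fact
  interpret F: left_module A "free_left_module A n" by (rule left_module_free) unfold_locales
  note F0 = F.left_module_axioms
  have "submodule {x \<in> carrier (free_left_module A n). f x = g x} A (free_left_module A n)"
    by (rule F.left_submoduleI)
      (auto simp del: free_left_module_simps
        simp: mod_homD[OF assms(2)] mod_homD[OF assms(3)]
          mod_hom_zero[OF F0 assms(1,2)] mod_hom_zero[OF F0 assms(1,3)])
  from free_basis_generates[OF V.R.ring_axioms this]
  have "{x \<in> carrier (free_left_module A n). f x = g x} = carrier (free_left_module A n)"
    using assms(4) free_basis_closed[OF V.R.ring_axioms] by blast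
  then show ?thesis using assms(5) by blast
qed

lemma free_hom_lift:
  assumes "left_module A E" "left_module A V"
    and \<pi>: "\<pi> \<in> mod_hom A E V" "\<pi> ` carrier E = carrier V"
    and \<phi>: "\<phi> \<in> mod_hom A (free_left_module A n) V"
  shows "\<exists>\<psi>\<in>mod_hom A (free_left_module A n) E. \<forall>x\<in>carrier (free_left_module A n). \<pi> (\<psi> x) = \<phi> x"
proof -
  interpret V: left_module A V by fact
  let ?F = "free_left_module A n"
  have F: "left_module A ?F" by (rule left_module_free) unfold_locales
  note basis = free_basis_closed[OF V.R.ring_axioms]
  have "\<exists>y\<in>carrier E. \<pi> y = \<phi> (free_basis A n i)" for i
    using \<pi>(2) mod_homD(1)[OF \<phi> basis] by (metis imageE)
  then obtain y where y: "\<And>i. y i \<in> carrier E" "\<And>i. \<pi> (y i) = \<phi> (free_basis A n i)"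
    by metis
  obtain \<psi> where \<psi>: "\<psi> \<in> mod_hom A ?F E" "\<And>i. i < n \<Longrightarrow> \<psi> (free_basis A n i) = y i"
    using free_hom_exists[OF assms(1), of n y] y(1) by blast
  have "(\<lambda>x\<in>carrier ?F. \<pi> (\<psi> x)) x = \<phi> x" if "x \<in> carrier ?F" for x
    by (rule free_hom_unique[OF assms(2) mod_hom_compose[OF F \<psi>(1) \<pi>(1)] \<phi> _ that])
      (use y(2) \<psi>(2) basis in \<open>simp del: free_left_module_simps\<close>)
  then show ?thesis using \<psi>(1) by (intro bexI[of _ \<psi>]) (auto simp del: free_left_module_simps)
qed

text \<open>The composite of \<open>\<phi>\<close> with the retraction \<open>r\<close> lifts
  because its source is free; restricting the lift along \<open>i\<close> gives a lift of
  \<open>\<phi>\<close>.\<close>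

lemma fg_projective_lift:
  assumes "fg_projective A P" "left_module A E" "left_module A V"
    and \<pi>: "\<pi> \<in> mod_hom A E V" "\<pi> ` carrier E = carrier V"
    and \<phi>: "\<phi> \<in> mod_hom A P V"
  shows "\<exists>\<psi>\<in>mod_hom A P E. \<forall>x\<in>carrier P. \<pi> (\<psi> x) = \<phi> x"
proof -
  obtain n i r where P: "left_module A P" and i: "i \<in> mod_hom A P (free_left_module A n)"
    and r: "r \<in> mod_hom A (free_left_module A n) P" and ri: "\<And>x. x \<in> carrier P \<Longrightarrow> r (i x) = x"
    using assms(1) unfolding fg_projective_def by blast
  interpret V: left_module A V by fact
  let ?F = "free_left_module A n"
  have F: "left_module A ?F" by (rule left_module_free) unfold_locales
  obtain \<psi> where \<psi>: "\<psi> \<in> mod_hom A ?F E" "\<And>x. x \<in> carrier ?F \<Longrightarrow> \<pi> (\<psi> x) = \<phi> (r x)"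
    using free_hom_lift[OF assms(2,3) \<pi> mod_hom_compose[OF F r \<phi>]]
    by (auto simp del: free_left_module_simps)
  have "\<pi> ((\<lambda>x\<in>carrier P. \<psi> (i x)) x) = \<phi> x" if "x \<in> carrier P" for x
    using \<psi>(2)[OF mod_homD(1)[OF i that]] ri that by simp
  then show ?thesis using mod_hom_compose[OF P i \<psi>(1)] by blast
qed

lemma fg_projective_free:
  assumes "ring A"
  shows "fg_projective A (free_left_module A n)"
proof -
  have F: "left_module A (free_left_module A n)" by (rule left_module_free) fact
  interpret F: left_module A "free_left_module A n" by fact
  have "restrict (\<lambda>x. x) (carrier (free_left_module A n)) \<in>
      mod_hom A (free_left_module A n) (free_left_module A n)"
    by (rule mod_hom_restrictI[OF F]) auto
  then show ?thesis
    unfolding fg_projective_def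
    by (intro conjI exI[of _ n] bexI[of _ "restrict (\<lambda>x. x) (carrier (free_left_module A n))"] F) auto
qed

lemma fg_left_module_free_cover:
  assumes "fg_left_module A V"
  shows "\<exists>n. \<exists>h\<in>mod_hom A (free_left_module A n) V. h ` ({..<n} \<rightarrow>\<^sub>E carrier A) = carrier V"
proof -
  obtain S where S: "finite S" "S \<subseteq> carrier V"
    "\<And>H. submodule H A V \<Longrightarrow> S \<subseteq> H \<Longrightarrow> H = carrier V" and V: "left_module A V"
    using assms by (auto simp: fg_left_module_def)
  interpret V: left_module A V by fact
  obtain xs where xs: "set xs = S" using S(1) finite_list by blast
  define n where "n = length xs"
  have F: "left_module A (free_left_module A n)" by (rule left_module_free) unfold_locales
  obtain h where h: "h \<in> mod_hom A (free_left_module A n) V"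
    "\<And>i. i < n \<Longrightarrow> h (free_basis A n i) = xs ! i"
    using free_hom_exists[OF V, of n "\<lambda>i. xs ! i"] xs S(2) nth_mem[of _ xs]
    by (auto simp: n_def subset_eq simp del: nth_mem)
  have "h ` carrier (free_left_module A n) = carrier V"
  proof (rule S(3))
    show "submodule (h ` carrier (free_left_module A n)) A V"
      by (intro submodule_image[OF F V h(1)] left_module.submodule_carrier F)
    show "S \<subseteq> h ` carrier (free_left_module A n)"
    proof
      fix s assume "s \<in> S"
      then obtain i where "i < n" "s = xs ! i" using xs by (auto simp: n_def in_set_conv_nth)
      then have "s = h (free_basis A n i)" using h(2) by simp
      then show "s \<in> h ` carrier (free_left_module A n)"
        using free_basis_closed[OF V.R.ring_axioms] by blast
    qed
  qed
  then show ?thesis using h(1) by auto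
qed

text \<open>Stated for submodules of every free module of finite rank and not only for left ideals:
  these are the kernels to be covered in a resolution, and over the group algebra they are
  finite-dimensional spaces.\<close>

definition left_noetherian :: "('a, 'r) ring_scheme \<Rightarrow> bool" where
  "left_noetherian A \<longleftrightarrow> (\<forall>n N. submodule N A (free_left_module A n) \<longrightarrow>
     fg_left_module A (free_left_module A n\<lparr>carrier := N\<rparr>))"

lemma left_noetherian_cover:
  assumes "left_noetherian A" "submodule N A (free_left_module A n)" "ring A"
  shows "\<exists>m. \<exists>d\<in>mod_hom A (free_left_module A m) (free_left_module A n).
    d ` ({..<m} \<rightarrow>\<^sub>E carrier A) = N"
proof -
  interpret F: left_module A "free_left_module A n" by (rule left_module_free) fact
  have "fg_left_module A (free_left_module A n\<lparr>carrier := N\<rparr>)"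
    using assms by (simp add: left_noetherian_def)
  from fg_left_module_free_cover[OF this] obtain m d where
    d: "d \<in> mod_hom A (free_left_module A m) (free_left_module A n\<lparr>carrier := N\<rparr>)"
    "d ` ({..<m} \<rightarrow>\<^sub>E carrier A) = N" by auto
  have "d \<in> mod_hom A (free_left_module A m) (free_left_module A n)"
    using d(1) F.left_submoduleD(1)[OF assms(2)]
    by (auto simp: mod_hom_def simp del: free_left_module_simps)
  then show ?thesis using d(2) by blast
qed

lemma projective_resolution_exists:
  fixes A :: "('a, 'r) ring_scheme"
  assumes "ring A" "left_noetherian A" "fg_left_module A V"
  shows "\<exists>P d \<epsilon>. projective_resolution A V P d \<epsilon>"
proof -
  let ?F = "free_left_module A" and ?C = "\<lambda>n. {..<n} \<rightarrow>\<^sub>E carrier A"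
  let ?ker = "\<lambda>m n d. {x \<in> ?C n. d x = \<zero>\<^bsub>?F m\<^esub>}"
  note F = left_module_free[OF assms(1)]
  have V: "left_module A V" using assms(3) by (simp add: fg_left_module_def)
  obtain n0 \<epsilon> where \<epsilon>: "\<epsilon> \<in> mod_hom A (?F n0) V" "\<epsilon> ` ?C n0 = carrier V"
    using fg_left_module_free_cover[OF assms(3)] by blast
  obtain n1 d0 where d0: "d0 \<in> mod_hom A (?F n1) (?F n0)" "d0 ` ?C n1 = {x \<in> ?C n0. \<epsilon> x = \<zero>\<^bsub>V\<^esub>}"
    using left_noetherian_cover[OF assms(2) submodule_kernel[OF F V \<epsilon>(1)] assms(1)] by auto
  \<comment> \<open>A state \<open>(m, n, d)\<close> stands for a map \<open>d\<close> from rank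
    \<open>n\<close> to rank \<open>m\<close>; the ranks are chosen along with the map, since the
    number of generators of a kernel is not known beforehand. The clause for \<open>k = 0\<close>
    ties the first map to the kernel of \<open>\<epsilon>\<close>, and \<open>next'\<close> ties
    each later map to its predecessor.\<close>
  define good where "good = (\<lambda>k (m, n, d). d \<in> mod_hom A (?F n) (?F m) \<and>
    (k = (0::nat) \<longrightarrow> m = n0 \<and> d ` ?C n = {x \<in> ?C n0. \<epsilon> x = \<zero>\<^bsub>V\<^esub>}))"
  define next' where "next' = (\<lambda>k :: nat. \<lambda>(m, n, d) (m' :: nat, n', d' :: (nat \<Rightarrow> 'a) \<Rightarrow> nat \<Rightarrow> 'a). m' = n \<and> d' ` ?C n' = ?ker m n d)"
  have "\<exists>s. \<forall>k. good k (s k) \<and> next' k (s k) (s (Suc k))"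
  proof (rule dependent_nat_choice)
    show "\<exists>x. good 0 x" using d0 by (auto simp: good_def intro!: exI[of _ n0] exI[of _ n1] exI[of _ d0])
    show "\<exists>y. good (Suc k) y \<and> next' k x y" if "good k x" for x k
    proof -
      obtain m n d where x: "x = (m, n, d)" by (cases x)
      then have d: "d \<in> mod_hom A (?F n) (?F m)" using that by (simp add: good_def)
      obtain n' d' where "d' \<in> mod_hom A (?F n') (?F n)" "d' ` ?C n' = ?ker m n d"
        using left_noetherian_cover[OF assms(2) submodule_kernel[OF F F d] assms(1)] by auto
      then show ?thesis by (intro exI[of _ "(n, n', d')"]) (simp add: good_def next'_def x)
    qed
  qed
  then obtain s where s: "\<And>k. good k (s k)" "\<And>k. next' k (s k) (s (Suc k))" by blast
  define P where "P = (\<lambda>k. ?F (fst (s k)))"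
  define d where "d = (\<lambda>k. snd (snd (s k)))"
  have next_fst: "fst (s (Suc k)) = fst (snd (s k))" for k
    using s(2)[of k] by (auto simp: next'_def split: prod.splits)
  have "projective_resolution A V P d \<epsilon>"
    unfolding projective_resolution_def
  proof (intro conjI allI)
    show "fg_projective A (P k)" for k
      unfolding P_def by (rule fg_projective_free) fact
    show d: "d k \<in> mod_hom A (P (Suc k)) (P k)" for k
      using s(1)[of k] next_fst[of k] by (auto simp: good_def P_def d_def split: prod.splits)
    have [simp]: "fst (s 0) = n0" using s(1)[of 0] by (auto simp: good_def)
    show "\<epsilon> \<in> mod_hom A (P 0) V" "\<epsilon> ` carrier (P 0) = carrier V"
      using \<epsilon> by (simp_all add: P_def)
    show "d 0 ` carrier (P 1) = {x \<in> carrier (P 0). \<epsilon> x = \<zero>\<^bsub>V\<^esub>}"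
      using s(1)[of 0] next_fst[of 0] by (auto simp: good_def P_def d_def)
    show "d (Suc k) ` carrier (P (Suc (Suc k))) = {x \<in> carrier (P (Suc k)). d k x = \<zero>\<^bsub>P k\<^esub>}" for k
      using s(2)[of k] next_fst[of k] next_fst[of "Suc k"]
      by (cases "s k"; cases "s (Suc k)") (simp add: next'_def P_def d_def)
  qed
  then show ?thesis by blast
qed

section \<open>Vanishing of the first Ext group splits extensions\<close>

section \<open>Vanishing of the first extension group\<close>

text \<open>Existence of a resolution is what gives meaning to the choice made in
  \<open>Ext\<close>: without it \<open>SOME\<close> would return an arbitrary triple.\<close>

lemma Ext_eq_for_some_resolution:
  assumes "ring A" "left_noetherian A" "fg_left_module A V"
  shows "\<exists>P d \<epsilon>. projective_resolution A V P d \<epsilon> \<and>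
    Ext A n V W = Hom_cocycle_group A P d W n Mod Hom_coboundaries A P d W n"
proof -
  let ?res = "\<lambda>(P, d, \<epsilon>). projective_resolution A V P d \<epsilon>"
  obtain P d \<epsilon> where c: "(SOME x. ?res x) = (P, d, \<epsilon>)" by (cases "SOME x. ?res x")
  have "?res (SOME x. ?res x)"
    by (rule someI_ex) (use projective_resolution_exists[OF assms] in auto)
  then show ?thesis
    by (intro exI[of _ P] exI[of _ d] exI[of _ \<epsilon>]) (simp add: Ext_def c)
qed

text \<open>If the quotient is trivial, the coset of \<open>g\<close> is the set of coboundaries
  itself; and this coset contains \<open>0 + g = g\<close>, because the zero map is a
  coboundary.\<close>

lemma cocycle_is_coboundary:
  assumes W: "left_module A W" and "left_module A (P n)" "left_module A (P (Suc n))"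
    and "carrier (Hom_cocycle_group A P d W (Suc n) Mod Hom_coboundaries A P d W (Suc n)) =
      {\<one>\<^bsub>Hom_cocycle_group A P d W (Suc n) Mod Hom_coboundaries A P d W (Suc n)\<^esub>}"
    and d: "d n \<in> mod_hom A (P (Suc n)) (P n)"
    and g: "g \<in> Hom_cocycles A P d W (Suc n)"
  shows "g \<in> Hom_coboundaries A P d W (Suc n)"
proof -
  interpret W: left_module A W by fact
  let ?Z = "Hom_cocycle_group A P d W (Suc n)" and ?B = "Hom_coboundaries A P d W (Suc n)"
  let ?z = "\<lambda>x\<in>carrier (P (Suc n)). \<zero>\<^bsub>W\<^esub>"
  have "?B #>\<^bsub>?Z\<^esub> g \<in> carrier (?Z Mod ?B)"
    using g by (auto simp: FactGroup_def RCOSETS_def Hom_cocycle_group_def)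
  then have coset: "?B #>\<^bsub>?Z\<^esub> g = ?B" using assms(4) by simp
  have "restrict (\<lambda>_. \<zero>\<^bsub>W\<^esub>) (carrier (P n)) \<in> mod_hom A (P n) W"
    by (rule mod_hom_restrictI[OF assms(2)]) auto
  then have "(\<lambda>x\<in>carrier (P (Suc n)). restrict (\<lambda>_. \<zero>\<^bsub>W\<^esub>) (carrier (P n)) (d n x)) \<in> ?B"
    unfolding Hom_coboundaries.simps by (rule imageI)
  also have "(\<lambda>x\<in>carrier (P (Suc n)). restrict (\<lambda>_. \<zero>\<^bsub>W\<^esub>) (carrier (P n)) (d n x)) = ?z"
    using mod_homD(1)[OF d] by (intro restrict_ext) simp
  finally have mem: "?z \<otimes>\<^bsub>?Z\<^esub> g \<in> ?B #>\<^bsub>?Z\<^esub> g"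
    unfolding r_coset_def by blast
  have g': "g \<in> mod_hom A (P (Suc n)) W" using g by (simp add: Hom_cocycles_def)
  have "?z \<otimes>\<^bsub>?Z\<^esub> g = g"
    using mod_homD(1,2)[OF g']
    by (intro extensionalityI[of _ "carrier (P (Suc n))"]) (auto simp: Hom_cocycle_group_def)
  then show ?thesis using mem unfolding coset by simp
qed

text \<open>A lift of \<open>\<epsilon>\<close> to \<open>E\<close> carries the image of
  \<open>d 0\<close> into \<open>W\<close> and so defines a cocycle. Writing this as a coboundary
  allows the lift to be corrected until it vanishes on the kernel of \<open>\<epsilon>\<close> and
  descends to a section on \<open>V\<close>.\<close>

lemma split_of_Ext_one_zero:
  assumes "ring A" "left_noetherian A" "fg_left_module A V" "left_module A W" "left_module A E"
    and j: "j \<in> mod_hom A W E" "inj_on j (carrier W)"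
    and \<pi>: "\<pi> \<in> mod_hom A E V" "\<pi> ` carrier E = carrier V"
    and exact: "j ` carrier W = {x \<in> carrier E. \<pi> x = \<zero>\<^bsub>V\<^esub>}"
    and zero: "\<not> Ext_nonzero A 1 V W"
  shows "\<exists>s\<in>mod_hom A V E. \<forall>v\<in>carrier V. \<pi> (s v) = v"
proof -
  obtain P d \<epsilon> where res: "projective_resolution A V P d \<epsilon>"
    and Ext: "Ext A 1 V W = Hom_cocycle_group A P d W 1 Mod Hom_coboundaries A P d W 1"
    using Ext_eq_for_some_resolution[OF assms(1-3)] by blast
  have V: "left_module A V" using assms(3) by (simp add: fg_left_module_def)
  interpret V: left_module A V by fact
  interpret W: left_module A W by fact
  interpret E: left_module A E by fact
  have P: "fg_projective A (P n)" for n using res by (simp add: projective_resolution_def)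
  then have Pm: "left_module A (P n)" for n by (simp add: fg_projective_def)
  have d: "d n \<in> mod_hom A (P (Suc n)) (P n)" for n using res by (simp add: projective_resolution_def)
  have \<epsilon>: "\<epsilon> \<in> mod_hom A (P 0) V" "\<epsilon> ` carrier (P 0) = carrier V"
    "d 0 ` carrier (P 1) = {x \<in> carrier (P 0). \<epsilon> x = \<zero>\<^bsub>V\<^esub>}"
    and dd: "d 1 ` carrier (P 2) = {x \<in> carrier (P 1). d 0 x = \<zero>\<^bsub>P 0\<^esub>}"
    using res unfolding projective_resolution_def by (simp_all add: numeral_2_eq_2)
  obtain \<phi> where \<phi>: "\<phi> \<in> mod_hom A (P 0) E" "\<And>x. x \<in> carrier (P 0) \<Longrightarrow> \<pi> (\<phi> x) = \<epsilon> x"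
    using fg_projective_lift[OF P assms(5) V \<pi> \<epsilon>(1)] by blast
  \<comment> \<open>\<open>\<phi> (d 0 x)\<close> lies in the kernel of \<open>\<pi>\<close>, which
    is the image of \<open>j\<close>; pulled back along \<open>j\<close> it gives the
    cocycle.\<close>
  define g where "g = restrict (\<lambda>x. inv_into (carrier W) j (\<phi> (d 0 x))) (carrier (P 1))"
  have jg: "j (g x) = \<phi> (d 0 x)" "g x \<in> carrier W" if x: "x \<in> carrier (P 1)" for x
  proof -
    have "d 0 x \<in> carrier (P 0)" "\<epsilon> (d 0 x) = \<zero>\<^bsub>V\<^esub>" using \<epsilon>(3) x by auto
    then have "\<phi> (d 0 x) \<in> j ` carrier W"
      unfolding exact using \<phi>(2) mod_homD(1)[OF \<phi>(1)] by simp
    then show "j (g x) = \<phi> (d 0 x)" "g x \<in> carrier W"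
      using x by (auto simp: g_def f_inv_into_f inv_into_into)
  qed
  note W_eqI = inj_onD[OF j(2)]
  have d0: "d 0 \<in> mod_hom A (P 1) (P 0)" using d[of 0] by simp
  interpret P1: left_module A "P 1" by (rule Pm)
  have g: "g \<in> mod_hom A (P 1) W"
  proof (rule mod_homI)
    have closed: "x \<oplus>\<^bsub>P 1\<^esub> y \<in> carrier (P 1)" "a \<odot>\<^bsub>P 1\<^esub> x \<in> carrier (P 1)"
      if "x \<in> carrier (P 1)" "y \<in> carrier (P 1)" "a \<in> carrier A" for x y a
      using that by (auto simp del: One_nat_def)
    show "g (x \<oplus>\<^bsub>P 1\<^esub> y) = g x \<oplus>\<^bsub>W\<^esub> g y" if "x \<in> carrier (P 1)" "y \<in> carrier (P 1)" for x y
      by (rule W_eqI) (use that in \<open>simp_all add: jg mod_homD[OF j(1)] mod_homD[OF \<phi>(1)] mod_homD[OF d0] closed del: One_nat_def\<close>)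
    show "g (a \<odot>\<^bsub>P 1\<^esub> x) = a \<odot>\<^bsub>W\<^esub> g x" if "a \<in> carrier A" "x \<in> carrier (P 1)" for a x
      by (rule W_eqI) (use that in \<open>simp_all add: jg mod_homD[OF j(1)] mod_homD[OF \<phi>(1)] mod_homD[OF d0] closed del: One_nat_def\<close>)
  qed (simp_all add: jg, simp add: g_def)
  have "g \<in> Hom_cocycles A P d W 1"
  proof -
    have "g (d 1 x) = \<zero>\<^bsub>W\<^esub>" if x: "x \<in> carrier (P 2)" for x
    proof -
      have *: "d 1 x \<in> carrier (P 1)" "d 0 (d 1 x) = \<zero>\<^bsub>P 0\<^esub>" using dd x by auto
      show ?thesis
        by (rule W_eqI) (use * in \<open>simp_all add: jg mod_hom_zero[OF Pm assms(5) \<phi>(1)]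
          mod_hom_zero[OF assms(4,5) j(1)]\<close>)
    qed
    then show ?thesis using g by (simp add: Hom_cocycles_def numeral_2_eq_2)
  qed
  then have "g \<in> Hom_coboundaries A P d W (Suc 0)"
    using zero d[of 0] by (intro cocycle_is_coboundary[of A W P 0 d g] assms(4) Pm)
      (simp_all add: Ext_nonzero_def Ext del: Hom_coboundaries.simps one_FactGroup flip: One_nat_def)
  then obtain h where h: "h \<in> mod_hom A (P 0) W" "\<And>x. x \<in> carrier (P 1) \<Longrightarrow> g x = h (d 0 x)"
    by auto
  \<comment> \<open>\<open>j h\<close> agrees with \<open>\<phi>\<close> on the image of
    \<open>d 0\<close>, which is the kernel of \<open>\<epsilon>\<close>. Since
    \<open>\<pi> j = 0\<close>, the corrected map is still a lift of
    \<open>\<epsilon>\<close>.\<close>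
  define \<sigma> where "\<sigma> = restrict (\<lambda>x. \<phi> x \<ominus>\<^bsub>E\<^esub> j (h x)) (carrier (P 0))"
  note hom = mod_homD[OF \<phi>(1)] mod_homD[OF h(1)] mod_homD[OF j(1)]
  have "\<sigma> \<in> mod_hom A (P 0) E"
    unfolding \<sigma>_def
  proof (rule mod_hom_restrictI[OF Pm])
    fix x y assume xy: "x \<in> carrier (P 0)" "y \<in> carrier (P 0)"
    then show "\<phi> (x \<oplus>\<^bsub>P 0\<^esub> y) \<ominus>\<^bsub>E\<^esub> j (h (x \<oplus>\<^bsub>P 0\<^esub> y)) =
        (\<phi> x \<ominus>\<^bsub>E\<^esub> j (h x)) \<oplus>\<^bsub>E\<^esub> (\<phi> y \<ominus>\<^bsub>E\<^esub> j (h y))"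
      by (simp add: hom a_minus_def E.M.minus_add E.M.a_ac)
  next
    fix a x assume ax: "a \<in> carrier A" "x \<in> carrier (P 0)"
    then have "\<ominus>\<^bsub>E\<^esub> (a \<odot>\<^bsub>E\<^esub> j (h x)) = a \<odot>\<^bsub>E\<^esub> (\<ominus>\<^bsub>E\<^esub> j (h x))"
      using mod_hom_minus
      by (intro E.M.minus_equality) (simp_all add: hom E.smult_r_distr[symmetric] E.M.l_neg)
    then show "\<phi> (a \<odot>\<^bsub>P 0\<^esub> x) \<ominus>\<^bsub>E\<^esub> j (h (a \<odot>\<^bsub>P 0\<^esub> x)) = a \<odot>\<^bsub>E\<^esub> (\<phi> x \<ominus>\<^bsub>E\<^esub> j (h x))"
      using ax by (simp add: hom a_minus_def E.smult_r_distr)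
  qed (simp add: hom)
  moreover have "\<sigma> x = \<zero>\<^bsub>E\<^esub>" if x: "x \<in> carrier (P 0)" "\<epsilon> x = \<zero>\<^bsub>V\<^esub>" for x
  proof -
    have "x \<in> d 0 ` carrier (P 1)" unfolding \<epsilon>(3) using x by simp
    then obtain y where y: "y \<in> carrier (P 1)" "x = d 0 y" by blast
    then have "j (h x) = \<phi> x" using h(2)[of y] jg(1)[of y] by simp
    then show ?thesis using x by (simp add: \<sigma>_def hom E.eq_of_minus_eq_zero)
  qed
  ultimately obtain s where s: "s \<in> mod_hom A V E" "\<And>x. x \<in> carrier (P 0) \<Longrightarrow> s (\<epsilon> x) = \<sigma> x"
    using mod_hom_factor[OF Pm V assms(5) \<epsilon>(1,2)] by blast
  have "\<pi> (s v) = v" if "v \<in> carrier V" for v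
  proof -
    obtain x where x: "x \<in> carrier (P 0)" "v = \<epsilon> x" using \<epsilon>(2) \<open>v \<in> carrier V\<close> by blast
    have "\<pi> (\<phi> x \<ominus>\<^bsub>E\<^esub> j (h x)) = \<pi> (\<phi> x) \<ominus>\<^bsub>V\<^esub> \<pi> (j (h x))"
      using x by (intro mod_hom_minus[OF assms(5) V \<pi>(1)]) (auto simp: hom)
    moreover have "\<pi> (j (h x)) = \<zero>\<^bsub>V\<^esub>" using exact x hom by blast
    ultimately have "\<pi> (\<sigma> x) = \<epsilon> x \<ominus>\<^bsub>V\<^esub> \<zero>\<^bsub>V\<^esub>" using x by (simp add: \<sigma>_def \<phi>(2))
    then show ?thesis
      using x s(2) mod_homD(1)[OF \<epsilon>(1)] V.M.minus_equality[of "\<zero>\<^bsub>V\<^esub>" "\<zero>\<^bsub>V\<^esub>"] by (simp add: a_minus_def)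
  qed
  then show ?thesis using s(1) by blast
qed

section \<open>Gaussian elimination in coordinate spaces over a field\<close>

section \<open>Spaces of functions on a finite set\<close>

definition dot :: "('k, 'r) ring_scheme \<Rightarrow> 'x set \<Rightarrow> ('x \<Rightarrow> 'k) \<Rightarrow> ('x \<Rightarrow> 'k) \<Rightarrow> 'k" where
  "dot K I u v = (\<Oplus>\<^bsub>K\<^esub>i\<in>I. u i \<otimes>\<^bsub>K\<^esub> v i)"

text \<open>Used with the index set \<open>carrier G\<close> for duality in the group algebra, and
  with \<open>{..<n} \<times> carrier G\<close> for the Noetherian property.\<close>

locale function_space = K?: field K for K (structure) and I :: "'x set" +
  assumes finite_index: "finite I"
begin

abbreviation "V \<equiv> function_module K I"

text \<open>The value \<open>c\<close> is left general because in the group algebra the function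
  \<open>ind\<close> at the unit of the group is the scalar \<open>c\<close>.\<close>

definition ind :: "'x \<Rightarrow> 'a \<Rightarrow> 'x \<Rightarrow> 'a" where
  "ind i c = (\<lambda>j\<in>I. if i = j then c else \<zero>)"

sublocale V: left_module K V
  by (rule left_module_function) (rule K.ring_axioms)

lemma mem_carrier [simp]: "u \<in> I \<rightarrow>\<^sub>E carrier K \<Longrightarrow> i \<in> I \<Longrightarrow> u i \<in> carrier K"
  by auto

lemma dot_closed [simp]:
  "u \<in> I \<rightarrow>\<^sub>E carrier K \<Longrightarrow> v \<in> I \<rightarrow>\<^sub>E carrier K \<Longrightarrow> dot K I u v \<in> carrier K"
  unfolding dot_def by (intro K.finsum_closed) auto

lemma dot_commute:
  assumes "u \<in> I \<rightarrow>\<^sub>E carrier K" "v \<in> I \<rightarrow>\<^sub>E carrier K"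
  shows "dot K I u v = dot K I v u"
  unfolding dot_def using assms by (intro K.finsum_cong') (auto simp: K.m_comm)

lemma dot_add_left:
  assumes "u \<in> I \<rightarrow>\<^sub>E carrier K" "v \<in> I \<rightarrow>\<^sub>E carrier K" "w \<in> I \<rightarrow>\<^sub>E carrier K"
  shows "dot K I (u \<oplus>\<^bsub>V\<^esub> v) w = dot K I u w \<oplus> dot K I v w"
proof -
  have "dot K I (u \<oplus>\<^bsub>V\<^esub> v) w = (\<Oplus>i\<in>I. u i \<otimes> w i \<oplus> v i \<otimes> w i)"
    unfolding dot_def using assms by (intro K.finsum_cong') (auto simp: K.l_distr)
  also have "\<dots> = dot K I u w \<oplus> dot K I v w"
    unfolding dot_def using assms by (intro K.finsum_addf) auto
  finally show ?thesis .
qed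

lemma dot_smult_left:
  assumes "c \<in> carrier K" "u \<in> I \<rightarrow>\<^sub>E carrier K" "w \<in> I \<rightarrow>\<^sub>E carrier K"
  shows "dot K I (c \<odot>\<^bsub>V\<^esub> u) w = c \<otimes> dot K I u w"
proof -
  have "dot K I (c \<odot>\<^bsub>V\<^esub> u) w = (\<Oplus>i\<in>I. c \<otimes> (u i \<otimes> w i))"
    unfolding dot_def using assms by (intro K.finsum_cong') (auto simp: K.m_assoc)
  also have "\<dots> = c \<otimes> dot K I u w"
    unfolding dot_def using assms finite_index by (intro K.finsum_rdistr[symmetric]) auto
  finally show ?thesis .
qed

lemma dot_add_right:
  assumes "u \<in> I \<rightarrow>\<^sub>E carrier K" "v \<in> I \<rightarrow>\<^sub>E carrier K" "w \<in> I \<rightarrow>\<^sub>E carrier K"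
  shows "dot K I w (u \<oplus>\<^bsub>V\<^esub> v) = dot K I w u \<oplus> dot K I w v"
  using assms dot_add_left[OF assms] dot_commute[of w] V.M.add.m_closed[of u v]
  by (simp del: function_module_simps(3))

lemma ind_closed [simp]: "c \<in> carrier K \<Longrightarrow> ind i c \<in> I \<rightarrow>\<^sub>E carrier K"
  by (auto simp: ind_def)

lemma dot_ind:
  assumes "u \<in> I \<rightarrow>\<^sub>E carrier K" "i \<in> I" "c \<in> carrier K"
  shows "dot K I u (ind i c) = u i \<otimes> c"
proof -
  have "dot K I u (ind i c) = (\<Oplus>j\<in>I. if i = j then u j \<otimes> c else \<zero>)"
    unfolding dot_def using assms by (intro K.finsum_cong') (auto simp: ind_def)
  also have "\<dots> = u i \<otimes> c"
    using assms finite_index by (intro K.finsum_singleton) auto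
  finally show ?thesis .
qed

text \<open>The parameter of the elimination arguments, which induct on a set \<open>J\<close> of
  admissible indices.\<close>

definition supported :: "'x set \<Rightarrow> ('x \<Rightarrow> 'a) \<Rightarrow> bool" where
  "supported J u \<longleftrightarrow> (\<forall>i\<in>I - J. u i = \<zero>)"

lemma supported_empty:
  assumes "supported {} u" "u \<in> carrier V"
  shows "u = \<zero>\<^bsub>V\<^esub>"
  using assms by (intro extensionalityI[of _ I]) (auto simp: supported_def PiE_def)

lemma supported_Diff:
  assumes "supported (insert i J) u" "u i = \<zero>"
  shows "supported J u"
  using assms by (auto simp: supported_def)

text \<open>One elimination step with pivot \<open>m\<close> at index \<open>i\<close>; the multiple
  is \<open>c = u i / m i\<close>.\<close>

lemma support_eliminate:
  assumes "supported (insert i J) u" "supported (insert i J) m" "i \<in> I" "m i \<noteq> \<zero>"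
    and "u \<in> carrier V" "m \<in> carrier V"
  obtains c where "c \<in> carrier K" "supported J (u \<ominus>\<^bsub>V\<^esub> c \<odot>\<^bsub>V\<^esub> m)"
    and "(u \<ominus>\<^bsub>V\<^esub> c \<odot>\<^bsub>V\<^esub> m) i = \<zero>" "u = (u \<ominus>\<^bsub>V\<^esub> c \<odot>\<^bsub>V\<^esub> m) \<oplus>\<^bsub>V\<^esub> c \<odot>\<^bsub>V\<^esub> m"
proof
  let ?c = "u i \<otimes> inv (m i)"
  have mem: "u j \<in> carrier K" "m j \<in> carrier K" if "j \<in> I" for j using assms that by auto
  have inv: "inv (m i) \<in> carrier K" "inv (m i) \<otimes> m i = \<one>"
    using assms mem by (simp_all add: K.field_Units)
  show c: "?c \<in> carrier K" using mem inv assms(3) by simp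
  have minus: "\<ominus>\<^bsub>V\<^esub> (?c \<odot>\<^bsub>V\<^esub> m) = (\<lambda>j\<in>I. \<ominus> (?c \<otimes> m j))"
    using c mem by (intro V.M.minus_equality) (auto simp: K.l_neg)
  have eq: "(u \<ominus>\<^bsub>V\<^esub> ?c \<odot>\<^bsub>V\<^esub> m) j = u j \<ominus> ?c \<otimes> m j" if "j \<in> I" for j
    using that unfolding a_minus_def minus by simp
  show i: "(u \<ominus>\<^bsub>V\<^esub> ?c \<odot>\<^bsub>V\<^esub> m) i = \<zero>"
    using assms(3) inv mem[OF assms(3)] by (simp only: eq K.m_assoc) (simp add: a_minus_def K.r_neg)
  show "supported J (u \<ominus>\<^bsub>V\<^esub> ?c \<odot>\<^bsub>V\<^esub> m)"
    unfolding supported_def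
  proof
    fix j assume j: "j \<in> I - J"
    show "(u \<ominus>\<^bsub>V\<^esub> ?c \<odot>\<^bsub>V\<^esub> m) j = \<zero>"
    proof (cases "j = i")
      case False
      then have "u j = \<zero>" "m j = \<zero>" using j assms(1,2) by (auto simp: supported_def)
      then show ?thesis using j c by (simp only: eq DiffD1) (simp add: a_minus_def)
    qed (use i in simp)
  qed
  have "?c \<odot>\<^bsub>V\<^esub> m \<in> carrier V" using c assms(6) by (rule V.smult_closed)
  then show "u = (u \<ominus>\<^bsub>V\<^esub> ?c \<odot>\<^bsub>V\<^esub> m) \<oplus>\<^bsub>V\<^esub> ?c \<odot>\<^bsub>V\<^esub> m"
    using assms(5) unfolding a_minus_def
    by (simp add: V.M.a_assoc V.M.l_neg del: function_module_simps)
qed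

lemma subspace_vanishing_at:
  assumes M: "submodule M K V" and i: "i \<in> I"
  shows "submodule {m \<in> M. m i = \<zero>} K V"
proof -
  note MD = V.left_submoduleD[OF M]
  show ?thesis
    by (rule V.left_submoduleI) (use MD i in auto)
qed

text \<open>The vectors of \<open>M\<close> that vanish at \<open>i\<close> form a subspace with
  smaller support, and one pivot at \<open>i\<close> makes up the difference. Spanning is expressed
  through all subspaces containing \<open>B\<close>, which matches the definition of a finitely
  generated module.\<close>

lemma subspace_finitely_spanned:
  assumes M: "submodule M K V"
  shows "\<exists>B. finite B \<and> B \<subseteq> M \<and> (\<forall>N. submodule N K V \<and> B \<subseteq> N \<longrightarrow> M \<subseteq> N)"
proof -
  have "\<exists>B. finite B \<and> B \<subseteq> M \<and> (\<forall>N. submodule N K V \<and> B \<subseteq> N \<longrightarrow> M \<subseteq> N)"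
    if "finite J" "J \<subseteq> I" "submodule M K V" "\<And>m. m \<in> M \<Longrightarrow> supported J m" for J M
    using that
  proof (induction J arbitrary: M rule: finite_induct)
    case empty
    then have "M \<subseteq> {\<zero>\<^bsub>V\<^esub>}"
      using supported_empty V.left_submoduleD(1)[OF empty(2)] by blast
    then have "M \<subseteq> N" if "submodule N K V" for N
      using V.left_submoduleD(2)[OF that] by blast
    then show ?case by blast
  next
    case (insert i J M)
    note MD = V.left_submoduleD[OF insert.prems(2)]
    have i: "i \<in> I" using insert.prems by simp
    define M' where "M' = {m \<in> M. m i = \<zero>}"
    have "J \<subseteq> I" using insert.prems(1) by simp
    moreover have "submodule M' K V"
      unfolding M'_def by (rule subspace_vanishing_at[OF insert.prems(2) i])
    moreover have "supported J m" if "m \<in> M'" for m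
      using that insert.prems(3)[of m] supported_Diff[of i J m] by (simp add: M'_def)
    ultimately obtain B where B: "finite B" "B \<subseteq> M'"
      and BN: "\<forall>N. submodule N K V \<and> B \<subseteq> N \<longrightarrow> M' \<subseteq> N"
      using insert.IH[of M'] by auto
    show ?case
    proof (cases "M' = M")
      case True
      then show ?thesis using B BN by auto
    next
      case False
      then obtain m where m: "m \<in> M" "m i \<noteq> \<zero>" by (auto simp: M'_def)
      have "M \<subseteq> N" if N: "submodule N K V" "insert m B \<subseteq> N" for N
      proof
        fix u assume u: "u \<in> M"
        note ND = V.left_submoduleD[OF N(1)]
        obtain c where c: "c \<in> carrier K" "(u \<ominus>\<^bsub>V\<^esub> c \<odot>\<^bsub>V\<^esub> m) i = \<zero>"
          "u = (u \<ominus>\<^bsub>V\<^esub> c \<odot>\<^bsub>V\<^esub> m) \<oplus>\<^bsub>V\<^esub> c \<odot>\<^bsub>V\<^esub> m"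
          using support_eliminate[OF insert.prems(3)[OF u] insert.prems(3)[OF m(1)] i m(2)]
            u m(1) MD(1) by blast
        have "u \<ominus>\<^bsub>V\<^esub> c \<odot>\<^bsub>V\<^esub> m \<in> M'"
          using c u m MD(4,6) by (auto simp: M'_def)
        then have "u \<ominus>\<^bsub>V\<^esub> c \<odot>\<^bsub>V\<^esub> m \<in> N" using BN N by auto
        moreover have "c \<odot>\<^bsub>V\<^esub> m \<in> N" using ND(4) c(1) N(2) by blast
        ultimately show "u \<in> N" using c(3) ND(3) by metis
      qed
      moreover have "finite (insert m B)" "insert m B \<subseteq> M" using B m by (auto simp: M'_def)
      ultimately show ?thesis by (intro exI[of _ "insert m B"]) simp
    qed
  qed
  from this[of I M] show ?thesis using M finite_index by (auto simp: supported_def)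
qed

text \<open>By induction on the support: a functional that works for the vectors vanishing at
  \<open>i\<close> is corrected in its coordinate \<open>i\<close>. This is the equality of a
  subspace with its double orthogonal.\<close>

lemma subspace_separation:
  assumes M: "submodule M K V" and f: "f \<in> carrier V" "f \<notin> M"
  shows "\<exists>a\<in>carrier V. (\<forall>m\<in>M. dot K I m a = \<zero>) \<and> dot K I f a \<noteq> \<zero>"
proof -
  have "\<exists>a\<in>carrier V. (\<forall>m\<in>M. dot K I m a = \<zero>) \<and> dot K I f a \<noteq> \<zero>"
    if "finite J" "J \<subseteq> I" "submodule M K V" "\<And>m. m \<in> M \<Longrightarrow> supported J m"
      "f \<in> carrier V" "f \<notin> M" "supported J f" for J M f
    using that
  proof (induction J arbitrary: M f rule: finite_induct)
    case empty
    then show ?case using supported_empty V.left_submoduleD(2) by blast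
  next
    case (insert i J M f)
    note MD = V.left_submoduleD[OF insert.prems(2)]
    have i: "i \<in> I" using insert.prems by simp
    define M' where "M' = {m \<in> M. m i = \<zero>}"
    have M': "submodule M' K V"
      unfolding M'_def by (rule subspace_vanishing_at[OF insert.prems(2) i])
    have M'_supported: "supported J m" if "m \<in> M'" for m
      using that insert.prems(3)[of m] supported_Diff[of i J m] by (simp add: M'_def)
    have J: "J \<subseteq> I" using insert.prems(1) by simp
    consider "M' = M" "f i \<noteq> \<zero>" | "M' = M" "f i = \<zero>" | m where "m \<in> M" "m i \<noteq> \<zero>"
      by (auto simp: M'_def)
    then show ?case
    proof cases
      case 1
      have "dot K I m (ind i \<one>) = m i" if "m \<in> carrier V" for m
        using that i dot_ind[of m i \<one>] by simp
      then show ?thesis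
        using 1 insert.prems MD(1) by (intro bexI[of _ "ind i \<one>"]) (auto simp: M'_def subset_iff)
    next
      case 2
      with M' M'_supported have "submodule M K V" "\<And>m. m \<in> M \<Longrightarrow> supported J m" by simp_all
      with J show ?thesis
        using insert.prems(4,5) supported_Diff[OF insert.prems(6) 2(2)] by (rule insert.IH)
    next
      case (3 m)
      have m: "m \<in> carrier V" using 3 MD(1) by blast
      obtain c where c: "c \<in> carrier K" "supported J (f \<ominus>\<^bsub>V\<^esub> c \<odot>\<^bsub>V\<^esub> m)"
        "f = (f \<ominus>\<^bsub>V\<^esub> c \<odot>\<^bsub>V\<^esub> m) \<oplus>\<^bsub>V\<^esub> c \<odot>\<^bsub>V\<^esub> m" "(f \<ominus>\<^bsub>V\<^esub> c \<odot>\<^bsub>V\<^esub> m) i = \<zero>"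
        using support_eliminate[OF insert.prems(6) insert.prems(3)[OF 3(1)] i 3(2) insert.prems(4) m]
        by blast
      define f' where "f' = f \<ominus>\<^bsub>V\<^esub> c \<odot>\<^bsub>V\<^esub> m"
      have f': "f' \<in> carrier V"
        unfolding f'_def using V.M.minus_closed V.smult_closed c(1) m insert.prems(4) by blast
      have "f' \<notin> M'"
        using c(1,3) insert.prems(5) 3(1) MD(3,4) unfolding f'_def M'_def by (metis (lifting) mem_Collect_eq)
      then obtain a where a: "a \<in> carrier V" "\<And>m. m \<in> M' \<Longrightarrow> dot K I m a = \<zero>" "dot K I f' a \<noteq> \<zero>"
        using insert.IH[OF J M' M'_supported f'] c(2) unfolding f'_def by blast
      \<comment> \<open>\<open>t\<close> solves \<open>dot m a + m i t = 0\<close>. Changing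
        \<open>a\<close> at the index \<open>i\<close> does not affect its values on vectors
        vanishing there, in particular on \<open>M'\<close> and \<open>f'\<close>.\<close>
      define t where "t = \<ominus> (inv (m i) \<otimes> dot K I m a)"
      have mi: "m i \<in> carrier K" "inv (m i) \<in> carrier K" "m i \<otimes> inv (m i) = \<one>"
        using m i 3(2) by (auto simp: K.field_Units)
      have t: "t \<in> carrier K" "m i \<otimes> t = \<ominus> dot K I m a"
        using mi m a(1) by (simp_all add: t_def K.r_minus K.m_assoc[symmetric])
      define b where "b = a \<oplus>\<^bsub>V\<^esub> ind i t"
      have b: "b \<in> carrier V" "dot K I u b = dot K I u a \<oplus> u i \<otimes> t" if "u \<in> carrier V" for u
      proof -
        show "b \<in> carrier V"
          unfolding b_def using a(1) t(1) by (intro V.M.a_closed) auto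
        show "dot K I u b = dot K I u a \<oplus> u i \<otimes> t"
          unfolding b_def using that a(1) t(1) i by (simp only: dot_add_right function_module_simps(1) ind_closed dot_ind)
      qed
      have bm: "dot K I m b = \<zero>" using b(2)[OF m] t m a(1) by (simp add: K.r_neg)
      have bM': "dot K I u b = \<zero>" if "u \<in> M'" for u
        using b(2)[of u] a(2)[OF that] that MD(1) t(1) by (auto simp: M'_def)
      have b_elim: "dot K I u b = dot K I (u \<ominus>\<^bsub>V\<^esub> c \<odot>\<^bsub>V\<^esub> m) b"
        if u: "u \<in> carrier V" and c: "c \<in> carrier K"
          and eq: "u = (u \<ominus>\<^bsub>V\<^esub> c \<odot>\<^bsub>V\<^esub> m) \<oplus>\<^bsub>V\<^esub> c \<odot>\<^bsub>V\<^esub> m" for u c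
      proof -
        have "u \<ominus>\<^bsub>V\<^esub> c \<odot>\<^bsub>V\<^esub> m \<in> carrier V" "c \<odot>\<^bsub>V\<^esub> m \<in> carrier V"
          using V.M.minus_closed V.smult_closed c m u by blast+
        then have "dot K I u b = dot K I (u \<ominus>\<^bsub>V\<^esub> c \<odot>\<^bsub>V\<^esub> m) b \<oplus> dot K I (c \<odot>\<^bsub>V\<^esub> m) b"
          using b(1)[OF m] by (subst eq, intro dot_add_left) auto
        moreover have "dot K I (c \<odot>\<^bsub>V\<^esub> m) b = \<zero>"
          using dot_smult_left[OF c, of m b] m b(1)[OF m] bm c by simp
        ultimately show ?thesis
          using \<open>u \<ominus>\<^bsub>V\<^esub> c \<odot>\<^bsub>V\<^esub> m \<in> carrier V\<close> b(1)[OF m] by simp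
      qed
      show ?thesis
      proof (intro bexI[of _ b] conjI ballI)
        show "b \<in> carrier V" by (rule b(1)[OF m])
        have "dot K I f b = dot K I f' b"
          using b_elim[OF insert.prems(4) c(1) c(3)] unfolding f'_def .
        also have "\<dots> = dot K I f' a"
          using b(2)[OF f'] c(4) t(1) f' a(1) unfolding f'_def[symmetric] by simp
        finally show "dot K I f b \<noteq> \<zero>" using a(3) by simp
      next
        fix u assume u: "u \<in> M"
        obtain c where c: "c \<in> carrier K" "(u \<ominus>\<^bsub>V\<^esub> c \<odot>\<^bsub>V\<^esub> m) i = \<zero>"
          "u = (u \<ominus>\<^bsub>V\<^esub> c \<odot>\<^bsub>V\<^esub> m) \<oplus>\<^bsub>V\<^esub> c \<odot>\<^bsub>V\<^esub> m"
          using support_eliminate[OF insert.prems(3)[OF u] insert.prems(3)[OF 3(1)] i 3(2) _ m]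
            u MD(1) by blast
        have "u \<ominus>\<^bsub>V\<^esub> c \<odot>\<^bsub>V\<^esub> m \<in> M'"
          using c u 3(1) MD(4,6) by (auto simp: M'_def)
        then show "dot K I u b = \<zero>"
          using b_elim[OF _ c(1,3)] u MD(1) bM' by auto
      qed
    qed
  qed
  from this[of I M f] show ?thesis using assms finite_index by (auto simp: supported_def)
qed

end

section \<open>The group algebra as a symmetric, left Noetherian algebra with augmentation\<close>

section \<open>The group algebra\<close>

context abelian_group
begin

lemma finsum_swap:
  assumes "finite I" "finite J" "\<And>i j. i \<in> I \<Longrightarrow> j \<in> J \<Longrightarrow> f i j \<in> carrier G"
  shows "(\<Oplus>i\<in>I. \<Oplus>j\<in>J. f i j) = (\<Oplus>j\<in>J. \<Oplus>i\<in>I. f i j)"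
  using assms
proof (induction I rule: finite_induct)
  case empty
  then show ?case by (simp add: finsum_empty finsum_zero)
next
  case (insert i I)
  have "(\<Oplus>j\<in>J. \<Oplus>i\<in>insert i I. f i j) = (\<Oplus>j\<in>J. f i j \<oplus> (\<Oplus>i\<in>I. f i j))"
    using insert by (intro finsum_cong') (auto simp: finsum_insert Pi_def intro!: finsum_closed)
  also have "\<dots> = (\<Oplus>j\<in>J. f i j) \<oplus> (\<Oplus>j\<in>J. \<Oplus>i\<in>I. f i j)"
    using insert by (intro finsum_addf) (auto intro!: finsum_closed)
  finally show ?case
    using insert by (simp add: finsum_insert Pi_def finsum_closed)
qed

end

locale finite_group_algebra = G: group G + function_space K "carrier G"
  for G :: "('g, 's) monoid_scheme" and K :: "('k, 'r) ring_scheme" (structure)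
begin

abbreviation "A \<equiv> group_algebra K G"

lemma group_algebra_simps [simp]:
  "carrier A = carrier G \<rightarrow>\<^sub>E carrier K"
  "\<zero>\<^bsub>A\<^esub> = (\<lambda>x\<in>carrier G. \<zero>)"
  "a \<oplus>\<^bsub>A\<^esub> b = (\<lambda>x\<in>carrier G. a x \<oplus> b x)"
  by (simp_all add: group_algebra_def)

lemma one_group_algebra: "\<one>\<^bsub>A\<^esub> = ind \<one>\<^bsub>G\<^esub> \<one>"
  by (auto simp: group_algebra_def ind_def)

lemma mult_apply:
  "x \<in> carrier G \<Longrightarrow>
    (a \<otimes>\<^bsub>A\<^esub> b) x = (\<Oplus>y\<in>carrier G. a y \<otimes> b (inv\<^bsub>G\<^esub> y \<otimes>\<^bsub>G\<^esub> x))"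
  by (simp add: group_algebra_def)

lemma mult_closed:
  assumes "a \<in> carrier A" "b \<in> carrier A"
  shows "a \<otimes>\<^bsub>A\<^esub> b \<in> carrier A"
proof -
  have "(\<Oplus>y\<in>carrier G. a y \<otimes> b (inv\<^bsub>G\<^esub> y \<otimes>\<^bsub>G\<^esub> x)) \<in> carrier K" if "x \<in> carrier G" for x
    using assms that by (intro K.finsum_closed) auto
  then show ?thesis by (auto simp: group_algebra_def)
qed

lemma eqI:
  assumes "a \<in> carrier A" "b \<in> carrier A" "\<And>x. x \<in> carrier G \<Longrightarrow> a x = b x"
  shows "a = b"
  using assms by (intro extensionalityI[of _ "carrier G"]) (auto simp: PiE_def)

lemma finsum_left_shift:
  assumes "f \<in> carrier G \<rightarrow> carrier K" "g \<in> carrier G"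
  shows "(\<Oplus>x\<in>carrier G. f (g \<otimes>\<^bsub>G\<^esub> x)) = (\<Oplus>x\<in>carrier G. f x)"
proof -
  have "(\<lambda>x. g \<otimes>\<^bsub>G\<^esub> x) ` carrier G = carrier G"
    using assms(2) G.surj_const_mult by blast
  moreover have "inj_on (\<lambda>x. g \<otimes>\<^bsub>G\<^esub> x) (carrier G)"
    using assms(2) G.inj_on_cmult by blast
  ultimately show ?thesis
    using K.finsum_reindex[of f "\<lambda>x. g \<otimes>\<^bsub>G\<^esub> x" "carrier G"] assms(1) by simp
qed

lemma finsum_inverse:
  assumes "f \<in> carrier G \<rightarrow> carrier K"
  shows "(\<Oplus>x\<in>carrier G. f (inv\<^bsub>G\<^esub> x)) = (\<Oplus>x\<in>carrier G. f x)"
proof -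
  have "x \<in> (\<lambda>x. inv\<^bsub>G\<^esub> x) ` carrier G" if "x \<in> carrier G" for x
    using that by (intro image_eqI[of _ _ "inv\<^bsub>G\<^esub> x"]) auto
  then have "(\<lambda>x. inv\<^bsub>G\<^esub> x) ` carrier G = carrier G" by auto
  moreover have "inj_on (\<lambda>x. inv\<^bsub>G\<^esub> x) (carrier G)"
    by (rule G.inv_inj)
  ultimately show ?thesis
    using K.finsum_reindex[of f "\<lambda>x. inv\<^bsub>G\<^esub> x" "carrier G"] assms by simp
qed

lemma mult_assoc:
  assumes "a \<in> carrier A" "b \<in> carrier A" "c \<in> carrier A"
  shows "(a \<otimes>\<^bsub>A\<^esub> b) \<otimes>\<^bsub>A\<^esub> c = a \<otimes>\<^bsub>A\<^esub> (b \<otimes>\<^bsub>A\<^esub> c)"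
proof (rule eqI)
  fix x assume x: "x \<in> carrier G"
  have mem: "a y \<in> carrier K" "b y \<in> carrier K" "c y \<in> carrier K" if "y \<in> carrier G" for y
    using assms that by auto
  let ?i = "\<lambda>y. inv\<^bsub>G\<^esub> y"
  have "((a \<otimes>\<^bsub>A\<^esub> b) \<otimes>\<^bsub>A\<^esub> c) x =
      (\<Oplus>z\<in>carrier G. (\<Oplus>y\<in>carrier G. a y \<otimes> b (?i y \<otimes>\<^bsub>G\<^esub> z)) \<otimes> c (?i z \<otimes>\<^bsub>G\<^esub> x))"
    using x mem by (subst mult_apply) (auto intro!: K.finsum_cong' K.finsum_closed simp: mult_apply)
  also have "\<dots> = (\<Oplus>z\<in>carrier G. \<Oplus>y\<in>carrier G. a y \<otimes> (b (?i y \<otimes>\<^bsub>G\<^esub> z) \<otimes> c (?i z \<otimes>\<^bsub>G\<^esub> x)))"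
    using x mem finite_index
    by (intro K.finsum_cong' refl)
      (auto intro!: K.finsum_cong' K.finsum_closed simp: K.finsum_ldistr K.m_assoc Pi_def)
  also have "\<dots> = (\<Oplus>y\<in>carrier G. \<Oplus>z\<in>carrier G. a y \<otimes> (b (?i y \<otimes>\<^bsub>G\<^esub> z) \<otimes> c (?i z \<otimes>\<^bsub>G\<^esub> x)))"
    using x mem finite_index by (intro K.finsum_swap) auto
  also have "\<dots> = (\<Oplus>y\<in>carrier G. a y \<otimes> (b \<otimes>\<^bsub>A\<^esub> c) (?i y \<otimes>\<^bsub>G\<^esub> x))"
  proof (intro K.finsum_cong' refl)
    fix y assume y: "y \<in> carrier G"
    have "(\<Oplus>z\<in>carrier G. a y \<otimes> (b (?i y \<otimes>\<^bsub>G\<^esub> z) \<otimes> c (?i z \<otimes>\<^bsub>G\<^esub> x))) =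
        a y \<otimes> (\<Oplus>z\<in>carrier G. b (?i y \<otimes>\<^bsub>G\<^esub> z) \<otimes> c (?i z \<otimes>\<^bsub>G\<^esub> x))"
      using x y mem finite_index by (intro K.finsum_rdistr[symmetric]) auto
    \<comment> \<open>Substitution \<open>z = y w\<close>.\<close>
    also have "(\<Oplus>z\<in>carrier G. b (?i y \<otimes>\<^bsub>G\<^esub> z) \<otimes> c (?i z \<otimes>\<^bsub>G\<^esub> x)) =
        (\<Oplus>w\<in>carrier G. b (?i y \<otimes>\<^bsub>G\<^esub> (y \<otimes>\<^bsub>G\<^esub> w)) \<otimes> c (?i (y \<otimes>\<^bsub>G\<^esub> w) \<otimes>\<^bsub>G\<^esub> x))"
      using x y mem
      by (intro finsum_left_shift[symmetric, where f = "\<lambda>z. b (?i y \<otimes>\<^bsub>G\<^esub> z) \<otimes> c (?i z \<otimes>\<^bsub>G\<^esub> x)"]) auto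
    also have "\<dots> = (\<Oplus>w\<in>carrier G. b w \<otimes> c (?i w \<otimes>\<^bsub>G\<^esub> (?i y \<otimes>\<^bsub>G\<^esub> x)))"
      using x y mem
      by (intro K.finsum_cong' refl) (auto simp: G.m_assoc[symmetric] G.inv_mult_group)
    also have "\<dots> = (b \<otimes>\<^bsub>A\<^esub> c) (?i y \<otimes>\<^bsub>G\<^esub> x)"
      using x y by (simp add: mult_apply)
    finally show "(\<Oplus>z\<in>carrier G. a y \<otimes> (b (?i y \<otimes>\<^bsub>G\<^esub> z) \<otimes> c (?i z \<otimes>\<^bsub>G\<^esub> x))) =
      a y \<otimes> (b \<otimes>\<^bsub>A\<^esub> c) (?i y \<otimes>\<^bsub>G\<^esub> x)" .
  qed (use x mem mult_closed[OF assms(2,3)] in \<open>auto\<close>)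
  also have "\<dots> = (a \<otimes>\<^bsub>A\<^esub> (b \<otimes>\<^bsub>A\<^esub> c)) x"
    using x by (simp add: mult_apply)
  finally show "((a \<otimes>\<^bsub>A\<^esub> b) \<otimes>\<^bsub>A\<^esub> c) x = (a \<otimes>\<^bsub>A\<^esub> (b \<otimes>\<^bsub>A\<^esub> c)) x" .
qed (use assms mult_closed in auto)

lemma ind_mult_apply:
  assumes "a \<in> carrier A" "c \<in> carrier K" "g \<in> carrier G" "x \<in> carrier G"
  shows "(ind g c \<otimes>\<^bsub>A\<^esub> a) x = c \<otimes> a (inv\<^bsub>G\<^esub> g \<otimes>\<^bsub>G\<^esub> x)"
proof -
  have "(ind g c \<otimes>\<^bsub>A\<^esub> a) x = (\<Oplus>y\<in>carrier G. if g = y then c \<otimes> a (inv\<^bsub>G\<^esub> y \<otimes>\<^bsub>G\<^esub> x) else \<zero>)"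
    using assms by (subst mult_apply) (auto intro!: K.finsum_cong' simp: ind_def)
  also have "\<dots> = c \<otimes> a (inv\<^bsub>G\<^esub> g \<otimes>\<^bsub>G\<^esub> x)"
    using assms finite_index by (intro K.finsum_singleton) auto
  finally show ?thesis .
qed

lemma mult_ind_apply:
  assumes "a \<in> carrier A" "c \<in> carrier K" "g \<in> carrier G" "x \<in> carrier G"
  shows "(a \<otimes>\<^bsub>A\<^esub> ind g c) x = a (x \<otimes>\<^bsub>G\<^esub> inv\<^bsub>G\<^esub> g) \<otimes> c"
proof -
  have eq: "g = inv\<^bsub>G\<^esub> y \<otimes>\<^bsub>G\<^esub> x \<longleftrightarrow> x \<otimes>\<^bsub>G\<^esub> inv\<^bsub>G\<^esub> g = y" if "y \<in> carrier G" for y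
    using assms that G.inv_solve_left G.inv_solve_right by metis
  have "(a \<otimes>\<^bsub>A\<^esub> ind g c) x =
      (\<Oplus>y\<in>carrier G. if x \<otimes>\<^bsub>G\<^esub> inv\<^bsub>G\<^esub> g = y then a y \<otimes> c else \<zero>)"
    using assms by (subst mult_apply) (auto intro!: K.finsum_cong' simp: ind_def eq)
  also have "\<dots> = a (x \<otimes>\<^bsub>G\<^esub> inv\<^bsub>G\<^esub> g) \<otimes> c"
    using assms finite_index by (intro K.finsum_singleton) auto
  finally show ?thesis .
qed

lemma scalar_mult:
  assumes "a \<in> carrier A" "c \<in> carrier K"
  shows "ind \<one>\<^bsub>G\<^esub> c \<otimes>\<^bsub>A\<^esub> a = c \<odot>\<^bsub>V\<^esub> a" "a \<otimes>\<^bsub>A\<^esub> ind \<one>\<^bsub>G\<^esub> c = c \<odot>\<^bsub>V\<^esub> a"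
proof -
  have "c \<odot>\<^bsub>V\<^esub> a \<in> carrier A" using assms by auto
  then show "ind \<one>\<^bsub>G\<^esub> c \<otimes>\<^bsub>A\<^esub> a = c \<odot>\<^bsub>V\<^esub> a" "a \<otimes>\<^bsub>A\<^esub> ind \<one>\<^bsub>G\<^esub> c = c \<odot>\<^bsub>V\<^esub> a"
    using assms mult_closed
    by (auto intro!: eqI simp: ind_mult_apply mult_ind_apply K.m_comm simp del: PiE_iff)
qed

lemma ring_group_algebra: "ring A"
proof (rule ringI)
  have V: "carrier A = carrier V" "\<zero>\<^bsub>A\<^esub> = \<zero>\<^bsub>V\<^esub>" "a \<oplus>\<^bsub>A\<^esub> b = a \<oplus>\<^bsub>V\<^esub> b" for a b
    by simp_all
  have "\<exists>y\<in>carrier V. y \<oplus>\<^bsub>V\<^esub> x = \<zero>\<^bsub>V\<^esub>" if "x \<in> carrier V" for x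
    using that V.M.l_neg V.M.a_inv_closed by blast
  then show "abelian_group A"
    by (intro abelian_groupI; unfold V) (simp_all del: function_module_simps add: V.M.a_ac)
  show "monoid A"
  proof (rule monoidI)
    fix a assume a: "a \<in> carrier A"
    have "c \<odot>\<^bsub>V\<^esub> a = a" if "c = \<one>" for c using V.smult_one[of a] a that by simp
    then show "\<one>\<^bsub>A\<^esub> \<otimes>\<^bsub>A\<^esub> a = a" "a \<otimes>\<^bsub>A\<^esub> \<one>\<^bsub>A\<^esub> = a"
      using a scalar_mult[of a \<one>] by (simp_all add: one_group_algebra)
  next
    show "\<one>\<^bsub>A\<^esub> \<in> carrier A" by (simp add: one_group_algebra)
  qed (rule mult_assoc mult_closed; assumption)+
  fix a b c assume abc: "a \<in> carrier A" "b \<in> carrier A" "c \<in> carrier A"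
  then have mem: "a y \<in> carrier K" "b y \<in> carrier K" "c y \<in> carrier K" if "y \<in> carrier G" for y
    using that by auto
  have add: "u \<oplus>\<^bsub>A\<^esub> v \<in> carrier A" if "u \<in> carrier A" "v \<in> carrier A" for u v
    using that by auto
  have "((a \<oplus>\<^bsub>A\<^esub> b) \<otimes>\<^bsub>A\<^esub> c) x = (a \<otimes>\<^bsub>A\<^esub> c) x \<oplus> (b \<otimes>\<^bsub>A\<^esub> c) x" if x: "x \<in> carrier G" for x
  proof -
    have "((a \<oplus>\<^bsub>A\<^esub> b) \<otimes>\<^bsub>A\<^esub> c) x =
      (\<Oplus>y\<in>carrier G. a y \<otimes> c (inv\<^bsub>G\<^esub> y \<otimes>\<^bsub>G\<^esub> x) \<oplus> b y \<otimes> c (inv\<^bsub>G\<^esub> y \<otimes>\<^bsub>G\<^esub> x))"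
      unfolding mult_apply[OF x] using x mem by (intro K.finsum_cong' refl) (auto simp: K.l_distr)
    also have "\<dots> = (\<Oplus>y\<in>carrier G. a y \<otimes> c (inv\<^bsub>G\<^esub> y \<otimes>\<^bsub>G\<^esub> x)) \<oplus> (\<Oplus>y\<in>carrier G. b y \<otimes> c (inv\<^bsub>G\<^esub> y \<otimes>\<^bsub>G\<^esub> x))"
      using x mem by (intro K.finsum_addf) auto
    also have "\<dots> = (a \<otimes>\<^bsub>A\<^esub> c) x \<oplus> (b \<otimes>\<^bsub>A\<^esub> c) x"
      using x by (simp add: mult_apply)
    finally show ?thesis .
  qed
  then show "(a \<oplus>\<^bsub>A\<^esub> b) \<otimes>\<^bsub>A\<^esub> c = a \<otimes>\<^bsub>A\<^esub> c \<oplus>\<^bsub>A\<^esub> b \<otimes>\<^bsub>A\<^esub> c"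
    by (intro eqI add mult_closed abc) (simp add: group_algebra_simps(3))
  have "(c \<otimes>\<^bsub>A\<^esub> (a \<oplus>\<^bsub>A\<^esub> b)) x = (c \<otimes>\<^bsub>A\<^esub> a) x \<oplus> (c \<otimes>\<^bsub>A\<^esub> b) x" if x: "x \<in> carrier G" for x
  proof -
    have "(c \<otimes>\<^bsub>A\<^esub> (a \<oplus>\<^bsub>A\<^esub> b)) x =
      (\<Oplus>y\<in>carrier G. c y \<otimes> a (inv\<^bsub>G\<^esub> y \<otimes>\<^bsub>G\<^esub> x) \<oplus> c y \<otimes> b (inv\<^bsub>G\<^esub> y \<otimes>\<^bsub>G\<^esub> x))"
      unfolding mult_apply[OF x] using x mem by (intro K.finsum_cong' refl) (auto simp: K.r_distr)
    also have "\<dots> = (\<Oplus>y\<in>carrier G. c y \<otimes> a (inv\<^bsub>G\<^esub> y \<otimes>\<^bsub>G\<^esub> x)) \<oplus> (\<Oplus>y\<in>carrier G. c y \<otimes> b (inv\<^bsub>G\<^esub> y \<otimes>\<^bsub>G\<^esub> x))"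
      using x mem by (intro K.finsum_addf) auto
    also have "\<dots> = (c \<otimes>\<^bsub>A\<^esub> a) x \<oplus> (c \<otimes>\<^bsub>A\<^esub> b) x"
      using x by (simp add: mult_apply)
    finally show ?thesis .
  qed
  then show "c \<otimes>\<^bsub>A\<^esub> (a \<oplus>\<^bsub>A\<^esub> b) = c \<otimes>\<^bsub>A\<^esub> a \<oplus>\<^bsub>A\<^esub> c \<otimes>\<^bsub>A\<^esub> b"
    by (intro eqI add mult_closed abc) (simp add: group_algebra_simps(3))
qed

sublocale A: ring A
  by (rule ring_group_algebra)

text \<open>A vector outside \<open>N\<close> would be separated from \<open>N\<close> by a
  functional; but the coordinates of that functional are its values on the group elements, hence
  zero.\<close>

lemma subspace_generated_by_group:
  assumes N: "submodule N K V" and ind: "\<And>g. g \<in> carrier G \<Longrightarrow> ind g \<one> \<in> N"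
  shows "N = carrier A"
proof (rule ccontr)
  assume "N \<noteq> carrier A"
  then obtain f where f: "f \<in> carrier V" "f \<notin> N"
    using V.left_submoduleD(1)[OF N] by auto
  obtain a where a: "a \<in> carrier V" "\<And>m. m \<in> N \<Longrightarrow> dot K (carrier G) m a = \<zero>"
    "dot K (carrier G) f a \<noteq> \<zero>"
    using subspace_separation[OF N f] by blast
  have "a g = \<zero>" if "g \<in> carrier G" for g
    using a(2)[OF ind[OF that]] a(1) that dot_commute[of a "ind g \<one>"] dot_ind[of a g \<one>] by simp
  then have "dot K (carrier G) f a = (\<Oplus>g\<in>carrier G. \<zero>)"
    unfolding dot_def using f(1) by (intro K.finsum_cong') auto
  then show False using a(3) by (simp add: K.finsum_zero)
qed

subsection \<open>Augmentation\<close>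

definition aug :: "('g \<Rightarrow> 'k) \<Rightarrow> 'k" where
  "aug a = (\<Oplus>x\<in>carrier G. a x)"

lemma aug_closed [simp]: "a \<in> carrier A \<Longrightarrow> aug a \<in> carrier K"
  unfolding aug_def by (intro K.finsum_closed) auto

lemma aug_add:
  assumes "a \<in> carrier A" "b \<in> carrier A"
  shows "aug (a \<oplus>\<^bsub>A\<^esub> b) = aug a \<oplus> aug b"
proof -
  have "aug (a \<oplus>\<^bsub>A\<^esub> b) = (\<Oplus>x\<in>carrier G. a x \<oplus> b x)"
    unfolding aug_def using assms by (intro K.finsum_cong') auto
  also have "\<dots> = aug a \<oplus> aug b"
    unfolding aug_def using assms by (intro K.finsum_addf) auto
  finally show ?thesis .
qed

lemma aug_mult:
  assumes "a \<in> carrier A" "b \<in> carrier A"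
  shows "aug (a \<otimes>\<^bsub>A\<^esub> b) = aug a \<otimes> aug b"
proof -
  have mem: "a y \<in> carrier K" "b y \<in> carrier K" if "y \<in> carrier G" for y
    using assms that by auto
  have "aug (a \<otimes>\<^bsub>A\<^esub> b) =
      (\<Oplus>x\<in>carrier G. \<Oplus>y\<in>carrier G. a y \<otimes> b (inv\<^bsub>G\<^esub> y \<otimes>\<^bsub>G\<^esub> x))"
    unfolding aug_def using mem by (intro K.finsum_cong') (auto simp: mult_apply intro!: K.finsum_closed)
  also have "\<dots> = (\<Oplus>y\<in>carrier G. \<Oplus>x\<in>carrier G. a y \<otimes> b (inv\<^bsub>G\<^esub> y \<otimes>\<^bsub>G\<^esub> x))"
    using mem finite_index by (intro K.finsum_swap) auto
  also have "\<dots> = (\<Oplus>y\<in>carrier G. a y \<otimes> aug b)"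
  proof (intro K.finsum_cong' refl)
    fix y assume y: "y \<in> carrier G"
    have "(\<Oplus>x\<in>carrier G. a y \<otimes> b (inv\<^bsub>G\<^esub> y \<otimes>\<^bsub>G\<^esub> x)) =
        a y \<otimes> (\<Oplus>x\<in>carrier G. b (inv\<^bsub>G\<^esub> y \<otimes>\<^bsub>G\<^esub> x))"
      using y mem finite_index by (intro K.finsum_rdistr[symmetric]) auto
    also have "(\<Oplus>x\<in>carrier G. b (inv\<^bsub>G\<^esub> y \<otimes>\<^bsub>G\<^esub> x)) = aug b"
      unfolding aug_def using y mem by (intro finsum_left_shift) auto
    finally show "(\<Oplus>x\<in>carrier G. a y \<otimes> b (inv\<^bsub>G\<^esub> y \<otimes>\<^bsub>G\<^esub> x)) = a y \<otimes> aug b" .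
  qed (use mem assms in auto)
  also have "\<dots> = aug a \<otimes> aug b"
    unfolding aug_def using mem assms finite_index
    by (intro K.finsum_ldistr[symmetric]) (auto intro!: K.finsum_closed)
  finally show ?thesis .
qed

lemma aug_ind: "g \<in> carrier G \<Longrightarrow> c \<in> carrier K \<Longrightarrow> aug (ind g c) = c"
proof -
  assume "g \<in> carrier G" "c \<in> carrier K"
  then have "aug (ind g c) = (\<Oplus>x\<in>carrier G. if g = x then c else \<zero>)"
    unfolding aug_def ind_def by (intro K.finsum_cong') auto
  also have "\<dots> = c"
    using \<open>g \<in> carrier G\<close> \<open>c \<in> carrier K\<close> finite_index by (intro K.finsum_singleton) auto
  finally show ?thesis .
qed

lemma aug_one: "aug \<one>\<^bsub>A\<^esub> = \<one>"
  by (simp add: one_group_algebra aug_ind)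

lemma aug_zero: "aug \<zero>\<^bsub>A\<^esub> = \<zero>"
proof -
  have "aug \<zero>\<^bsub>A\<^esub> = (\<Oplus>x\<in>carrier G. \<zero>)" unfolding aug_def by (intro K.finsum_cong') auto
  then show ?thesis by (simp add: K.finsum_zero)
qed

lemma trivial_module_simps [simp]:
  "carrier (trivial_module K G) = carrier K" "\<zero>\<^bsub>trivial_module K G\<^esub> = \<zero>"
  "c \<oplus>\<^bsub>trivial_module K G\<^esub> d = c \<oplus> d" "a \<odot>\<^bsub>trivial_module K G\<^esub> c = aug a \<otimes> c"
  by (simp_all add: trivial_module_def aug_def)

lemma left_module_trivial: "left_module A (trivial_module K G)"
  by (intro left_module.intro left_module_axioms.intro abelian_groupI ring_group_algebra)
    (auto simp del: group_algebra_simps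
      simp: K.a_ac K.l_distr K.r_distr K.m_assoc aug_add aug_mult aug_one
      intro: bexI[of _ "\<ominus> c" for c] K.l_neg)

subsection \<open>The symmetrizing form\<close>

definition trace_form :: "('g \<Rightarrow> 'k) \<Rightarrow> 'k" where
  "trace_form a = a \<one>\<^bsub>G\<^esub>"

text \<open>Inverting the argument of the second factor turns the form into the coordinate product,
  so separation of vectors becomes a statement about products in \<open>A\<close>.\<close>

lemma trace_form_mult:
  assumes "a \<in> carrier A" "b \<in> carrier A"
  shows "trace_form (a \<otimes>\<^bsub>A\<^esub> b) = dot K (carrier G) a (\<lambda>y\<in>carrier G. b (inv\<^bsub>G\<^esub> y))"
  unfolding trace_form_def dot_def using assms
  by (subst mult_apply) (auto intro!: K.finsum_cong')

text \<open>The substitution \<open>y \<mapsto> inv y\<close> exchanges the roles of the two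
  factors.\<close>

lemma trace_form_commute:
  assumes "a \<in> carrier A" "b \<in> carrier A"
  shows "trace_form (a \<otimes>\<^bsub>A\<^esub> b) = trace_form (b \<otimes>\<^bsub>A\<^esub> a)"
proof -
  have mem: "a y \<in> carrier K" "b y \<in> carrier K" if "y \<in> carrier G" for y
    using assms that by auto
  have "trace_form (a \<otimes>\<^bsub>A\<^esub> b) = (\<Oplus>y\<in>carrier G. a y \<otimes> b (inv\<^bsub>G\<^esub> y))"
    unfolding trace_form_def using mem by (subst mult_apply) (auto intro!: K.finsum_cong')
  also have "\<dots> = (\<Oplus>y\<in>carrier G. a (inv\<^bsub>G\<^esub> y) \<otimes> b (inv\<^bsub>G\<^esub> (inv\<^bsub>G\<^esub> y)))"
    using mem finsum_inverse[of "\<lambda>y. a y \<otimes> b (inv\<^bsub>G\<^esub> y)"] by simp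
  also have "\<dots> = trace_form (b \<otimes>\<^bsub>A\<^esub> a)"
    unfolding trace_form_def using mem
    by (subst mult_apply) (auto intro!: K.finsum_cong' simp: K.m_comm)
  finally show ?thesis .
qed

text \<open>Multiplication by the group element inverse to \<open>g\<close> moves the coefficient of
  \<open>a\<close> at \<open>g\<close> to the unit.\<close>

lemma trace_form_nondegenerate:
  assumes "a \<in> carrier A" "\<And>x. x \<in> carrier A \<Longrightarrow> trace_form (x \<otimes>\<^bsub>A\<^esub> a) = \<zero>"
  shows "a = \<zero>\<^bsub>A\<^esub>"
proof (rule eqI)
  fix g assume g: "g \<in> carrier G"
  have "trace_form (ind (inv\<^bsub>G\<^esub> g) \<one> \<otimes>\<^bsub>A\<^esub> a) = a g"
    unfolding trace_form_def using g assms(1) by (subst ind_mult_apply) auto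
  then show "a g = \<zero>\<^bsub>A\<^esub> g" using assms(2)[of "ind (inv\<^bsub>G\<^esub> g) \<one>"] g by simp
qed (use assms in auto)

text \<open>A functional \<open>b\<close> vanishing on \<open>M\<close> has the form
  \<open>u \<mapsto> trace_form (u a)\<close>. As \<open>M\<close> is a left ideal,
  \<open>trace_form (x m a) = 0\<close> for all \<open>x\<close>, so \<open>m a = 0\<close> by
  nondegeneracy. Applied to the annihilator of a vector of \<open>T\<close>, this embeds
  \<open>T\<close> into \<open>A\<close>.\<close>

lemma right_annihilator_nontrivial:
  assumes "submodule M K V" "M \<noteq> carrier A"
    and ideal: "\<And>x m. x \<in> carrier A \<Longrightarrow> m \<in> M \<Longrightarrow> x \<otimes>\<^bsub>A\<^esub> m \<in> M"
  shows "\<exists>a\<in>carrier A. a \<noteq> \<zero>\<^bsub>A\<^esub> \<and> (\<forall>m\<in>M. m \<otimes>\<^bsub>A\<^esub> a = \<zero>\<^bsub>A\<^esub>)"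
proof -
  note M = V.left_submoduleD[OF assms(1)]
  obtain f where f: "f \<in> carrier V" "f \<notin> M" using assms(2) M(1) by auto
  obtain b where b: "b \<in> carrier V" "\<And>m. m \<in> M \<Longrightarrow> dot K (carrier G) m b = \<zero>"
    "dot K (carrier G) f b \<noteq> \<zero>"
    using subspace_separation[OF assms(1) f] by blast
  define a where "a = (\<lambda>y\<in>carrier G. b (inv\<^bsub>G\<^esub> y))"
  have a: "a \<in> carrier A" using b(1) by (auto simp: a_def)
  have "(\<lambda>y\<in>carrier G. a (inv\<^bsub>G\<^esub> y)) = b"
    using b(1) by (intro extensionalityI[of _ "carrier G"]) (auto simp: a_def PiE_def)
  then have tr: "trace_form (u \<otimes>\<^bsub>A\<^esub> a) = dot K (carrier G) u b" if "u \<in> carrier A" for u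
    using trace_form_mult[OF that a] by simp
  have "m \<otimes>\<^bsub>A\<^esub> a = \<zero>\<^bsub>A\<^esub>" if "m \<in> M" for m
  proof (rule trace_form_nondegenerate)
    have m: "m \<in> carrier A" using that M(1) by auto
    then show "m \<otimes>\<^bsub>A\<^esub> a \<in> carrier A" using a by (rule mult_closed)
    show "trace_form (x \<otimes>\<^bsub>A\<^esub> (m \<otimes>\<^bsub>A\<^esub> a)) = \<zero>" if x: "x \<in> carrier A" for x
      using b(2)[OF ideal[OF x \<open>m \<in> M\<close>]] tr[OF mult_closed[OF x m]] mult_assoc[OF x m a] by simp
  qed
  moreover have "a \<noteq> \<zero>\<^bsub>A\<^esub>"
  proof
    assume "a = \<zero>\<^bsub>A\<^esub>"
    then have "trace_form (f \<otimes>\<^bsub>A\<^esub> a) = \<zero>"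
      using f(1) by (simp add: trace_form_def del: group_algebra_simps(2)) simp
    then show False using tr[of f] f(1) b(3) by simp
  qed
  ultimately show ?thesis using a by blast
qed

subsection \<open>Noetherianity\<close>

text \<open>The free module of rank \<open>n\<close> is a coordinate space over \<open>K\<close>
  with index set \<open>{..<n} \<times> carrier G\<close>; a finite set that spans a submodule over
  \<open>K\<close> also generates it over \<open>A\<close>.\<close>

lemma left_noetherian_group_algebra: "left_noetherian A"
  unfolding left_noetherian_def
proof (intro allI impI)
  fix n N assume N: "submodule N A (free_left_module A n)"
  interpret F: left_module A "free_left_module A n" by (rule left_module_free) (rule ring_group_algebra)
  interpret W: function_space K "{..<n} \<times> carrier G"
    by unfold_locales (simp add: finite_index)
  define \<phi> where "\<phi> = (\<lambda>x :: nat \<Rightarrow> 'g \<Rightarrow> 'k. \<lambda>(i, g)\<in>{..<n} \<times> carrier G. x i g)"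
  have \<phi>_inj: "x = y" if "\<phi> x = \<phi> y" "x \<in> carrier (free_left_module A n)" "y \<in> carrier (free_left_module A n)" for x y
  proof (rule extensionalityI[of _ "{..<n}"])
    fix i assume i: "i \<in> {..<n}"
    show "x i = y i"
    proof (rule eqI)
      show "x i g = y i g" if "g \<in> carrier G" for g
        using fun_cong[OF \<open>\<phi> x = \<phi> y\<close>, of "(i, g)"] i that by (simp add: \<phi>_def)
    qed (use that i in auto)
  qed (use that in \<open>auto simp: PiE_def\<close>)
  have \<phi>_submodule: "submodule (\<phi> ` H) K W.V" if H: "submodule H A (free_left_module A n)" for H
  proof (rule W.V.left_submoduleI)
    note HD = F.left_submoduleD[OF H]
    have memA: "x i \<in> carrier A" if "x \<in> H" "i < n" for x i
      using that HD(1) by (force simp: PiE_def)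
    have mem: "x i g \<in> carrier K" if "x \<in> H" "i < n" "g \<in> carrier G" for x i g
      using memA[OF that(1,2)] that(3) by auto
    show "\<phi> ` H \<subseteq> carrier W.V" using mem by (auto simp: \<phi>_def split: if_splits)
    have "\<phi> \<zero>\<^bsub>free_left_module A n\<^esub> = \<zero>\<^bsub>W.V\<^esub>" by (auto simp: \<phi>_def)
    then show "\<zero>\<^bsub>W.V\<^esub> \<in> \<phi> ` H" using HD(2) by (metis imageI)
    show "u \<oplus>\<^bsub>W.V\<^esub> v \<in> \<phi> ` H" if "u \<in> \<phi> ` H" "v \<in> \<phi> ` H" for u v
    proof -
      from that obtain x y where xy: "x \<in> H" "y \<in> H" "u = \<phi> x" "v = \<phi> y" by blast
      have "u \<oplus>\<^bsub>W.V\<^esub> v = \<phi> (x \<oplus>\<^bsub>free_left_module A n\<^esub> y)"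
        unfolding xy by (auto simp: \<phi>_def)
      then show ?thesis using HD(3) xy by blast
    qed
    show "c \<odot>\<^bsub>W.V\<^esub> u \<in> \<phi> ` H" if "c \<in> carrier K" "u \<in> \<phi> ` H" for c u
    proof -
      from that obtain x where x: "x \<in> H" "u = \<phi> x" by blast
      \<comment> \<open>The scalar \<open>c\<close> acts as an element of the algebra, so submodules
        over \<open>A\<close> are subspaces over \<open>K\<close>.\<close>
      have "c \<odot>\<^bsub>W.V\<^esub> u = \<phi> (ind \<one>\<^bsub>G\<^esub> c \<odot>\<^bsub>free_left_module A n\<^esub> x)"
        unfolding x(2) using that(1) mem[OF x(1)] memA[OF x(1)]
        by (auto simp: \<phi>_def ind_mult_apply fun_eq_iff simp del: group_algebra_simps)
      moreover have "ind \<one>\<^bsub>G\<^esub> c \<in> carrier A" using that(1) by simp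
      ultimately show ?thesis using HD(4) x(1) by blast
    qed
  qed
  obtain B where B: "finite B" "B \<subseteq> \<phi> ` N" "\<forall>H. submodule H K W.V \<and> B \<subseteq> H \<longrightarrow> \<phi> ` N \<subseteq> H"
    using W.subspace_finitely_spanned[OF \<phi>_submodule[OF N]] by auto
  obtain C where C: "finite C" "C \<subseteq> N" "B = \<phi> ` C"
    using finite_subset_image[OF B(1,2)] by auto
  have "H = N" if "submodule H A (free_left_module A n)" "H \<subseteq> N" "C \<subseteq> H" for H
  proof
    show "N \<subseteq> H"
    proof
      fix x assume x: "x \<in> N"
      have "B \<subseteq> \<phi> ` H" using that(3) C(3) by blast
      then have "\<phi> ` N \<subseteq> \<phi> ` H" using B(3) \<phi>_submodule[OF that(1)] by blast
      then have "\<phi> x \<in> \<phi> ` H" using x by blast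
      then obtain y where "y \<in> H" "\<phi> x = \<phi> y" by blast
      then show "x \<in> H"
        using \<phi>_inj[of x y] x that(2) F.left_submoduleD(1)[OF N] by auto
    qed
  qed fact
  then show "fg_left_module A (free_left_module A n\<lparr>carrier := N\<rparr>)"
    unfolding fg_left_module_def submodule_restrict_iff[OF F.left_module_axioms N]
    using C(1,2) left_module_submodule[OF F.left_module_axioms N] by (auto intro!: exI[of _ C])
qed

end

section \<open>The central idempotent of a projective simple left ideal\<close>

section \<open>Central idempotents\<close>

context ring
begin

lemma minus_self [simp]: "a \<in> carrier R \<Longrightarrow> a \<ominus> a = \<zero>"
  by (simp add: minus_eq r_neg)

lemma minus_eq_zeroD:
  assumes "a \<in> carrier R" "b \<in> carrier R" "a \<ominus> b = \<zero>"
  shows "a = b"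
  using assms by (simp add: minus_eq) (metis add.inv_closed add.inv_equality minus_minus)

lemma r_distr_minus:
  assumes "a \<in> carrier R" "b \<in> carrier R" "c \<in> carrier R"
  shows "c \<otimes> (a \<ominus> b) = c \<otimes> a \<ominus> c \<otimes> b" "(a \<ominus> b) \<otimes> c = a \<otimes> c \<ominus> b \<otimes> c"
  using assms by (simp_all add: minus_eq r_distr l_distr r_minus l_minus)

text \<open>Otherwise \<open>e = e y + (e - e y)\<close> would decompose \<open>e\<close> into two
  nonzero orthogonal central idempotents.\<close>

lemma block_mult_central_idempotent:
  assumes "block R e" "y \<in> ring_center R" "y \<otimes> y = y" "e \<otimes> y \<noteq> \<zero>"
  shows "e \<otimes> y = e"
proof (rule ccontr)
  assume ne: "e \<otimes> y \<noteq> e"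
  have e: "e \<in> carrier R" "e \<otimes> e = e" "\<And>a. a \<in> carrier R \<Longrightarrow> e \<otimes> a = a \<otimes> e"
    and y: "y \<in> carrier R" "\<And>a. a \<in> carrier R \<Longrightarrow> y \<otimes> a = a \<otimes> y"
    using assms(1,2) unfolding block_def ring_center_def by blast+
  define z where "z = e \<ominus> e \<otimes> y"
  have z: "z \<in> carrier R" using e(1) y(1) by (simp add: z_def)
  have eyc: "(e \<otimes> y) \<otimes> a = a \<otimes> (e \<otimes> y)" if "a \<in> carrier R" for a
  proof -
    have "(e \<otimes> y) \<otimes> a = e \<otimes> (a \<otimes> y)"
      using that e(1) y(1) y(2)[OF that] by (simp only: m_assoc)
    also have "\<dots> = (a \<otimes> e) \<otimes> y"
      using that e(1) y(1) e(3)[OF that] by (simp only: m_assoc[symmetric])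
    also have "\<dots> = a \<otimes> (e \<otimes> y)" using that e(1) y(1) by (rule m_assoc)
    finally show ?thesis .
  qed
  have eye: "(e \<otimes> y) \<otimes> e = e \<otimes> y"
    unfolding eyc[OF e(1)] using e(1,2) y(1) by (simp add: m_assoc[symmetric])
  have idem: "(e \<otimes> y) \<otimes> (e \<otimes> y) = e \<otimes> y"
    using e(1) y(1) assms(3) eye by (simp add: m_assoc[symmetric]) (simp add: m_assoc)
  have zc: "z \<otimes> a = a \<otimes> z" if "a \<in> carrier R" for a
    unfolding z_def using that e(1) y(1) eyc[OF that] e(3)[OF that] by (simp only: r_distr_minus m_closed)
  have eyz: "(e \<otimes> y) \<otimes> z = \<zero>"
    unfolding z_def using e(1) y(1) eye idem by (simp add: r_distr_minus)
  have ez: "e \<otimes> z = z"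
    unfolding z_def using e(1,2) y(1) by (simp add: r_distr_minus m_assoc[symmetric])
  have "z \<otimes> z = e \<otimes> z \<ominus> (e \<otimes> y) \<otimes> z"
    using e(1) y(1) z unfolding z_def by (subst r_distr_minus(2)) auto
  then have "z \<otimes> z = z" using ez eyz z by (simp add: minus_eq)
  moreover have "z \<noteq> \<zero>"
    using ne e(1) y(1) minus_eq_zeroD[of e "e \<otimes> y"] by (auto simp: z_def)
  moreover have "e = e \<otimes> y \<oplus> z"
    unfolding z_def minus_eq using e(1) y(1) by (simp add: a_comm a_assoc r_neg l_neg a_lcomm)
  moreover have "e \<otimes> y \<in> ring_center R" "z \<in> ring_center R"
    using eyc zc e(1) y(1) z by (auto simp: ring_center_def)
  ultimately show False
    using assms(1,4) idem eyz unfolding block_def by blast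
qed

text \<open>\<open>L\<close> plays the projective simple left ideal, with right identity
  \<open>f\<close>. By symmetry of the form, \<open>L\<close> and its annihilator \<open>N\<close>
  multiply to zero in both orders, so \<open>N\<close> splits off as a direct factor and
  \<open>y\<close> is the identity of the complement. Being a sum of products that start in
  \<open>L\<close>, the element \<open>y\<close> stays in every \<open>H\<close> that contains
  \<open>L\<close> and is closed under addition and right multiplication; this controls its
  augmentation later. Values of the form are compared with \<open>\<tau> \<zero>\<close> because
  their type carries no structure.\<close>

lemma central_idempotent_of_left_ideal:
  assumes comm: "\<And>a b. a \<in> carrier R \<Longrightarrow> b \<in> carrier R \<Longrightarrow> \<tau> (a \<otimes> b) = \<tau> (b \<otimes> a)"
    and nondegenerate: "\<And>a. a \<in> carrier R \<Longrightarrow> (\<And>x. x \<in> carrier R \<Longrightarrow> \<tau> (x \<otimes> a) = \<tau> \<zero>) \<Longrightarrow> a = \<zero>"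
    and L: "L \<subseteq> carrier R" "\<And>a b. a \<in> L \<Longrightarrow> b \<in> L \<Longrightarrow> a \<ominus> b \<in> L"
      "\<And>x a. x \<in> carrier R \<Longrightarrow> a \<in> L \<Longrightarrow> x \<otimes> a \<in> L"
    and f: "f \<in> L" "\<And>l. l \<in> L \<Longrightarrow> l \<otimes> f = l"
    and simple: "\<And>w. w \<in> L \<Longrightarrow> w \<noteq> \<zero> \<Longrightarrow> \<exists>d\<in>carrier R. d \<otimes> w = f"
    and S: "finite S" "S \<subseteq> L"
      "\<And>y. y \<in> carrier R \<Longrightarrow> (\<And>s. s \<in> S \<Longrightarrow> y \<otimes> s = s) \<Longrightarrow> (\<And>l. l \<in> L \<Longrightarrow> y \<otimes> l = l)"
    and H: "H \<subseteq> carrier R" "\<zero> \<in> H" "L \<subseteq> H" "\<And>a b. a \<in> H \<Longrightarrow> b \<in> H \<Longrightarrow> a \<oplus> b \<in> H"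
      "\<And>x a. x \<in> carrier R \<Longrightarrow> a \<in> H \<Longrightarrow> a \<otimes> x \<in> H"
  shows "\<exists>y\<in>H. y \<in> ring_center R \<and> y \<otimes> y = y \<and> (\<forall>l\<in>L. y \<otimes> l = l) \<and>
    (\<forall>n\<in>carrier R. (\<forall>l\<in>L. n \<otimes> l = \<zero>) \<longrightarrow> y \<otimes> n = \<zero>)"
proof -
  define N where "N = {n \<in> carrier R. \<forall>l\<in>L. n \<otimes> l = \<zero>}"
  have LR: "l \<in> carrier R" if "l \<in> L" for l using that L(1) by blast
  have N: "n \<in> carrier R" "\<And>l. l \<in> L \<Longrightarrow> n \<otimes> l = \<zero>" if "n \<in> N" for n
    using that by (auto simp: N_def)
  have xN: "x \<otimes> n \<in> N" if "x \<in> carrier R" "n \<in> N" for x n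
    using that LR by (auto simp: N_def m_assoc)
  \<comment> \<open>Cyclicity moves \<open>n\<close> to the front, where it kills the element
    \<open>x l\<close> of \<open>L\<close>.\<close>
  have LN: "l \<otimes> n = \<zero>" if "l \<in> L" "n \<in> N" for l n
  proof (rule nondegenerate)
    fix x assume x: "x \<in> carrier R"
    have "\<tau> (x \<otimes> (l \<otimes> n)) = \<tau> (n \<otimes> (x \<otimes> l))"
      using x LR[OF that(1)] N(1)[OF that(2)] comm[of "x \<otimes> l" n] by (simp add: m_assoc)
    then show "\<tau> (x \<otimes> (l \<otimes> n)) = \<tau> \<zero>" using N(2)[OF that(2) L(3)[OF x that(1)]] by simp
  qed (use that LR N in auto)
  \<comment> \<open>A density argument: an element acting as the identity on \<open>L\<close> is
    assembled over the finite set \<open>S\<close>, starting from zero. Each correction starts with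
    a factor in \<open>L\<close>, which is why it keeps killing \<open>N\<close>.\<close>
  have "\<exists>y\<in>H. (\<forall>n\<in>N. y \<otimes> n = \<zero>) \<and> (\<forall>s\<in>S. y \<otimes> s = s)"
    using S(1,2)
  proof (induction S rule: finite_induct)
    case empty
    then show ?case using H(2) N(1) by (intro bexI[of _ \<zero>]) auto
  next
    case (insert t S)
    then obtain y where y: "y \<in> H" "\<And>n. n \<in> N \<Longrightarrow> y \<otimes> n = \<zero>" "\<And>s. s \<in> S \<Longrightarrow> y \<otimes> s = s"
      by auto
    have yR: "y \<in> carrier R" using y(1) H(1) by blast
    have t: "t \<in> L" "t \<in> carrier R" using insert.prems LR by auto
    define w where "w = t \<ominus> y \<otimes> t"
    have w: "w \<in> L" unfolding w_def using L(2,3) t yR by blast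
    show ?case
    proof (cases "w = \<zero>")
      case True
      then have "y \<otimes> t = t"
        using minus_eq_zeroD[of t "y \<otimes> t"] t yR by (auto simp: w_def)
      then show ?thesis using y by auto
    next
      case False
      then obtain d where d: "d \<in> carrier R" "d \<otimes> w = f" using simple w by blast
      \<comment> \<open>\<open>d w = f\<close> and \<open>w f = w\<close>, so \<open>z\<close> repairs \<open>y\<close> at \<open>t\<close> and vanishes where \<open>y\<close> is already right.\<close>
      define z where "z = w \<otimes> (d \<otimes> (\<one> \<ominus> y))"
      have wR: "w \<in> carrier R" using w LR by blast
      have zR: "z \<in> carrier R" using wR d(1) yR by (simp add: z_def)
      have z: "z \<otimes> a = w \<otimes> (d \<otimes> (a \<ominus> y \<otimes> a))" if "a \<in> carrier R" for a
        using that wR d(1) yR by (simp add: z_def m_assoc r_distr_minus)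
      have "y \<oplus> z \<in> H" using y(1) H(3-5) w d(1) yR by (auto simp: z_def)
      moreover have "(y \<oplus> z) \<otimes> n = \<zero>" if n: "n \<in> N" for n
      proof -
        have "z \<otimes> n = w \<otimes> (d \<otimes> n)" using z[OF N(1)[OF n]] y(2)[OF n] N(1)[OF n] by (simp add: minus_eq)
        then show ?thesis
          using LN[OF w xN[OF d(1) n]] y(2)[OF n] N(1)[OF n] yR zR by (simp add: l_distr)
      qed
      moreover have "(y \<oplus> z) \<otimes> s = s" if s: "s \<in> insert t S" for s
      proof (cases "s = t")
        case True
        have "z \<otimes> t = w" using z[OF t(2)] d(2) f(2)[OF w] by (simp add: w_def)
        moreover have "y \<otimes> t \<oplus> w = t"
          unfolding w_def minus_eq using t(2) yR by (simp add: a_lcomm r_neg)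
        ultimately show ?thesis using True t(2) yR zR by (simp add: l_distr)
      next
        case False
        then have "s \<in> S" "s \<in> carrier R" using s insert.prems LR by auto
        then show ?thesis using y(3)[of s] z[of s] yR zR wR d(1) by (simp add: l_distr)
      qed
      ultimately show ?thesis by blast
    qed
  qed
  then obtain y where y: "y \<in> H" "\<And>n. n \<in> N \<Longrightarrow> y \<otimes> n = \<zero>" "\<And>s. s \<in> S \<Longrightarrow> y \<otimes> s = s"
    by blast
  have yR: "y \<in> carrier R" using y(1) H(1) by blast
  have yl: "y \<otimes> l = l" if "l \<in> L" for l using S(3)[OF yR y(3) that] .
  \<comment> \<open>The cyclicity argument again, now with \<open>y\<close> in place of an element
    of \<open>L\<close>.\<close>
  have Ny: "n \<otimes> y = \<zero>" if n: "n \<in> N" for n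
  proof (rule nondegenerate)
    fix x assume x: "x \<in> carrier R"
    have "\<tau> (x \<otimes> (n \<otimes> y)) = \<tau> (y \<otimes> (x \<otimes> n))"
      using x N(1)[OF n] yR comm[of "x \<otimes> n" y] by (simp add: m_assoc)
    then show "\<tau> (x \<otimes> (n \<otimes> y)) = \<tau> \<zero>" using y(2)[OF xN[OF x n]] by simp
  qed (use n N yR in auto)
  \<comment> \<open>\<open>y\<close> fixes \<open>L\<close> pointwise, so \<open>1 - y\<close>
    annihilates \<open>L\<close> and \<open>y (1 - y) = 0\<close>.\<close>
  have "\<one> \<ominus> y \<in> N" using yR yl LR by (auto simp: N_def r_distr_minus)
  from y(2)[OF this] have "y \<ominus> y \<otimes> y = \<zero>" using yR by (simp add: r_distr_minus)
  then have idem: "y \<otimes> y = y" using minus_eq_zeroD[of y "y \<otimes> y"] yR by simp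
  \<comment> \<open>The commutator of \<open>y\<close> and \<open>c\<close> annihilates
    \<open>L\<close>, hence lies in \<open>N\<close> and is killed by \<open>y\<close> from both
    sides; this reads \<open>y c = y c y = c y\<close>.\<close>
  have central: "y \<otimes> c = c \<otimes> y" if c: "c \<in> carrier R" for c
  proof -
    define u where "u = y \<otimes> c \<ominus> c \<otimes> y"
    have "u \<in> N"
      unfolding N_def
    proof (intro CollectI conjI ballI)
      show "u \<in> carrier R" using yR c by (simp add: u_def)
      show "u \<otimes> l = \<zero>" if l: "l \<in> L" for l
        using yR c LR[OF l] yl[OF l] yl[OF L(3)[OF c l]] by (simp add: u_def r_distr_minus m_assoc)
    qed
    have "y \<otimes> u = y \<otimes> c \<ominus> y \<otimes> (c \<otimes> y)" "u \<otimes> y = y \<otimes> (c \<otimes> y) \<ominus> c \<otimes> y"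
      using yR c m_assoc[OF yR yR c] m_assoc[OF c yR yR] m_assoc[OF yR c yR]
      by (simp_all add: u_def r_distr_minus idem)
    then have "y \<otimes> c \<ominus> y \<otimes> (c \<otimes> y) = \<zero>" "y \<otimes> (c \<otimes> y) \<ominus> c \<otimes> y = \<zero>"
      using y(2)[OF \<open>u \<in> N\<close>] Ny[OF \<open>u \<in> N\<close>] by simp_all
    from this[THEN minus_eq_zeroD[rotated 2]] show ?thesis using yR c by (metis m_closed)
  qed
  have "\<forall>n\<in>carrier R. (\<forall>l\<in>L. n \<otimes> l = \<zero>) \<longrightarrow> y \<otimes> n = \<zero>"
    using y(2) by (simp add: N_def)
  moreover have "y \<in> ring_center R"
    unfolding ring_center_def using yR central by blast
  ultimately show ?thesis using y(1) idem yl by blast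
qed

end

section \<open>Copies of images and quotients inside a given type\<close>

section \<open>Modules realised on a prescribed type\<close>

text \<open>The fibres of \<open>h \<phi>\<close> are the cosets of the kernel of
  \<open>\<phi>\<close>, so the copy along \<open>h\<close> is isomorphic to the image of
  \<open>\<phi>\<close>.\<close>

lemma image_module_of_hom:
  assumes "left_module R E" "left_module R W" "\<phi> \<in> mod_hom R E W" "inj_on h (carrier W)"
  shows "left_module R (image_module E (\<lambda>x. h (\<phi> x)))"
    and "restrict (\<lambda>x. h (\<phi> x)) (carrier E) \<in> mod_hom R E (image_module E (\<lambda>x. h (\<phi> x)))"
    and "\<And>x. x \<in> carrier E \<Longrightarrow> h (\<phi> x) = \<zero>\<^bsub>image_module E (\<lambda>x. h (\<phi> x))\<^esub> \<longleftrightarrow> \<phi> x = \<zero>\<^bsub>W\<^esub>"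
proof -
  interpret E: left_module R E by fact
  interpret W: left_module R W by fact
  have *: "h (\<phi> x) = h (\<phi> y) \<longleftrightarrow> x \<ominus>\<^bsub>E\<^esub> y \<in> {x \<in> carrier E. \<phi> x = \<zero>\<^bsub>W\<^esub>}"
    if "x \<in> carrier E" "y \<in> carrier E" for x y
    using that mod_hom_minus[OF assms(1-3)] W.eq_of_minus_eq_zero mod_homD(1)[OF assms(3)]
      inj_on_eq_iff[OF assms(4)] by simp
  note ker = submodule_kernel[OF assms(1-3)]
  show "left_module R (image_module E (\<lambda>x. h (\<phi> x)))"
    "restrict (\<lambda>x. h (\<phi> x)) (carrier E) \<in> mod_hom R E (image_module E (\<lambda>x. h (\<phi> x)))"
    using left_module_image_module[OF assms(1) ker *] restrict_in_mod_hom_image_module[OF assms(1) ker *]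
    by simp_all
  show "h (\<phi> x) = \<zero>\<^bsub>image_module E (\<lambda>x. h (\<phi> x))\<^esub> \<longleftrightarrow> \<phi> x = \<zero>\<^bsub>W\<^esub>" if "x \<in> carrier E" for x
    using image_module_eq_zero_iff[OF assms(1) ker *] that by simp
qed

text \<open>Cosets are replaced by chosen representatives; these are elements of \<open>E\<close>,
  which the injection \<open>h\<close> then carries into the target type.\<close>

lemma quotient_map_exists:
  fixes h :: "'b \<Rightarrow> 'c"
  assumes "left_module R E" "submodule N R E" "inj_on h (carrier E)"
  shows "\<exists>q :: 'b \<Rightarrow> 'c. \<forall>x\<in>carrier E. \<forall>y\<in>carrier E. q x = q y \<longleftrightarrow> x \<ominus>\<^bsub>E\<^esub> y \<in> N"
proof -
  interpret E: left_module R E by fact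
  note N = E.left_submoduleD[OF assms(2)]
  define rep where "rep = (\<lambda>x. SOME z. z \<in> carrier E \<and> x \<ominus>\<^bsub>E\<^esub> z \<in> N)"
  have self: "x \<ominus>\<^bsub>E\<^esub> x \<in> N" if "x \<in> carrier E" for x
    using that N(2) E.eq_of_minus_eq_zero[of x x] by simp
  have rep: "rep x \<in> carrier E" "x \<ominus>\<^bsub>E\<^esub> rep x \<in> N" if "x \<in> carrier E" for x
    using someI[of "\<lambda>z. z \<in> carrier E \<and> x \<ominus>\<^bsub>E\<^esub> z \<in> N" x] self that by (auto simp: rep_def)
  have swap: "(x \<ominus>\<^bsub>E\<^esub> y) \<ominus>\<^bsub>E\<^esub> (x \<ominus>\<^bsub>E\<^esub> z) = z \<ominus>\<^bsub>E\<^esub> y"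
    "(x \<ominus>\<^bsub>E\<^esub> z) \<ominus>\<^bsub>E\<^esub> (y \<ominus>\<^bsub>E\<^esub> z) = x \<ominus>\<^bsub>E\<^esub> y"
    if "x \<in> carrier E" "y \<in> carrier E" "z \<in> carrier E" for x y z
  proof -
    have "(x \<oplus>\<^bsub>E\<^esub> \<ominus>\<^bsub>E\<^esub> y) \<oplus>\<^bsub>E\<^esub> (\<ominus>\<^bsub>E\<^esub> x \<oplus>\<^bsub>E\<^esub> z) = (x \<oplus>\<^bsub>E\<^esub> \<ominus>\<^bsub>E\<^esub> x) \<oplus>\<^bsub>E\<^esub> (z \<oplus>\<^bsub>E\<^esub> \<ominus>\<^bsub>E\<^esub> y)"
      "(x \<oplus>\<^bsub>E\<^esub> \<ominus>\<^bsub>E\<^esub> z) \<oplus>\<^bsub>E\<^esub> (\<ominus>\<^bsub>E\<^esub> y \<oplus>\<^bsub>E\<^esub> z) = (z \<oplus>\<^bsub>E\<^esub> \<ominus>\<^bsub>E\<^esub> z) \<oplus>\<^bsub>E\<^esub> (x \<oplus>\<^bsub>E\<^esub> \<ominus>\<^bsub>E\<^esub> y)"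
      using that by (simp_all add: E.M.a_ac)
    then show "(x \<ominus>\<^bsub>E\<^esub> y) \<ominus>\<^bsub>E\<^esub> (x \<ominus>\<^bsub>E\<^esub> z) = z \<ominus>\<^bsub>E\<^esub> y"
      "(x \<ominus>\<^bsub>E\<^esub> z) \<ominus>\<^bsub>E\<^esub> (y \<ominus>\<^bsub>E\<^esub> z) = x \<ominus>\<^bsub>E\<^esub> y"
      using that by (simp_all add: a_minus_def E.M.minus_add E.M.r_neg)
  qed
  have iff: "x \<ominus>\<^bsub>E\<^esub> z \<in> N \<longleftrightarrow> y \<ominus>\<^bsub>E\<^esub> z \<in> N"
    if "x \<in> carrier E" "y \<in> carrier E" "z \<in> carrier E" "x \<ominus>\<^bsub>E\<^esub> y \<in> N" for x y z
  proof
    assume "x \<ominus>\<^bsub>E\<^esub> z \<in> N"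
    then have "(x \<ominus>\<^bsub>E\<^esub> z) \<ominus>\<^bsub>E\<^esub> (x \<ominus>\<^bsub>E\<^esub> y) \<in> N" using that(4) by (rule N(6))
    then show "y \<ominus>\<^bsub>E\<^esub> z \<in> N" using swap(1)[of x z y] that by simp
  next
    assume "y \<ominus>\<^bsub>E\<^esub> z \<in> N"
    moreover have "y \<ominus>\<^bsub>E\<^esub> x \<in> N"
      using N(6)[OF self[OF that(1)] that(4)] swap(1)[of x x y] that by simp
    ultimately have "(y \<ominus>\<^bsub>E\<^esub> z) \<ominus>\<^bsub>E\<^esub> (y \<ominus>\<^bsub>E\<^esub> x) \<in> N" by (rule N(6))
    then show "x \<ominus>\<^bsub>E\<^esub> z \<in> N" using swap(1)[of y z x] that by simp
  qed
  have "rep x = rep y \<longleftrightarrow> x \<ominus>\<^bsub>E\<^esub> y \<in> N" if xy: "x \<in> carrier E" "y \<in> carrier E" for x y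
  proof
    assume eq: "rep x = rep y"
    then have "(x \<ominus>\<^bsub>E\<^esub> rep y) \<ominus>\<^bsub>E\<^esub> (y \<ominus>\<^bsub>E\<^esub> rep y) \<in> N"
      using rep[OF xy(1)] rep[OF xy(2)] N(6) by simp
    then show "x \<ominus>\<^bsub>E\<^esub> y \<in> N" using swap(2)[OF xy rep(1)[OF xy(2)]] by simp
  next
    \<comment> \<open>Elements of one coset have the same admissible representatives, so the choice
      operator returns the same one for both.\<close>
    assume "x \<ominus>\<^bsub>E\<^esub> y \<in> N"
    then show "rep x = rep y"
      using iff[OF xy] unfolding rep_def by (intro arg_cong[where f = Eps] ext) blast
  qed
  then show ?thesis
    using inj_on_eq_iff[OF assms(3)] rep(1) by (intro exI[of _ "\<lambda>x. h (rep x)"]) simp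
qed

lemma function_module_minus:
  assumes "ring A" "x \<in> carrier (function_module A I)" "y \<in> carrier (function_module A I)" "i \<in> I"
  shows "(x \<ominus>\<^bsub>function_module A I\<^esub> y) i = x i \<ominus>\<^bsub>A\<^esub> y i"
proof -
  interpret A: ring A by fact
  interpret V: left_module A "function_module A I" by (rule left_module_function) fact
  have "\<ominus>\<^bsub>function_module A I\<^esub> y = (\<lambda>j\<in>I. \<ominus>\<^bsub>A\<^esub> y j)"
    using assms(3) by (intro V.M.minus_equality) (auto intro!: extensionalityI[of _ I] simp: A.l_neg PiE_iff)
  then show ?thesis using assms(4) by (simp add: a_minus_def)
qed

lemma free_minus:
  assumes "ring A" "x \<in> carrier (free_left_module A n)" "y \<in> carrier (free_left_module A n)" "i < n"
  shows "(x \<ominus>\<^bsub>free_left_module A n\<^esub> y) i = x i \<ominus>\<^bsub>A\<^esub> y i"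
  using function_module_minus[of A x "{..<n}" y i] assms by (simp add: free_left_module_eq)

lemma fg_left_module_free:
  assumes "ring A"
  shows "fg_left_module A (free_left_module A n)"
  unfolding fg_left_module_def
proof (intro conjI exI[of _ "free_basis A n ` {..<n}"] allI impI)
  show "free_basis A n ` {..<n} \<subseteq> carrier (free_left_module A n)"
    using free_basis_closed[OF assms] by blast
  show "N = carrier (free_left_module A n)"
    if "submodule N A (free_left_module A n) \<and> free_basis A n ` {..<n} \<subseteq> N" for N
    using that by (intro free_basis_generates assms) auto
qed (use left_module_free[OF assms] in auto)

context finite_group_algebra
begin

lemma free_module_encoding:
  "\<exists>h :: (nat \<Rightarrow> 'g \<Rightarrow> 'k) \<Rightarrow> nat \<Rightarrow> 'k. inj_on h (carrier (free_left_module A 2))"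
proof -
  obtain b where b: "bij_betw b {..<card (carrier G)} (carrier G)"
    using ex_bij_betw_nat_finite[OF finite_index] by (auto simp: atLeast0LessThan)
  \<comment> \<open>The two components are interleaved: the parity of \<open>m\<close> selects the
    component, and \<open>m div 2\<close> the group element through the enumeration
    \<open>b\<close>.\<close>
  define h where "h = (\<lambda>x :: nat \<Rightarrow> 'g \<Rightarrow> 'k. \<lambda>m. x (m mod 2) (b (m div 2)))"
  have "x = y" if x: "x \<in> carrier (free_left_module A 2)" and y: "y \<in> carrier (free_left_module A 2)"
    and eq: "h x = h y" for x y
  proof (rule extensionalityI[of _ "{..<2}"])
    fix i :: nat assume i: "i \<in> {..<2}"
    show "x i = y i"
    proof (rule eqI)
      fix g assume "g \<in> carrier G"
      then obtain k where k: "g = b k" using b by (auto simp: bij_betw_def)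
      show "x i g = y i g"
        using fun_cong[OF eq, of "2 * k + i"] i by (simp add: h_def k)
    qed (use x y i in auto)
  qed (use x y in \<open>auto simp: PiE_def\<close>)
  then show ?thesis by (intro exI[of _ h]) (auto intro!: inj_onI)
qed

declare group_algebra_simps [simp del]

lemma ind_in_group_algebra [simp]: "c \<in> carrier K \<Longrightarrow> ind g c \<in> carrier A"
  by (simp add: group_algebra_simps)

lemma scalar_central:
  "a \<in> carrier A \<Longrightarrow> c \<in> carrier K \<Longrightarrow> ind \<one>\<^bsub>G\<^esub> c \<otimes>\<^bsub>A\<^esub> a = a \<otimes>\<^bsub>A\<^esub> ind \<one>\<^bsub>G\<^esub> c"
  using scalar_mult by simp

text \<open>With scalars written as elements of the algebra, left ideals are seen to be subspaces at
  once.\<close>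

lemma subspaceI:
  assumes "H \<subseteq> carrier A" "\<zero>\<^bsub>A\<^esub> \<in> H" "\<And>a b. a \<in> H \<Longrightarrow> b \<in> H \<Longrightarrow> a \<oplus>\<^bsub>A\<^esub> b \<in> H"
    and "\<And>c a. c \<in> carrier K \<Longrightarrow> a \<in> H \<Longrightarrow> ind \<one>\<^bsub>G\<^esub> c \<otimes>\<^bsub>A\<^esub> a \<in> H"
  shows "submodule H K V"
proof (rule V.left_submoduleI)
  show "c \<odot>\<^bsub>V\<^esub> a \<in> H" if "c \<in> carrier K" "a \<in> H" for c a
    using assms(4)[OF that] scalar_mult(1)[of a c] that assms(1) by auto
qed (use assms(1-3) in \<open>auto simp: group_algebra_simps\<close>)

text \<open>The products of group elements with \<open>f\<close> span \<open>A f = L\<close> over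
  \<open>K\<close>. Scalars are central, so an element that fixes these products under left
  multiplication fixes all of \<open>L\<close>.\<close>

lemma central_idempotent_exists:
  assumes L: "L \<subseteq> carrier A" "\<And>a b. a \<in> L \<Longrightarrow> b \<in> L \<Longrightarrow> a \<ominus>\<^bsub>A\<^esub> b \<in> L"
      "\<And>x a. x \<in> carrier A \<Longrightarrow> a \<in> L \<Longrightarrow> x \<otimes>\<^bsub>A\<^esub> a \<in> L"
    and f: "f \<in> L" "\<And>l. l \<in> L \<Longrightarrow> l \<otimes>\<^bsub>A\<^esub> f = l"
    and simple: "\<And>w. w \<in> L \<Longrightarrow> w \<noteq> \<zero>\<^bsub>A\<^esub> \<Longrightarrow> \<exists>d\<in>carrier A. d \<otimes>\<^bsub>A\<^esub> w = f"
    and H: "H \<subseteq> carrier A" "\<zero>\<^bsub>A\<^esub> \<in> H" "L \<subseteq> H" "\<And>a b. a \<in> H \<Longrightarrow> b \<in> H \<Longrightarrow> a \<oplus>\<^bsub>A\<^esub> b \<in> H"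
      "\<And>x a. x \<in> carrier A \<Longrightarrow> a \<in> H \<Longrightarrow> a \<otimes>\<^bsub>A\<^esub> x \<in> H"
  shows "\<exists>y\<in>H. y \<in> ring_center A \<and> y \<otimes>\<^bsub>A\<^esub> y = y \<and> (\<forall>l\<in>L. y \<otimes>\<^bsub>A\<^esub> l = l) \<and>
    (\<forall>n\<in>carrier A. (\<forall>l\<in>L. n \<otimes>\<^bsub>A\<^esub> l = \<zero>\<^bsub>A\<^esub>) \<longrightarrow> y \<otimes>\<^bsub>A\<^esub> n = \<zero>\<^bsub>A\<^esub>)"
proof (rule A.central_idempotent_of_left_ideal[where \<tau> = trace_form and f = f
      and S = "(\<lambda>g. ind g \<one> \<otimes>\<^bsub>A\<^esub> f) ` carrier G"])
  have fA: "f \<in> carrier A" using f(1) L(1) by blast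
  show "a = \<zero>\<^bsub>A\<^esub>" if "a \<in> carrier A" "\<And>x. x \<in> carrier A \<Longrightarrow> trace_form (x \<otimes>\<^bsub>A\<^esub> a) = trace_form \<zero>\<^bsub>A\<^esub>" for a
    using that by (intro trace_form_nondegenerate) (auto simp: trace_form_def group_algebra_simps(2))
  show "finite ((\<lambda>g. ind g \<one> \<otimes>\<^bsub>A\<^esub> f) ` carrier G)" using finite_index by simp
  show "(\<lambda>g. ind g \<one> \<otimes>\<^bsub>A\<^esub> f) ` carrier G \<subseteq> L" using L(3) f(1) by auto
  show "y \<otimes>\<^bsub>A\<^esub> l = l"
    if y: "y \<in> carrier A" and ys: "\<And>s. s \<in> (\<lambda>g. ind g \<one> \<otimes>\<^bsub>A\<^esub> f) ` carrier G \<Longrightarrow> y \<otimes>\<^bsub>A\<^esub> s = s"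
      and l: "l \<in> L" for y l
  proof -
    let ?H = "{x \<in> carrier A. y \<otimes>\<^bsub>A\<^esub> (x \<otimes>\<^bsub>A\<^esub> f) = x \<otimes>\<^bsub>A\<^esub> f}"
    have "submodule ?H K V"
    proof (rule subspaceI)
      show "ind \<one>\<^bsub>G\<^esub> c \<otimes>\<^bsub>A\<^esub> a \<in> ?H" if "c \<in> carrier K" "a \<in> ?H" for c a
      proof -
        let ?c = "ind \<one>\<^bsub>G\<^esub> c"
        have c: "?c \<in> carrier A" and a: "a \<in> carrier A" using that by auto
        have "y \<otimes>\<^bsub>A\<^esub> ((?c \<otimes>\<^bsub>A\<^esub> a) \<otimes>\<^bsub>A\<^esub> f) = (y \<otimes>\<^bsub>A\<^esub> ?c) \<otimes>\<^bsub>A\<^esub> (a \<otimes>\<^bsub>A\<^esub> f)"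
          using c a y fA by (simp add: A.m_assoc)
        also have "\<dots> = ?c \<otimes>\<^bsub>A\<^esub> (y \<otimes>\<^bsub>A\<^esub> (a \<otimes>\<^bsub>A\<^esub> f))"
          using c a y fA scalar_central[OF y that(1)] by (simp add: A.m_assoc[symmetric])
        also have "\<dots> = (?c \<otimes>\<^bsub>A\<^esub> a) \<otimes>\<^bsub>A\<^esub> f" using that(2) c a fA by (simp add: A.m_assoc)
        finally show ?thesis using c a by simp
      qed
    qed (use y fA in \<open>auto simp: A.l_distr A.r_distr\<close>)
    then have "?H = carrier A"
      by (rule subspace_generated_by_group) (use ys in auto)
    then have "y \<otimes>\<^bsub>A\<^esub> (l \<otimes>\<^bsub>A\<^esub> f) = l \<otimes>\<^bsub>A\<^esub> f" using l L(1) by blast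
    then show ?thesis using f(2)[OF l] by simp
  qed
qed (fact trace_form_commute assms)+

end

section \<open>The left ideal isomorphic to the simple module, and the chain with three
  terms\<close>

section \<open>Linking the trivial module to a simple module\<close>

text \<open>Everything annihilating \<open>t0\<close> annihilates \<open>a0\<close>, so
  \<open>x t0 \<mapsto> x a0\<close> is a well defined nonzero homomorphism from \<open>T\<close> to
  \<open>A\<close>, injective by simplicity. Fixing the two elements instead of the map lets the
  later computations take place in \<open>A\<close>.\<close>

locale embedded_simple = finite_group_algebra G K + T: left_module "group_algebra K G" T
  for G :: "('g, 's) monoid_scheme" and K :: "('k, 'r) ring_scheme" (structure)
    and T :: "('g \<Rightarrow> 'k, 't, 'm) module_scheme" +
  fixes t0 :: 't and a0 :: "'g \<Rightarrow> 'k"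
  assumes simple: "simple_left_module A T"
    and t0: "t0 \<in> carrier T" "t0 \<noteq> \<zero>\<^bsub>T\<^esub>"
    and a0: "a0 \<in> carrier A" "a0 \<noteq> \<zero>\<^bsub>A\<^esub>"
    and annihilates: "\<And>x. x \<in> carrier A \<Longrightarrow> x \<odot>\<^bsub>T\<^esub> t0 = \<zero>\<^bsub>T\<^esub> \<Longrightarrow> x \<otimes>\<^bsub>A\<^esub> a0 = \<zero>\<^bsub>A\<^esub>"
begin

text \<open>For a left ideal \<open>H\<close> the set \<open>H t0\<close> is a submodule, so
  simplicity leaves only zero and all of \<open>T\<close>.\<close>

lemma orbit_eq_carrier:
  assumes H: "H \<subseteq> carrier A" "\<zero>\<^bsub>A\<^esub> \<in> H" "\<And>a b. a \<in> H \<Longrightarrow> b \<in> H \<Longrightarrow> a \<oplus>\<^bsub>A\<^esub> b \<in> H"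
      "\<And>x a. x \<in> carrier A \<Longrightarrow> a \<in> H \<Longrightarrow> x \<otimes>\<^bsub>A\<^esub> a \<in> H"
    and nonzero: "h \<in> H" "h \<odot>\<^bsub>T\<^esub> t0 \<noteq> \<zero>\<^bsub>T\<^esub>"
  shows "(\<lambda>x. x \<odot>\<^bsub>T\<^esub> t0) ` H = carrier T"
proof -
  have "submodule ((\<lambda>x. x \<odot>\<^bsub>T\<^esub> t0) ` H) A T"
  proof (rule T.left_submoduleI)
    show "(\<lambda>x. x \<odot>\<^bsub>T\<^esub> t0) ` H \<subseteq> carrier T" using H(1) t0(1) by auto
    show "\<zero>\<^bsub>T\<^esub> \<in> (\<lambda>x. x \<odot>\<^bsub>T\<^esub> t0) ` H"
      using H(2) t0(1) by (intro image_eqI[of _ _ "\<zero>\<^bsub>A\<^esub>"]) auto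
    show "u \<oplus>\<^bsub>T\<^esub> v \<in> (\<lambda>x. x \<odot>\<^bsub>T\<^esub> t0) ` H"
      if "u \<in> (\<lambda>x. x \<odot>\<^bsub>T\<^esub> t0) ` H" "v \<in> (\<lambda>x. x \<odot>\<^bsub>T\<^esub> t0) ` H" for u v
    proof -
      from that obtain a b where ab: "a \<in> H" "u = a \<odot>\<^bsub>T\<^esub> t0" "b \<in> H" "v = b \<odot>\<^bsub>T\<^esub> t0" by blast
      then have "u \<oplus>\<^bsub>T\<^esub> v = (a \<oplus>\<^bsub>A\<^esub> b) \<odot>\<^bsub>T\<^esub> t0"
        using H(1) t0(1) T.smult_l_distr[of a b t0] by (simp add: subset_eq)
      then show ?thesis using H(3)[OF ab(1,3)] by blast
    qed
    show "x \<odot>\<^bsub>T\<^esub> u \<in> (\<lambda>x. x \<odot>\<^bsub>T\<^esub> t0) ` H"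
      if "x \<in> carrier A" "u \<in> (\<lambda>x. x \<odot>\<^bsub>T\<^esub> t0) ` H" for x u
    proof -
      from that obtain a where a: "a \<in> H" "u = a \<odot>\<^bsub>T\<^esub> t0" by blast
      then have "x \<odot>\<^bsub>T\<^esub> u = (x \<otimes>\<^bsub>A\<^esub> a) \<odot>\<^bsub>T\<^esub> t0"
        using H(1) t0(1) that(1) T.smult_assoc1[of x a t0] by (simp add: subset_eq)
      then show ?thesis using H(4)[OF that(1) a(1)] by blast
    qed
  qed
  moreover have "(\<lambda>x. x \<odot>\<^bsub>T\<^esub> t0) ` H \<noteq> {\<zero>\<^bsub>T\<^esub>}" using nonzero by blast
  ultimately show ?thesis using simple unfolding simple_left_module_def by blast
qed

lemma orbit_carrier: "(\<lambda>x. x \<odot>\<^bsub>T\<^esub> t0) ` carrier A = carrier T"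
  by (rule orbit_eq_carrier[of _ "\<one>\<^bsub>A\<^esub>"]) (use t0 in auto)

text \<open>If \<open>h t0\<close> were nonzero, then \<open>H t0 = T\<close> would give
  \<open>x\<close> in \<open>H\<close> with \<open>x t0 = t0\<close>; now \<open>1 - x\<close>
  annihilates \<open>t0\<close>, so it lies in \<open>H\<close>, and \<open>1\<close> does
  too.\<close>

lemma annihilator_maximal:
  assumes H: "H \<subseteq> carrier A" "\<zero>\<^bsub>A\<^esub> \<in> H" "\<And>a b. a \<in> H \<Longrightarrow> b \<in> H \<Longrightarrow> a \<oplus>\<^bsub>A\<^esub> b \<in> H"
      "\<And>x a. x \<in> carrier A \<Longrightarrow> a \<in> H \<Longrightarrow> x \<otimes>\<^bsub>A\<^esub> a \<in> H"
    and ann: "\<And>x. x \<in> carrier A \<Longrightarrow> x \<odot>\<^bsub>T\<^esub> t0 = \<zero>\<^bsub>T\<^esub> \<Longrightarrow> x \<in> H"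
    and proper: "\<one>\<^bsub>A\<^esub> \<notin> H"
    and h: "h \<in> H"
  shows "h \<odot>\<^bsub>T\<^esub> t0 = \<zero>\<^bsub>T\<^esub>"
proof (rule ccontr)
  assume "h \<odot>\<^bsub>T\<^esub> t0 \<noteq> \<zero>\<^bsub>T\<^esub>"
  then have "t0 \<in> (\<lambda>x. x \<odot>\<^bsub>T\<^esub> t0) ` H"
    using orbit_eq_carrier[OF H h] t0(1) by simp
  then obtain x where x: "x \<in> H" "x \<odot>\<^bsub>T\<^esub> t0 = t0" by force
  have xA: "x \<in> carrier A" using x(1) H(1) by blast
  have "(\<one>\<^bsub>A\<^esub> \<ominus>\<^bsub>A\<^esub> x) \<odot>\<^bsub>T\<^esub> t0 = t0 \<ominus>\<^bsub>T\<^esub> t0"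
    using T.smult_diff_distr[of "\<one>\<^bsub>A\<^esub>" x t0] xA t0(1) x(2) by simp
  then have "\<one>\<^bsub>A\<^esub> \<ominus>\<^bsub>A\<^esub> x \<in> H"
    using xA t0(1) T.eq_of_minus_eq_zero[of t0 t0] by (intro ann) simp_all
  from H(3)[OF this x(1)] have "\<one>\<^bsub>A\<^esub> \<in> H"
    using xA by (simp add: A.minus_eq A.a_assoc A.l_neg)
  then show False using proper by simp
qed

text \<open>The annihilator of \<open>a0\<close> is a proper left ideal that contains the
  annihilator of \<open>t0\<close>, and the latter is maximal.\<close>

lemma annihilator_eq:
  assumes "x \<in> carrier A"
  shows "x \<odot>\<^bsub>T\<^esub> t0 = \<zero>\<^bsub>T\<^esub> \<longleftrightarrow> x \<otimes>\<^bsub>A\<^esub> a0 = \<zero>\<^bsub>A\<^esub>"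
proof
  assume "x \<otimes>\<^bsub>A\<^esub> a0 = \<zero>\<^bsub>A\<^esub>"
  then show "x \<odot>\<^bsub>T\<^esub> t0 = \<zero>\<^bsub>T\<^esub>"
    using assms a0 annihilates
    by (intro annihilator_maximal[of "{x \<in> carrier A. x \<otimes>\<^bsub>A\<^esub> a0 = \<zero>\<^bsub>A\<^esub>}"])
      (auto simp: A.l_distr A.m_assoc)
qed (use assms annihilates in auto)

definition L :: "('g \<Rightarrow> 'k) set" where
  "L = (\<lambda>x. x \<otimes>\<^bsub>A\<^esub> a0) ` carrier A"

lemma L_subset: "L \<subseteq> carrier A"
  using a0 by (auto simp: L_def)

lemma L_minus:
  assumes "a \<in> L" "b \<in> L"
  shows "a \<ominus>\<^bsub>A\<^esub> b \<in> L"
proof -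
  from assms obtain x y where "x \<in> carrier A" "y \<in> carrier A" "a = x \<otimes>\<^bsub>A\<^esub> a0" "b = y \<otimes>\<^bsub>A\<^esub> a0"
    by (auto simp: L_def)
  then show ?thesis
    unfolding L_def using a0 by (intro image_eqI[of _ _ "x \<ominus>\<^bsub>A\<^esub> y"]) (auto simp: A.r_distr_minus)
qed

lemma L_mult:
  assumes "x \<in> carrier A" "a \<in> L"
  shows "x \<otimes>\<^bsub>A\<^esub> a \<in> L"
proof -
  from assms obtain y where "y \<in> carrier A" "a = y \<otimes>\<^bsub>A\<^esub> a0" by (auto simp: L_def)
  then show ?thesis
    unfolding L_def using a0 assms by (intro image_eqI[of _ _ "x \<otimes>\<^bsub>A\<^esub> y"]) (auto simp: A.m_assoc)
qed

lemma a0_in_L: "a0 \<in> L"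
  unfolding L_def using a0 by (intro image_eqI[of _ _ "\<one>\<^bsub>A\<^esub>"]) auto

lemma L_add: "a \<in> L \<Longrightarrow> b \<in> L \<Longrightarrow> a \<oplus>\<^bsub>A\<^esub> b \<in> L"
  unfolding L_def using a0
  by (auto simp: A.l_distr[symmetric])

lemma zero_in_L: "\<zero>\<^bsub>A\<^esub> \<in> L"
  using L_mult[OF A.zero_closed a0_in_L] a0 by simp

text \<open>Transferred from \<open>T\<close>: if \<open>w = x a0\<close> is nonzero, so is
  \<open>x t0\<close>, which therefore generates \<open>T\<close>. Hence
  \<open>y t0 = d x t0\<close> for some \<open>d\<close>, and the same relation holds with
  \<open>a0\<close> for \<open>t0\<close>.\<close>

lemma L_minimal:
  assumes "w \<in> L" "w \<noteq> \<zero>\<^bsub>A\<^esub>" "f \<in> L"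
  shows "\<exists>d\<in>carrier A. d \<otimes>\<^bsub>A\<^esub> w = f"
proof -
  obtain x y where x: "x \<in> carrier A" "w = x \<otimes>\<^bsub>A\<^esub> a0" and y: "y \<in> carrier A" "f = y \<otimes>\<^bsub>A\<^esub> a0"
    using assms by (auto simp: L_def)
  let ?H = "(\<lambda>d. d \<otimes>\<^bsub>A\<^esub> x) ` carrier A"
  have "(\<lambda>x. x \<odot>\<^bsub>T\<^esub> t0) ` ?H = carrier T"
  proof (rule orbit_eq_carrier[of _ x])
    show "?H \<subseteq> carrier A" using x by auto
    show "\<zero>\<^bsub>A\<^esub> \<in> ?H" using x by (intro image_eqI[of _ _ "\<zero>\<^bsub>A\<^esub>"]) auto
    show "x \<in> ?H" using x by (intro image_eqI[of _ _ "\<one>\<^bsub>A\<^esub>"]) auto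
    show "x \<odot>\<^bsub>T\<^esub> t0 \<noteq> \<zero>\<^bsub>T\<^esub>" using annihilator_eq x assms(2) by simp
    show "a \<oplus>\<^bsub>A\<^esub> b \<in> ?H" if ab: "a \<in> ?H" "b \<in> ?H" for a b
    proof -
      from ab obtain c d where "c \<in> carrier A" "d \<in> carrier A" "a = c \<otimes>\<^bsub>A\<^esub> x" "b = d \<otimes>\<^bsub>A\<^esub> x" by blast
      then show ?thesis using x by (intro image_eqI[of _ _ "c \<oplus>\<^bsub>A\<^esub> d"]) (auto simp: A.l_distr)
    qed
    show "c \<otimes>\<^bsub>A\<^esub> a \<in> ?H" if ca: "c \<in> carrier A" "a \<in> ?H" for c a
    proof -
      from ca obtain d where "d \<in> carrier A" "a = d \<otimes>\<^bsub>A\<^esub> x" by blast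
      then show ?thesis using x ca by (intro image_eqI[of _ _ "c \<otimes>\<^bsub>A\<^esub> d"]) (auto simp: A.m_assoc)
    qed
  qed
  then have "y \<odot>\<^bsub>T\<^esub> t0 \<in> (\<lambda>x. x \<odot>\<^bsub>T\<^esub> t0) ` ?H" using y(1) t0(1) by simp
  then obtain d where d: "d \<in> carrier A" "y \<odot>\<^bsub>T\<^esub> t0 = (d \<otimes>\<^bsub>A\<^esub> x) \<odot>\<^bsub>T\<^esub> t0" by blast
  have "y \<otimes>\<^bsub>A\<^esub> a0 = (d \<otimes>\<^bsub>A\<^esub> x) \<otimes>\<^bsub>A\<^esub> a0"
  proof -
    have dx: "d \<otimes>\<^bsub>A\<^esub> x \<in> carrier A" using d(1) x(1) by simp
    have "(y \<ominus>\<^bsub>A\<^esub> d \<otimes>\<^bsub>A\<^esub> x) \<odot>\<^bsub>T\<^esub> t0 = \<zero>\<^bsub>T\<^esub>"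
      unfolding T.smult_diff_distr[OF y(1) dx t0(1)] d(2)[symmetric]
      using y(1) t0(1) T.eq_of_minus_eq_zero by simp
    then have "(y \<ominus>\<^bsub>A\<^esub> d \<otimes>\<^bsub>A\<^esub> x) \<otimes>\<^bsub>A\<^esub> a0 = \<zero>\<^bsub>A\<^esub>"
      using annihilates y(1) dx by simp
    then have "y \<otimes>\<^bsub>A\<^esub> a0 \<ominus>\<^bsub>A\<^esub> (d \<otimes>\<^bsub>A\<^esub> x) \<otimes>\<^bsub>A\<^esub> a0 = \<zero>\<^bsub>A\<^esub>"
      unfolding A.r_distr_minus(2)[OF y(1) dx a0(1)] .
    then show ?thesis by (rule A.minus_eq_zeroD[rotated 2]) (use y(1) dx a0(1) in auto)
  qed
  then show ?thesis using d(1) x y a0(1) A.m_assoc[of d x a0] by (intro bexI[of _ d]) simp_all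
qed

subsection \<open>The connecting modules\<close>

text \<open>All modules of the chain are images of \<open>F = A \<times> A\<close>: writing \<open>I\<close> for the augmentation ideal,
  \<open>V1\<close> is \<open>k\<close>, \<open>V2\<close> is \<open>(I \<times> A) / (0 \<times> L)\<close>, \<open>Q\<close> is \<open>F / (0 \<times> L)\<close>, and \<open>V3\<close> is \<open>L\<close>.\<close>

abbreviation "F \<equiv> free_left_module A 2"

definition IA :: "(nat \<Rightarrow> 'g \<Rightarrow> 'k) set" where
  "IA = {x \<in> carrier F. aug (x 0) = \<zero>}"

definition OL :: "(nat \<Rightarrow> 'g \<Rightarrow> 'k) set" where
  "OL = {x \<in> carrier F. x 0 = \<zero>\<^bsub>A\<^esub> \<and> x 1 \<in> L}"

abbreviation "E \<equiv> F\<lparr>carrier := IA\<rparr>"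

definition enc :: "(nat \<Rightarrow> 'g \<Rightarrow> 'k) \<Rightarrow> nat \<Rightarrow> 'k" where
  "enc = (SOME h. inj_on h (carrier F))"

definition q :: "(nat \<Rightarrow> 'g \<Rightarrow> 'k) \<Rightarrow> nat \<Rightarrow> 'k" where
  "q = (SOME q. \<forall>x\<in>carrier F. \<forall>y\<in>carrier F. q x = q y \<longleftrightarrow> x \<ominus>\<^bsub>F\<^esub> y \<in> OL)"

definition aug0 :: "(nat \<Rightarrow> 'g \<Rightarrow> 'k) \<Rightarrow> 'k" where
  "aug0 = restrict (\<lambda>x. aug (x 0)) (carrier F)"

definition proj_L :: "(nat \<Rightarrow> 'g \<Rightarrow> 'k) \<Rightarrow> nat \<Rightarrow> 'g \<Rightarrow> 'k" where
  "proj_L = restrict (\<lambda>x. \<lambda>i\<in>{..<2}. if i = 0 then \<zero>\<^bsub>A\<^esub> else x 1 \<otimes>\<^bsub>A\<^esub> a0) (carrier F)"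

definition "V1 = image_module F (\<lambda>x. (\<lambda>c. \<lambda>_ :: nat. c) (aug0 x))"
definition "V2 = image_module E q"
definition "V3 = image_module F (\<lambda>x. enc (proj_L x))"
definition "Q = image_module F q"

sublocale F: left_module A F
  by (rule left_module_free) (rule ring_group_algebra)

lemma F_apply [simp]:
  assumes "i < 2"
  shows "x \<in> carrier F \<Longrightarrow> x i \<in> carrier A"
    and "\<zero>\<^bsub>F\<^esub> i = \<zero>\<^bsub>A\<^esub>"
    and "(x \<oplus>\<^bsub>F\<^esub> y) i = x i \<oplus>\<^bsub>A\<^esub> y i"
    and "(a \<odot>\<^bsub>F\<^esub> x) i = a \<otimes>\<^bsub>A\<^esub> x i"
    and "x \<in> carrier F \<Longrightarrow> y \<in> carrier F \<Longrightarrow> (x \<ominus>\<^bsub>F\<^esub> y) i = x i \<ominus>\<^bsub>A\<^esub> y i"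
  using assms free_minus[OF ring_group_algebra, of x 2 y i] by auto

lemma pair_in_F [simp]:
  "a \<in> carrier A \<Longrightarrow> b \<in> carrier A \<Longrightarrow> (\<lambda>i\<in>{..<2}. if i = 0 then a else b) \<in> carrier F"
  by simp

declare free_left_module_simps [simp del]

lemma F_eqI:
  assumes "x \<in> carrier F" "y \<in> carrier F" "x 0 = y 0" "x 1 = y 1"
  shows "x = y"
proof (rule extensionalityI[of _ "{..<2}"])
  show "x i = y i" if "i \<in> {..<2}" for i
    using that assms(3,4) by (cases "i = 0") (auto simp: less_2_cases_iff)
qed (use assms in \<open>auto simp: PiE_def free_left_module_simps(1)\<close>)

lemma inj_enc: "inj_on enc (carrier F)"
  unfolding enc_def using free_module_encoding by (rule someI_ex)

lemma aug0_hom: "aug0 \<in> mod_hom A F (trivial_module K G)"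
  unfolding aug0_def
  by (rule mod_hom_restrictI[OF F.left_module_axioms]) (simp_all add: aug_add aug_mult)

lemma proj_L_hom: "proj_L \<in> mod_hom A F F"
  unfolding proj_L_def
  by (rule mod_hom_restrictI[OF F.left_module_axioms])
    (auto intro!: F_eqI simp: a0 A.l_distr A.m_assoc)

lemma proj_L_apply [simp]:
  assumes "x \<in> carrier F"
  shows "proj_L x 0 = \<zero>\<^bsub>A\<^esub>" "proj_L x (Suc 0) = x (Suc 0) \<otimes>\<^bsub>A\<^esub> a0" "proj_L x \<in> carrier F"
  using assms mod_homD(1)[OF proj_L_hom] by (simp_all add: proj_L_def)

lemma submodule_IA: "submodule IA A F"
  by (rule F.left_submoduleI) (auto simp: IA_def aug_zero aug_add aug_mult)

lemma submodule_OL: "submodule OL A F"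
  by (rule F.left_submoduleI) (auto simp: OL_def L_add L_mult zero_in_L)

lemma OL_subset_IA: "OL \<subseteq> IA"
  by (auto simp: OL_def IA_def aug_zero)

text \<open>Makes \<open>V3\<close> a copy of \<open>0 x L\<close>, the kernel of the projection
  from \<open>I x A\<close> onto \<open>V2\<close>.\<close>

lemma proj_L_image: "proj_L ` carrier F = OL"
proof
  show "proj_L ` carrier F \<subseteq> OL" by (auto simp: OL_def L_def)
  show "OL \<subseteq> proj_L ` carrier F"
  proof
    fix x assume x: "x \<in> OL"
    then obtain b where b: "b \<in> carrier A" "x 1 = b \<otimes>\<^bsub>A\<^esub> a0" by (auto simp: OL_def L_def)
    have "x = proj_L (\<lambda>i\<in>{..<2}. if i = 0 then \<zero>\<^bsub>A\<^esub> else b)"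
      using x b by (intro F_eqI) (auto simp: OL_def)
    then show "x \<in> proj_L ` carrier F" using b(1) by (intro image_eqI) auto
  qed
qed

sublocale E: left_module A E
  by (rule left_module_submodule[OF F.left_module_axioms submodule_IA])

text \<open>The same \<open>q\<close> serves for \<open>Q\<close> and for \<open>V2\<close>, so the
  inclusion of \<open>V2\<close> in \<open>Q\<close> is the identity on elements.\<close>

lemma q_eq_iff:
  "x \<in> carrier F \<Longrightarrow> y \<in> carrier F \<Longrightarrow> q x = q y \<longleftrightarrow> x \<ominus>\<^bsub>F\<^esub> y \<in> OL"
  using someI_ex[OF quotient_map_exists[OF F.left_module_axioms submodule_OL inj_enc]]
  unfolding q_def by blast

end

context embedded_simple
begin

lemma carrier_E [simp]: "carrier E = IA" "\<zero>\<^bsub>E\<^esub> = \<zero>\<^bsub>F\<^esub>"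
  by simp_all

lemma IA_subset: "IA \<subseteq> carrier F"
  by (auto simp: IA_def)

text \<open>Lets the elements of \<open>k\<close> enter the common type of the chain as constant
  sequences.\<close>

lemma inj_const: "inj_on (\<lambda>c. \<lambda>_ :: nat. c) B"
  by (auto intro!: inj_onI dest: fun_cong)

lemma
  shows left_module_V1: "left_module A V1"
    and V1_hom: "restrict (\<lambda>x _. aug0 x) (carrier F) \<in> mod_hom A F V1"
    and V1_kernel: "\<And>x. x \<in> carrier F \<Longrightarrow> (\<lambda>_. aug0 x) = \<zero>\<^bsub>V1\<^esub> \<longleftrightarrow> aug0 x = \<zero>"
  using image_module_of_hom[OF F.left_module_axioms left_module_trivial aug0_hom inj_const]
  unfolding V1_def by simp_all

lemma carrier_V1: "carrier V1 = (\<lambda>x _. aug0 x) ` carrier F"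
  by (simp add: V1_def)

lemma
  shows left_module_V3: "left_module A V3"
    and V3_hom: "restrict (\<lambda>x. enc (proj_L x)) (carrier F) \<in> mod_hom A F V3"
    and V3_kernel: "\<And>x. x \<in> carrier F \<Longrightarrow> enc (proj_L x) = \<zero>\<^bsub>V3\<^esub> \<longleftrightarrow> proj_L x = \<zero>\<^bsub>F\<^esub>"
  using image_module_of_hom[OF F.left_module_axioms F.left_module_axioms proj_L_hom inj_enc]
  unfolding V3_def by simp_all

lemma
  shows left_module_Q: "left_module A Q"
    and Q_hom: "restrict q (carrier F) \<in> mod_hom A F Q"
    and Q_kernel: "\<And>x. x \<in> carrier F \<Longrightarrow> q x = \<zero>\<^bsub>Q\<^esub> \<longleftrightarrow> x \<in> OL"
  using left_module_image_module[OF F.left_module_axioms submodule_OL q_eq_iff]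
    restrict_in_mod_hom_image_module[OF F.left_module_axioms submodule_OL q_eq_iff]
    image_module_eq_zero_iff[OF F.left_module_axioms submodule_OL q_eq_iff]
  unfolding Q_def by simp_all

text \<open>Negatives in \<open>E\<close> are formed within its smaller carrier; they agree with
  those of \<open>F\<close> because the inclusion is a homomorphism.\<close>

lemma E_minus:
  assumes "x \<in> IA" "y \<in> IA"
  shows "x \<ominus>\<^bsub>E\<^esub> y = x \<ominus>\<^bsub>F\<^esub> y"
proof -
  have xy: "x \<in> carrier F" "y \<in> carrier F" using assms IA_subset by auto
  have "restrict (\<lambda>x. x) IA \<in> mod_hom A E F"
    using mod_hom_restrictI[OF E.left_module_axioms, of "\<lambda>x. x" F] IA_subset by auto
  from mod_hom_minus[OF E.left_module_axioms F.left_module_axioms this, of x y]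
  show ?thesis using assms E.M.minus_closed[of x y] by simp
qed

lemma submodule_OL_E: "submodule OL A E"
  using submodule_restrict_iff[OF F.left_module_axioms submodule_IA] submodule_OL OL_subset_IA by blast

lemma q_eq_iff_E: "x \<in> carrier E \<Longrightarrow> y \<in> carrier E \<Longrightarrow> q x = q y \<longleftrightarrow> x \<ominus>\<^bsub>E\<^esub> y \<in> OL"
  using q_eq_iff[of x y] E_minus[of x y] IA_subset by auto

lemma
  shows left_module_V2: "left_module A V2"
    and V2_hom: "restrict q IA \<in> mod_hom A E V2"
    and V2_kernel: "\<And>x. x \<in> IA \<Longrightarrow> q x = \<zero>\<^bsub>V2\<^esub> \<longleftrightarrow> x \<in> OL"
  using left_module_image_module[OF E.left_module_axioms submodule_OL_E q_eq_iff_E]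
    restrict_in_mod_hom_image_module[OF E.left_module_axioms submodule_OL_E q_eq_iff_E]
    image_module_eq_zero_iff[OF E.left_module_axioms submodule_OL_E q_eq_iff_E]
  unfolding V2_def by simp_all

lemma carriers:
  "carrier Q = q ` carrier F" "carrier V2 = q ` IA" "carrier V3 = (\<lambda>x. enc (proj_L x)) ` carrier F"
  by (simp_all add: Q_def V2_def V3_def)

lemma fg_F: "fg_left_module A F"
  by (rule fg_left_module_free) (rule ring_group_algebra)

lemma fg_V1: "fg_left_module A V1"
  by (rule fg_left_module_image[OF fg_F left_module_V1 V1_hom]) (simp add: carrier_V1)

lemma fg_V3: "fg_left_module A V3"
  by (rule fg_left_module_image[OF fg_F left_module_V3 V3_hom]) (simp add: carriers)

lemma fg_V2: "fg_left_module A V2"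
proof -
  have "fg_left_module A E"
    using left_noetherian_group_algebra submodule_IA unfolding left_noetherian_def by blast
  then show ?thesis
    by (rule fg_left_module_image[OF _ left_module_V2 V2_hom]) (simp add: carriers)
qed

section \<open>Identification of the ends of the chain with k and T\<close>

lemma aug0_surj: "aug0 ` carrier F = carrier K"
proof
  show "aug0 ` carrier F \<subseteq> carrier K" by (auto simp: aug0_def)
  show "carrier K \<subseteq> aug0 ` carrier F"
  proof
    fix c assume c: "c \<in> carrier K"
    let ?u = "\<lambda>i\<in>{..<2}. if i = 0 then ind \<one>\<^bsub>G\<^esub> c else \<zero>\<^bsub>A\<^esub>"
    have u: "?u \<in> carrier F" using c by simp
    then have "c = aug0 ?u" using c by (simp add: aug0_def aug_ind)
    then show "c \<in> aug0 ` carrier F" using u by (rule image_eqI)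
  qed
qed

lemma V1_isomorphic_trivial: "mod_isomorphic A V1 (trivial_module K G)"
  by (rule mod_isomorphic_of_same_kernel[OF F.left_module_axioms left_module_V1 left_module_trivial
        V1_hom _ aug0_hom])
    (simp_all add: carrier_V1 aug0_surj V1_kernel)

lemma orbit_hom:
  assumes "i < 2"
  shows "restrict (\<lambda>x. x i \<odot>\<^bsub>T\<^esub> t0) (carrier F) \<in> mod_hom A F T"
  by (rule mod_hom_restrictI[OF F.left_module_axioms])
    (use assms t0 in \<open>simp_all add: T.smult_l_distr T.smult_assoc1\<close>)

lemma orbit_hom_surj:
  assumes "i < 2"
  shows "(\<lambda>x. x i \<odot>\<^bsub>T\<^esub> t0) ` carrier F = carrier T"
proof -
  have "(\<lambda>x. x i) ` carrier F = carrier A"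
  proof
    show "carrier A \<subseteq> (\<lambda>x. x i) ` carrier F"
    proof
      fix a assume "a \<in> carrier A"
      then show "a \<in> (\<lambda>x. x i) ` carrier F"
        using assms pair_in_F[of a a] by (intro image_eqI[of _ _ "\<lambda>i\<in>{..<2}. a"]) simp_all
    qed
  qed (use assms in auto)
  then have "(\<lambda>a. a \<odot>\<^bsub>T\<^esub> t0) ` (\<lambda>x. x i) ` carrier F = carrier T" using orbit_carrier by simp
  then show ?thesis by (simp add: image_image)
qed

lemma proj_L_eq_zero_iff:
  assumes "x \<in> carrier F"
  shows "proj_L x = \<zero>\<^bsub>F\<^esub> \<longleftrightarrow> x 1 \<otimes>\<^bsub>A\<^esub> a0 = \<zero>\<^bsub>A\<^esub>"
proof
  assume "proj_L x = \<zero>\<^bsub>F\<^esub>"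
  then have "proj_L x 1 = \<zero>\<^bsub>F\<^esub> 1" by simp
  then show "x 1 \<otimes>\<^bsub>A\<^esub> a0 = \<zero>\<^bsub>A\<^esub>" using assms by simp
qed (use assms in \<open>intro F_eqI; simp\<close>)

lemma V3_isomorphic_T: "mod_isomorphic A V3 T"
proof (rule mod_isomorphic_of_same_kernel[OF F.left_module_axioms left_module_V3
      T.left_module_axioms V3_hom _ orbit_hom[of 1]])
  show "restrict (\<lambda>x. enc (proj_L x)) (carrier F) x = \<zero>\<^bsub>V3\<^esub> \<longleftrightarrow>
    restrict (\<lambda>x. x 1 \<odot>\<^bsub>T\<^esub> t0) (carrier F) x = \<zero>\<^bsub>T\<^esub>" if "x \<in> carrier F" for x
    using that V3_kernel proj_L_eq_zero_iff annihilator_eq[of "x 1"] by simp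
qed (use orbit_hom_surj[of 1] in \<open>simp_all add: carriers\<close>)

text \<open>If \<open>x a0 = 0\<close>, then \<open>aug x aug a0 = 0\<close> and so
  \<open>aug x = 0\<close>. The annihilator of \<open>t0\<close> is thus contained in the
  augmentation ideal, and equals it by maximality.\<close>

lemma V1_isomorphic_T:
  assumes "aug a0 \<noteq> \<zero>"
  shows "mod_isomorphic A V1 T"
proof (rule mod_isomorphic_of_same_kernel[OF F.left_module_axioms left_module_V1
      T.left_module_axioms V1_hom _ orbit_hom[of 0]])
  have aug_zero_if: "aug x = \<zero>" if "x \<in> carrier A" "x \<odot>\<^bsub>T\<^esub> t0 = \<zero>\<^bsub>T\<^esub>" for x
  proof -
    have "aug x \<otimes> aug a0 = \<zero>"
      using annihilates[OF that] that(1) a0(1) aug_mult[of x a0] by (simp add: aug_zero)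
    then show ?thesis using assms that(1) a0(1) by (simp add: K.integral_iff)
  qed
  have "aug x = \<zero> \<longleftrightarrow> x \<odot>\<^bsub>T\<^esub> t0 = \<zero>\<^bsub>T\<^esub>" if "x \<in> carrier A" for x
  proof
    assume "aug x = \<zero>"
    then show "x \<odot>\<^bsub>T\<^esub> t0 = \<zero>\<^bsub>T\<^esub>"
      using that aug_zero_if
      by (intro annihilator_maximal[of "{x \<in> carrier A. aug x = \<zero>}"])
        (auto simp: aug_zero aug_one aug_add aug_mult)
  qed (use aug_zero_if that in blast)
  then show "restrict (\<lambda>x _. aug0 x) (carrier F) x = \<zero>\<^bsub>V1\<^esub> \<longleftrightarrow>
    restrict (\<lambda>x. x 0 \<odot>\<^bsub>T\<^esub> t0) (carrier F) x = \<zero>\<^bsub>T\<^esub>" if "x \<in> carrier F" for x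
    using that V1_kernel by (simp add: aug0_def)
qed (use orbit_hom_surj[of 0] in \<open>simp_all add: carrier_V1\<close>)

text \<open>The vanishing splits \<open>V2 -> Q -> V1\<close>. A lift to \<open>Q\<close> of the
  unit of \<open>k\<close> spans a copy of \<open>k\<close>; the relations of \<open>Q\<close> live
  in \<open>0 x L\<close>, so the first component of a representative satisfies the equations in
  \<open>A\<close> itself.\<close>

lemma invariant_of_Ext_zero:
  assumes "\<not> Ext_nonzero A 1 V1 V2"
  shows "\<exists>a\<in>carrier A. aug a = \<one> \<and> (\<forall>x\<in>carrier A. x \<otimes>\<^bsub>A\<^esub> a = ind \<one>\<^bsub>G\<^esub> (aug x) \<otimes>\<^bsub>A\<^esub> a)"
proof -
  obtain j where j: "j \<in> mod_hom A V2 Q" "\<And>x. x \<in> IA \<Longrightarrow> j (q x) = q x"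
  proof -
    have hom: "restrict q IA \<in> mod_hom A E Q"
      using mod_homD[OF Q_hom] IA_subset
      by (intro mod_homI) (auto simp: subset_eq left_module.left_submoduleD[OF F.left_module_axioms submodule_IA])
    have "\<exists>s\<in>mod_hom A V2 Q. \<forall>x\<in>carrier E. s (restrict q IA x) = restrict q IA x"
      by (rule mod_hom_factor[OF E.left_module_axioms left_module_V2 left_module_Q V2_hom _ hom])
        (use V2_kernel Q_kernel IA_subset in \<open>auto simp: carriers\<close>)
    then show ?thesis using that by auto
  qed
  obtain \<pi> where \<pi>: "\<pi> \<in> mod_hom A Q V1" "\<And>x. x \<in> carrier F \<Longrightarrow> \<pi> (q x) = (\<lambda>_. aug0 x)"
  proof -
    have "\<exists>s\<in>mod_hom A Q V1. \<forall>x\<in>carrier F. s (restrict q (carrier F) x) = restrict (\<lambda>x _. aug0 x) (carrier F) x"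
      by (rule mod_hom_factor[OF F.left_module_axioms left_module_Q left_module_V1 Q_hom _ V1_hom])
        (use V1_kernel Q_kernel OL_subset_IA in \<open>auto simp: carriers IA_def aug0_def\<close>)
    then show ?thesis using that by auto
  qed
  have IA_iff: "\<pi> (q x) = \<zero>\<^bsub>V1\<^esub> \<longleftrightarrow> x \<in> IA" if "x \<in> carrier F" for x
    using that \<pi>(2) V1_kernel by (simp add: IA_def aug0_def)
  have "\<exists>s\<in>mod_hom A V1 Q. \<forall>v\<in>carrier V1. \<pi> (s v) = v"
  proof (rule split_of_Ext_one_zero[OF ring_group_algebra left_noetherian_group_algebra fg_V1
        left_module_V2 left_module_Q j(1) _ \<pi>(1) _ _ assms])
    show "inj_on j (carrier V2)" by (auto intro!: inj_onI simp: carriers j(2))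
    show "\<pi> ` carrier Q = carrier V1" by (simp add: carriers carrier_V1 image_image \<pi>(2) cong: image_cong)
    show "j ` carrier V2 = {x \<in> carrier Q. \<pi> x = \<zero>\<^bsub>V1\<^esub>}"
      using IA_iff IA_subset j(2) by (auto simp: carriers image_image)
  qed
  then obtain s where s: "s \<in> mod_hom A V1 Q" "\<And>v. v \<in> carrier V1 \<Longrightarrow> \<pi> (s v) = v" by blast
  \<comment> \<open>\<open>u\<close> represents the unit of \<open>k\<close>, \<open>v\<close> is
    its class in \<open>V1\<close>, and \<open>z\<close> will represent the image of
    \<open>v\<close> under the splitting.\<close>
  define u where "u = (\<lambda>i\<in>{..<2::nat}. if i = 0 then \<one>\<^bsub>A\<^esub> else \<zero>\<^bsub>A\<^esub>)"
  define v where "v = (\<lambda>_ :: nat. aug0 u)"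
  have u: "u \<in> carrier F" by (simp add: u_def)
  then have v: "v \<in> carrier V1" by (auto simp: v_def carrier_V1)
  obtain z where z: "z \<in> carrier F" "s v = q z"
    using mod_homD(1)[OF s(1) v] by (auto simp: carriers)
  have "\<pi> (q z) = v" using s(2)[OF v] z by simp
  then have augz: "aug (z 0) = \<one>"
    using \<pi>(2)[OF z(1)] z(1) u by (simp add: v_def aug0_def u_def aug_one fun_eq_iff)
  have "x \<otimes>\<^bsub>A\<^esub> z 0 = ind \<one>\<^bsub>G\<^esub> (aug x) \<otimes>\<^bsub>A\<^esub> z 0" if x: "x \<in> carrier A" for x
  proof -
    have act: "y \<odot>\<^bsub>V1\<^esub> v = (\<lambda>_. aug0 (y \<odot>\<^bsub>F\<^esub> u))" if "y \<in> carrier A" for y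
      using mod_homD(4)[OF V1_hom that u] F.smult_closed[OF that u] u by (simp add: v_def)
    have qact: "q (y \<odot>\<^bsub>F\<^esub> z) = y \<odot>\<^bsub>Q\<^esub> s v" if "y \<in> carrier A" for y
      using mod_homD(4)[OF Q_hom that z(1)] F.smult_closed[OF that z(1)] z by simp
    let ?c = "ind \<one>\<^bsub>G\<^esub> (aug x)"
    have c: "?c \<in> carrier A" using x by simp
    \<comment> \<open>\<open>x\<close> and the scalar \<open>aug x\<close> act alike on the trivial
      module; the splitting carries this over to \<open>Q\<close>.\<close>
    have "x \<odot>\<^bsub>V1\<^esub> v = ?c \<odot>\<^bsub>V1\<^esub> v"
      unfolding act[OF x] act[OF c] using x c u F.smult_closed[OF x u] F.smult_closed[OF c u]
      by (simp add: aug0_def aug_mult aug_ind)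
    then have "q (x \<odot>\<^bsub>F\<^esub> z) = q (?c \<odot>\<^bsub>F\<^esub> z)"
      unfolding qact[OF x] qact[OF c] mod_homD(4)[OF s(1) x v, symmetric]
        mod_homD(4)[OF s(1) c v, symmetric] by simp
    then have "x \<odot>\<^bsub>F\<^esub> z \<ominus>\<^bsub>F\<^esub> ?c \<odot>\<^bsub>F\<^esub> z \<in> OL"
      using q_eq_iff F.smult_closed[OF x z(1)] F.smult_closed[OF c z(1)] by blast
    then have "x \<otimes>\<^bsub>A\<^esub> z 0 \<ominus>\<^bsub>A\<^esub> ?c \<otimes>\<^bsub>A\<^esub> z 0 = \<zero>\<^bsub>A\<^esub>"
      using F.smult_closed[OF x z(1)] F.smult_closed[OF c z(1)] by (simp add: OL_def)
    then show ?thesis by (rule A.minus_eq_zeroD[rotated 2]) (use x c z(1) in simp_all)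
  qed
  then show ?thesis using augz z(1) by (intro bexI[of _ "z 0"]) auto
qed

text \<open>The vanishing splits the projection from \<open>I x A\<close> to \<open>V2\<close> and
  so yields a retraction onto \<open>0 x L\<close>. The retraction sends \<open>(0, 1)\<close> to
  \<open>(0, f)\<close> and fixes \<open>(0, l)\<close>, which is \<open>l (0, 1)\<close>; hence
  \<open>l f = l\<close>.\<close>

lemma idempotent_of_Ext_zero:
  assumes "\<not> Ext_nonzero A 1 V2 V3"
  shows "\<exists>f\<in>L. \<forall>l\<in>L. l \<otimes>\<^bsub>A\<^esub> f = l"
proof -
  obtain j where j: "j \<in> mod_hom A V3 E" "\<And>x. x \<in> carrier F \<Longrightarrow> j (enc (proj_L x)) = proj_L x"
  proof -
    have hom: "proj_L \<in> mod_hom A F E"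
      using mod_homD[OF proj_L_hom] proj_L_image OL_subset_IA
      by (intro mod_homI) auto
    have "\<exists>s\<in>mod_hom A V3 E. \<forall>x\<in>carrier F. s (restrict (\<lambda>x. enc (proj_L x)) (carrier F) x) = proj_L x"
      by (rule mod_hom_factor[OF F.left_module_axioms left_module_V3 E.left_module_axioms V3_hom _ hom])
        (use V3_kernel in \<open>auto simp: carriers\<close>)
    then show ?thesis using that by auto
  qed
  have "\<exists>s\<in>mod_hom A V2 E. \<forall>v\<in>carrier V2. restrict q IA (s v) = v"
  proof (rule split_of_Ext_one_zero[OF ring_group_algebra left_noetherian_group_algebra fg_V2
        left_module_V3 E.left_module_axioms j(1) _ V2_hom _ _ assms])
    show "inj_on j (carrier V3)" by (auto intro!: inj_onI simp: carriers j(2))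
    have "j ` carrier V3 = proj_L ` carrier F"
      by (simp add: carriers image_image j(2) cong: image_cong)
    then show "j ` carrier V3 = {x \<in> carrier E. restrict q IA x = \<zero>\<^bsub>V2\<^esub>}"
      using proj_L_image V2_kernel OL_subset_IA by auto
  qed (simp add: carriers)
  then obtain s where s: "s \<in> mod_hom A V2 E" "\<And>v. v \<in> carrier V2 \<Longrightarrow> restrict q IA (s v) = v" by blast
  define b where "b = (\<lambda>i\<in>{..<2::nat}. if i = 0 then \<zero>\<^bsub>A\<^esub> else \<one>\<^bsub>A\<^esub>)"
  have b: "b \<in> carrier F" "b \<in> IA" by (simp_all add: b_def IA_def aug_zero)
  have qb: "q b \<in> carrier V2" using b by (simp add: carriers)
  define c where "c = s (q b)"
  have c: "c \<in> IA" "q c = q b" using mod_homD(1)[OF s(1) qb] s(2)[OF qb] by (simp_all add: c_def)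
  have cF: "c \<in> carrier F" using c(1) IA_subset by blast
  have "b \<ominus>\<^bsub>F\<^esub> c \<in> OL" using q_eq_iff[OF b(1) cF] c(2) by simp
  then have f: "\<one>\<^bsub>A\<^esub> \<ominus>\<^bsub>A\<^esub> c 1 \<in> L" using b(1) cF by (simp add: OL_def b_def)
  have "l \<otimes>\<^bsub>A\<^esub> (\<one>\<^bsub>A\<^esub> \<ominus>\<^bsub>A\<^esub> c 1) = l" if l: "l \<in> L" for l
  proof -
    have lA: "l \<in> carrier A" using l L_subset by blast
    \<comment> \<open>\<open>l b = (0, l)\<close> lies in \<open>0 x L\<close>, so \<open>l\<close>
      annihilates the class of \<open>b\<close> and therefore also its image
      \<open>c\<close>.\<close>
    have lb: "l \<odot>\<^bsub>F\<^esub> b \<in> OL"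
      using lA l b(1) F.smult_closed[OF lA b(1)] by (simp add: OL_def b_def)
    then have lbI: "l \<odot>\<^bsub>F\<^esub> b \<in> IA" using OL_subset_IA by blast
    have "l \<odot>\<^bsub>V2\<^esub> q b = q (l \<odot>\<^bsub>F\<^esub> b)"
      using mod_homD(4)[OF V2_hom lA, of b] b(2) lbI by simp
    also have "\<dots> = \<zero>\<^bsub>V2\<^esub>" using V2_kernel[OF lbI] lb by simp
    finally have "l \<odot>\<^bsub>V2\<^esub> q b = \<zero>\<^bsub>V2\<^esub>" .
    then have "l \<odot>\<^bsub>F\<^esub> c = \<zero>\<^bsub>F\<^esub>"
      using mod_homD(4)[OF s(1) lA qb] mod_hom_zero[OF left_module_V2 E.left_module_axioms s(1)]
      by (simp add: c_def)
    then have "(l \<odot>\<^bsub>F\<^esub> c) 1 = \<zero>\<^bsub>F\<^esub> 1" by simp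
    then have "l \<otimes>\<^bsub>A\<^esub> c 1 = \<zero>\<^bsub>A\<^esub>" by simp
    then show ?thesis using lA cF by (simp add: A.minus_eq A.r_distr A.r_minus)
  qed
  then show ?thesis using f by blast
qed

lemma chain_to_T:
  assumes block: "block A e" and e: "aug e \<noteq> \<zero>" "e \<odot>\<^bsub>T\<^esub> t0 = t0"
  shows "\<exists>(n::nat) (V :: nat \<Rightarrow> ('g \<Rightarrow> 'k, nat \<Rightarrow> 'k) module) (f :: nat \<Rightarrow> nat).
     n \<ge> 1 \<and>
     (\<forall>i\<in>{1..n}. fg_left_module A (V i)) \<and>
     mod_isomorphic A (V 1) (trivial_module K G) \<and>
     mod_isomorphic A (V n) T \<and>
     (\<forall>i\<in>{1..<n}. f i > 0 \<and> Ext_nonzero A (f i) (V i) (V (i + 1)))"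
\<comment> \<open>A nonzero value yields \<open>T \<cong> k\<close>. The value may be zero for
  trivial \<open>T\<close> as well, as happens for a nontrivial \<open>p\<close>-group; the chain
  with three terms covers that case too.\<close>
proof (cases "aug a0 = \<zero>")
  case False
  then show ?thesis
    using fg_V1 V1_isomorphic_trivial V1_isomorphic_T by (intro exI[of _ 1] exI[of _ "\<lambda>_. V1"]) auto
next
  case True
  have eA: "e \<in> carrier A" and ec: "\<And>x. x \<in> carrier A \<Longrightarrow> e \<otimes>\<^bsub>A\<^esub> x = x \<otimes>\<^bsub>A\<^esub> e"
    using block unfolding block_def ring_center_def by blast+
  have augL: "aug l = \<zero>" if "l \<in> L" for l
    using that True a0(1) by (auto simp: L_def aug_mult)
  \<comment> \<open>\<open>e - 1\<close> annihilates \<open>t0\<close>, hence \<open>a0\<close>;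
    centrality of \<open>e\<close> extends this to \<open>L\<close>.\<close>
  have el: "e \<otimes>\<^bsub>A\<^esub> l = l" if l: "l \<in> L" for l
  proof -
    have "(e \<ominus>\<^bsub>A\<^esub> \<one>\<^bsub>A\<^esub>) \<odot>\<^bsub>T\<^esub> t0 = \<zero>\<^bsub>T\<^esub>"
      using T.smult_diff_distr[OF eA A.one_closed t0(1)] e(2) t0(1) T.eq_of_minus_eq_zero[of t0 t0] by simp
    then have "e \<otimes>\<^bsub>A\<^esub> a0 \<ominus>\<^bsub>A\<^esub> a0 = \<zero>\<^bsub>A\<^esub>"
      using annihilates[of "e \<ominus>\<^bsub>A\<^esub> \<one>\<^bsub>A\<^esub>"] eA a0(1) A.r_distr_minus(2)[OF eA A.one_closed a0(1)] by simp
    then have ea0: "e \<otimes>\<^bsub>A\<^esub> a0 = a0" using A.minus_eq_zeroD[of "e \<otimes>\<^bsub>A\<^esub> a0" a0] eA a0(1) by simp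
    obtain x where x: "x \<in> carrier A" "l = x \<otimes>\<^bsub>A\<^esub> a0" using l by (auto simp: L_def)
    have "e \<otimes>\<^bsub>A\<^esub> l = x \<otimes>\<^bsub>A\<^esub> (e \<otimes>\<^bsub>A\<^esub> a0)"
      using x eA a0(1) ec[OF x(1)] by (simp add: A.m_assoc[symmetric])
    then show ?thesis using ea0 x(2) by simp
  qed
  have "Ext_nonzero A 1 V1 V2"
  proof (rule ccontr)
    assume "\<not> Ext_nonzero A 1 V1 V2"
    then obtain a where a: "a \<in> carrier A" "aug a = \<one>"
      and inv: "\<And>x. x \<in> carrier A \<Longrightarrow> x \<otimes>\<^bsub>A\<^esub> a = ind \<one>\<^bsub>G\<^esub> (aug x) \<otimes>\<^bsub>A\<^esub> a"
      using invariant_of_Ext_zero by blast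
    have ind1: "ind \<one>\<^bsub>G\<^esub> \<one> = \<one>\<^bsub>A\<^esub>" by (simp add: one_group_algebra)
    have ind0: "ind \<one>\<^bsub>G\<^esub> \<zero> = \<zero>\<^bsub>A\<^esub>" by (auto simp: ind_def group_algebra_simps)
    have aa: "a \<otimes>\<^bsub>A\<^esub> a = a" using inv[OF a(1)] a ind1 by simp
    \<comment> \<open>This is the line through \<open>a\<close>, a projective copy of
      \<open>k\<close>: each \<open>x a\<close> is the scalar \<open>aug x\<close> times
      \<open>a\<close>, and \<open>a\<close> is its right identity.\<close>
    let ?L = "(\<lambda>x. x \<otimes>\<^bsub>A\<^esub> a) ` carrier A"
    have "\<exists>y\<in>carrier A. y \<in> ring_center A \<and> y \<otimes>\<^bsub>A\<^esub> y = y \<and> (\<forall>l\<in>?L. y \<otimes>\<^bsub>A\<^esub> l = l) \<and>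
      (\<forall>n\<in>carrier A. (\<forall>l\<in>?L. n \<otimes>\<^bsub>A\<^esub> l = \<zero>\<^bsub>A\<^esub>) \<longrightarrow> y \<otimes>\<^bsub>A\<^esub> n = \<zero>\<^bsub>A\<^esub>)"
    proof (rule central_idempotent_exists[where f = a])
      show "?L \<subseteq> carrier A" using a(1) by auto
      then show "?L \<subseteq> carrier A" .
      show "u \<ominus>\<^bsub>A\<^esub> v \<in> ?L" if uv: "u \<in> ?L" "v \<in> ?L" for u v
      proof -
        from uv obtain x y where "x \<in> carrier A" "y \<in> carrier A" "u = x \<otimes>\<^bsub>A\<^esub> a" "v = y \<otimes>\<^bsub>A\<^esub> a" by blast
        then show ?thesis
          using a(1) by (intro image_eqI[of _ _ "x \<ominus>\<^bsub>A\<^esub> y"]) (auto simp: A.r_distr_minus)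
      qed
      show "x \<otimes>\<^bsub>A\<^esub> u \<in> ?L" if xu: "x \<in> carrier A" "u \<in> ?L" for x u
      proof -
        from xu obtain y where "y \<in> carrier A" "u = y \<otimes>\<^bsub>A\<^esub> a" by blast
        then show ?thesis
          using a(1) xu(1) by (intro image_eqI[of _ _ "x \<otimes>\<^bsub>A\<^esub> y"]) (auto simp: A.m_assoc)
      qed
      show "a \<in> ?L" using a(1) by (intro image_eqI[of _ _ "\<one>\<^bsub>A\<^esub>"]) auto
      show "l \<otimes>\<^bsub>A\<^esub> a = l" if "l \<in> ?L" for l
        using that a(1) aa by (auto simp: A.m_assoc)
      show "\<exists>d\<in>carrier A. d \<otimes>\<^bsub>A\<^esub> w = a" if w: "w \<in> ?L" "w \<noteq> \<zero>\<^bsub>A\<^esub>" for w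
      proof -
        obtain x where x: "x \<in> carrier A" "w = ind \<one>\<^bsub>G\<^esub> (aug x) \<otimes>\<^bsub>A\<^esub> a" using w(1) inv by auto
        have "aug x \<noteq> \<zero>" using x w(2) ind0 a(1) by auto
        then have c: "inv (aug x) \<in> carrier K" "inv (aug x) \<otimes> aug x = \<one>"
          using x(1) by (simp_all add: K.field_Units)
        let ?d = "ind \<one>\<^bsub>G\<^esub> (inv (aug x))" and ?x = "ind \<one>\<^bsub>G\<^esub> (aug x)"
        have dA: "?d \<in> carrier A" "?x \<in> carrier A" using c x(1) by simp_all
        have "?d \<otimes>\<^bsub>A\<^esub> w = (?d \<otimes>\<^bsub>A\<^esub> ?x) \<otimes>\<^bsub>A\<^esub> a" using dA a(1) x(2) by (simp add: A.m_assoc)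
        also have "\<dots> = ind \<one>\<^bsub>G\<^esub> (aug (?d \<otimes>\<^bsub>A\<^esub> ?x)) \<otimes>\<^bsub>A\<^esub> a" using dA by (intro inv) simp
        also have "\<dots> = a" using dA c x(1) a(1) ind1 by (simp add: aug_mult aug_ind)
        finally show ?thesis using dA(1) by blast
      qed
    qed (simp_all add: A.ring_simprules)
    then obtain y where y: "y \<in> carrier A" "y \<in> ring_center A" "y \<otimes>\<^bsub>A\<^esub> y = y"
      and yl: "\<forall>l\<in>?L. y \<otimes>\<^bsub>A\<^esub> l = l"
      and yn: "\<forall>n\<in>carrier A. (\<forall>l\<in>?L. n \<otimes>\<^bsub>A\<^esub> l = \<zero>\<^bsub>A\<^esub>) \<longrightarrow> y \<otimes>\<^bsub>A\<^esub> n = \<zero>\<^bsub>A\<^esub>"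
      by (elim bexE conjE)
    have "a \<in> ?L" using a(1) by (intro image_eqI[of _ _ "\<one>\<^bsub>A\<^esub>"]) auto
    with yl have "y \<otimes>\<^bsub>A\<^esub> a = a" by (rule bspec)
    \<comment> \<open>Taking augmentations in \<open>y a = a\<close> with \<open>aug a = 1\<close>;
      as \<open>aug e\<close> is nonzero, \<open>e y\<close> cannot vanish.\<close>
    then have "aug y = \<one>" using aug_mult[OF y(1) a(1)] a y(1) by simp
    then have "aug (e \<otimes>\<^bsub>A\<^esub> y) \<noteq> \<zero>" using e(1) eA y(1) by (simp add: aug_mult)
    then have "e \<otimes>\<^bsub>A\<^esub> y \<noteq> \<zero>\<^bsub>A\<^esub>" using aug_zero by auto
    then have ey: "e \<otimes>\<^bsub>A\<^esub> y = e"
      by (rule A.block_mult_central_idempotent[OF block y(2,3)])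
    \<comment> \<open>\<open>a0\<close> lies in the augmentation ideal, which annihilates the line
      through \<open>a\<close>. Therefore \<open>y a0 = 0\<close>, although \<open>e y = e\<close>
      fixes \<open>a0\<close>.\<close>
    have "a0 \<otimes>\<^bsub>A\<^esub> l = \<zero>\<^bsub>A\<^esub>" if "l \<in> ?L" for l
    proof -
      obtain x where x: "x \<in> carrier A" "l = x \<otimes>\<^bsub>A\<^esub> a" using \<open>l \<in> ?L\<close> by blast
      then have "a0 \<otimes>\<^bsub>A\<^esub> l = (a0 \<otimes>\<^bsub>A\<^esub> x) \<otimes>\<^bsub>A\<^esub> a" using a(1) a0(1) by (simp add: A.m_assoc)
      also have "\<dots> = \<zero>\<^bsub>A\<^esub>"
        using inv[of "a0 \<otimes>\<^bsub>A\<^esub> x"] x(1) a(1) a0(1) True ind0 by (simp add: aug_mult)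
      finally show ?thesis .
    qed
    then have "y \<otimes>\<^bsub>A\<^esub> a0 = \<zero>\<^bsub>A\<^esub>" using a0(1) yn by blast
    moreover have "a0 = (e \<otimes>\<^bsub>A\<^esub> y) \<otimes>\<^bsub>A\<^esub> a0" using ey el[OF a0_in_L] by simp
    ultimately show False using a0 eA y(1) by (simp add: A.m_assoc)
  qed
  moreover have "Ext_nonzero A 1 V2 V3"
  proof (rule ccontr)
    assume "\<not> Ext_nonzero A 1 V2 V3"
    then obtain f where f: "f \<in> L" "\<And>l. l \<in> L \<Longrightarrow> l \<otimes>\<^bsub>A\<^esub> f = l"
      using idempotent_of_Ext_zero by blast
    \<comment> \<open>As \<open>aug a0 = 0\<close>, the ideal \<open>L\<close> lies in the
      augmentation ideal; with the latter for \<open>H\<close> the idempotent has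
      \<open>aug y = 0\<close>. But \<open>y\<close> fixes \<open>a0\<close>, which forces
      \<open>e y = e\<close> and contradicts \<open>aug e \<noteq> 0\<close>.\<close>
    have "\<exists>y\<in>{x \<in> carrier A. aug x = \<zero>}. y \<in> ring_center A \<and> y \<otimes>\<^bsub>A\<^esub> y = y \<and> (\<forall>l\<in>L. y \<otimes>\<^bsub>A\<^esub> l = l) \<and>
      (\<forall>n\<in>carrier A. (\<forall>l\<in>L. n \<otimes>\<^bsub>A\<^esub> l = \<zero>\<^bsub>A\<^esub>) \<longrightarrow> y \<otimes>\<^bsub>A\<^esub> n = \<zero>\<^bsub>A\<^esub>)"
      by (rule central_idempotent_exists[OF L_subset L_minus L_mult f L_minimal[OF _ _ f(1)]])
        (use augL L_subset in \<open>auto simp: aug_zero aug_add aug_mult\<close>)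
    then obtain y where y: "y \<in> carrier A" "aug y = \<zero>" "y \<in> ring_center A" "y \<otimes>\<^bsub>A\<^esub> y = y"
      and yl: "\<And>l. l \<in> L \<Longrightarrow> y \<otimes>\<^bsub>A\<^esub> l = l"
      by blast
    have "(e \<otimes>\<^bsub>A\<^esub> y) \<otimes>\<^bsub>A\<^esub> a0 = a0"
      using yl[OF a0_in_L] el[OF a0_in_L] eA y(1) a0(1) by (simp add: A.m_assoc)
    then have "e \<otimes>\<^bsub>A\<^esub> y \<noteq> \<zero>\<^bsub>A\<^esub>" using a0 by auto
    then have "e \<otimes>\<^bsub>A\<^esub> y = e"
      by (rule A.block_mult_central_idempotent[OF block y(3,4)])
    then show False using aug_mult[OF eA y(1)] e(1) y(2) eA by simp
  qed
  ultimately show ?thesis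
    using fg_V1 fg_V2 fg_V3 V1_isomorphic_trivial V3_isomorphic_T
    by (intro exI[of _ 3] exI[of _ "\<lambda>i. if i = 1 then V1 else if i = 2 then V2 else V3"] exI[of _ "\<lambda>_. 1"])
      (auto simp: numeral_3_eq_3 numeral_2_eq_2 less_Suc_eq)
qed

end

text \<open>The annihilator of \<open>t0\<close> is a left ideal that misses \<open>1\<close>, so
  the symmetrizing form supplies a nonzero element which it kills from the left.\<close>

lemma (in finite_group_algebra) embedded_simple_exists:
  assumes simple: "simple_left_module A T" and t0: "t0 \<in> carrier T" "t0 \<noteq> \<zero>\<^bsub>T\<^esub>"
  shows "\<exists>a0. embedded_simple G K T t0 a0"
proof -
  interpret T: left_module A T using simple by (simp add: simple_left_module_def)
  define M where "M = {x \<in> carrier A. x \<odot>\<^bsub>T\<^esub> t0 = \<zero>\<^bsub>T\<^esub>}"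
  have ideal: "x \<otimes>\<^bsub>A\<^esub> m \<in> M" if "x \<in> carrier A" "m \<in> M" for x m
    using that t0(1) by (simp add: M_def T.smult_assoc1)
  have "submodule M K V"
    by (rule subspaceI) (use t0(1) ideal in \<open>auto simp: M_def T.smult_l_distr\<close>)
  moreover have "M \<noteq> carrier A"
  proof
    assume "M = carrier A"
    then have "\<one>\<^bsub>A\<^esub> \<in> M" by simp
    then show False using t0 by (simp add: M_def)
  qed
  ultimately obtain a0 where "a0 \<in> carrier A" "a0 \<noteq> \<zero>\<^bsub>A\<^esub>" "\<forall>m\<in>M. m \<otimes>\<^bsub>A\<^esub> a0 = \<zero>\<^bsub>A\<^esub>"
    using right_annihilator_nontrivial ideal by blast
  then have "embedded_simple G K T t0 a0"
    using simple t0 by unfold_locales (auto simp: M_def)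
  then show ?thesis by blast
qed

theorem mainTheorem1:
  fixes G :: "('g, 's) monoid_scheme"
    and K :: "('k, 'r) ring_scheme"
    and p :: nat
    and e :: "'g \<Rightarrow> 'k"
    and T :: "('g \<Rightarrow> 'k, 't, 'm) module_scheme"
  assumes "group G" and "finite (carrier G)"
    and "Factorial_Ring.prime p"
    and "field K" and "ring_characteristic K = p"
    and "principal_block K G e"
    and "simple_left_module (group_algebra K G) T"
    and "belongs_to_block T e"
  shows "\<exists>(n::nat) (V :: nat \<Rightarrow> ('g \<Rightarrow> 'k, nat \<Rightarrow> 'k) module) (f :: nat \<Rightarrow> nat).
     n \<ge> 1 \<and>
     (\<forall>i\<in>{1..n}. fg_left_module (group_algebra K G) (V i)) \<and>
     mod_isomorphic (group_algebra K G) (V 1) (trivial_module K G) \<and>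
     mod_isomorphic (group_algebra K G) (V n) T \<and>
     (\<forall>i\<in>{1..<n}. f i > 0 \<and> Ext_nonzero (group_algebra K G) (f i) (V i) (V (i + 1)))"
proof -
  interpret finite_group_algebra G K
    using assms(1,2,4) by (simp add: finite_group_algebra_def function_space_def function_space_axioms_def)
  have T: "left_module A T" "carrier T \<noteq> {\<zero>\<^bsub>T\<^esub>}"
    using assms(7) by (auto simp: simple_left_module_def)
  interpret T: left_module A T by fact
  obtain t0 where t0: "t0 \<in> carrier T" "t0 \<noteq> \<zero>\<^bsub>T\<^esub>"
    using T(2) T.M.zero_closed by blast
  obtain a0 where "embedded_simple G K T t0 a0"
    using embedded_simple_exists[OF assms(7) t0] by blast
  then interpret S: embedded_simple G K T t0 a0 .
  have block: "block A e" and e: "belongs_to_block (trivial_module K G) e"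
    using assms(6) by (simp_all add: principal_block_def)
  have eA: "e \<in> carrier A" "e \<otimes>\<^bsub>A\<^esub> e = e"
    using block unfolding block_def ring_center_def by blast+
  \<comment> \<open>\<open>e\<close> acts on \<open>k\<close> as multiplication by
    \<open>aug e\<close>, and this action is onto.\<close>
  have "aug e \<noteq> \<zero>\<^bsub>K\<^esub>"
  proof
    assume "aug e = \<zero>\<^bsub>K\<^esub>"
    moreover have "\<one>\<^bsub>K\<^esub> \<in> (\<lambda>u. aug e \<otimes>\<^bsub>K\<^esub> u) ` carrier K"
      using e by (simp add: belongs_to_block_def)
    ultimately show False by auto
  qed
  \<comment> \<open>An element in the image of the idempotent \<open>e\<close> is fixed by
    \<open>e\<close>.\<close>
  moreover have "t0 \<in> (\<lambda>u. e \<odot>\<^bsub>T\<^esub> u) ` carrier T"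
    using assms(8) t0(1) by (simp add: belongs_to_block_def)
  then obtain u where u: "u \<in> carrier T" "t0 = e \<odot>\<^bsub>T\<^esub> u" by blast
  then have "e \<odot>\<^bsub>T\<^esub> t0 = t0"
    using T.smult_assoc1[OF eA(1) eA(1) u(1)] eA(2) by simp
  ultimately show ?thesis by (rule S.chain_to_T[OF block])
qed

end
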